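(* Suppose $r$ is a number such that $0<r<1$. Then there exists (on some probability space) a strictly stationary, countable-state, irreducible, aperiodic Markov chain $X := (X_k, k\in\mathbb{Z})$ which is reversible and has the following three properties: (1) $H(\sigma(X_0)) \le r$. (2) For every positive integer $n$, $$\max\{\rho(X,n),\ \beta(X,n),\ I(X,n)\} \le r^n.$$ (3) For every positive integer $n$, $$\rho^*(X,n) = \rho\bigl(\sigma(X_0),\ \sigma(X_{-n},X_n)\bigr) = 1.$$
   Context: Let $(\Omega,\mathcal{F},P)$ be the underlying probability space. The notation $\sigma(\dots)$ means the $\sigma$-field generated by $(\dots)$, and $\log$ is the natural logarithm. For events $A,B$ with $P(A)>0$ and $P(B)>0$, put $\eta(A,B) := \dfrac{P(A\cap B)}{P(A)P(B)}$. For $\sigma$-fields $\mathcal{A},\mathcal{B}\subset\mathcal{F}$ define: - $\rho(\mathcal{A},\mathcal{B}) := \sup|\mathrm{Corr}(f,g)|$, the supremum over all pairs of (real-valued) square-integrable random variables $f$, $g$ such that $f$ is $\mathcal{A}$-measurable and $g$ is $\mathcal{B}$-measurable (a correlation involving an a.s. constant variable is taken to be $0$). - $\beta(\mathcal{A},\mathcal{B}) := \sup \frac12\sum_{i=1}^I\sum_{j=1}^J |P(A_i\cap B_j)-P(A_i)P(B_j)|$, and - $I(\mathcal{A},\mathcal{B}) := \sup \sum_{i=1}^I\sum_{j=1}^J [\eta(A_i,B_j)\log\eta(A_i,B_j)]\,P(A_i)P(B_j)$ (with $0\log 0:=0$; the value may be $+\infty$), where in each of the last two the supremum is taken over all pairs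 of finite partitions $\{A_1,\dots,A_I\}$ and $\{B_1,\dots,B_J\}$ of $\Omega$ such that $A_i\in\mathcal{A}$ and $P(A_i)>0$ for each $i$, and $B_j\in\mathcal{B}$ and $P(B_j)>0$ for each $j$. For a strictly stationary sequence $X=(X_k,k\in\mathbb{Z})$ and a positive integer $n$, define $$\rho(X,n) := \rho(\sigma(X_k,k\le 0),\sigma(X_k,k\ge n)),$$ $$\beta(X,n) := \beta(\sigma(X_k,k\le 0),\sigma(X_k,k\ge n)),$$ $$I(X,n) := I(\sigma(X_k,k\le 0),\sigma(X_k,k\ge n)),$$ $$\rho^*(X,n) := \sup\rho(\sigma(X_k,k\in S),\sigma(X_k,k\in T)),$$ where the last supremum is taken over all pairs of nonempty disjoint sets $S,T\subset\mathbb{Z}$ such that $\mathrm{dist}(S,T):=\min_{s\in S,t\in T}|s-t|\ge n$. For a purely atomic $\sigma$-field $\mathcal{A}$ with (finitely or countably many) atoms $A_1,A_2,\dots$, the entropy is $H(\mathcal{A}) := -\sum_k P(A_k)\log P(A_k)$. A strictly stationary Markov chain $X=(X_k,k\in\mathbb{Z})$ is "reversible" if the time-reversed chain $(X_{-k},k\in\mathbb{Z})$ has the same distribution as $X$; equivalently, $(X_1,X_0)$ has the same distribution as $(X_0,X_1)$. "Countable-state" means that the random variables $X_k$ take their values in a fixed countable set (equipped with the $\sigma$-field of all its subsets). *)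

theory Defs
  imports "HOL-Probability.Probability"
begin

text \<open>Following \<^const>\<open>subalgebra\<close>, a sub-\<sigma>-field of \<^term>\<open>M\<close> is represented by a measure
  object, of which only the space and the measurable sets matter. Suprema are taken in
  \<^typ>\<open>ereal\<close>, so that no boundedness is needed for them to be meaningful.\<close>

definition corr :: "'a measure \<Rightarrow> ('a \<Rightarrow> real) \<Rightarrow> ('a \<Rightarrow> real) \<Rightarrow> real" where
  \<comment> \<open>equals \<open>0\<close> if one of the variables is a.s. constant, as \<open>x / 0 = 0\<close>\<close>
  "corr M f g =
     (\<integral>\<omega>. (f \<omega> - (\<integral>x. f x \<partial>M)) * (g \<omega> - (\<integral>x. g x \<partial>M)) \<partial>M) /
     sqrt ((\<integral>\<omega>. (f \<omega> - (\<integral>x. f x \<partial>M))\<^sup>2 \<partial>M) * (\<integral>\<omega>. (g \<omega> - (\<integral>x. g x \<partial>M))\<^sup>2 \<partial>M))"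

definition square_integrable :: "'a measure \<Rightarrow> 'a measure \<Rightarrow> ('a \<Rightarrow> real) set" where
  "square_integrable M F = {f \<in> borel_measurable F. integrable M (\<lambda>\<omega>. (f \<omega>)\<^sup>2)}"

definition rho_coeff :: "'a measure \<Rightarrow> 'a measure \<Rightarrow> 'a measure \<Rightarrow> ereal" where
  "rho_coeff M A B =
     (SUP (f, g) \<in> square_integrable M A \<times> square_integrable M B. ereal \<bar>corr M f g\<bar>)"

definition positive_partitions :: "'a measure \<Rightarrow> 'a measure \<Rightarrow> 'a set set set" where
  "positive_partitions M F =
     {P. finite P \<and> partition_on (space M) P \<and> P \<subseteq> sets F \<and> (\<forall>A\<in>P. measure M A > 0)}"

definition beta_coeff :: "'a measure \<Rightarrow> 'a measure \<Rightarrow> 'a measure \<Rightarrow> ereal" where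
  "beta_coeff M A B =
     (SUP (P, Q) \<in> positive_partitions M A \<times> positive_partitions M B.
        ereal (1 / 2 * (\<Sum>C\<in>P. \<Sum>D\<in>Q. \<bar>measure M (C \<inter> D) - measure M C * measure M D\<bar>)))"

definition eta :: "'a measure \<Rightarrow> 'a set \<Rightarrow> 'a set \<Rightarrow> real" where
  "eta M C D = measure M (C \<inter> D) / (measure M C * measure M D)"

definition info_coeff :: "'a measure \<Rightarrow> 'a measure \<Rightarrow> 'a measure \<Rightarrow> ereal" where
  "info_coeff M A B =
     (SUP (P, Q) \<in> positive_partitions M A \<times> positive_partitions M B.
        ereal (\<Sum>C\<in>P. \<Sum>D\<in>Q. eta M C D * ln (eta M C D) * (measure M C * measure M D)))"

definition prob_atom :: "'a measure \<Rightarrow> 'a measure \<Rightarrow> 'a set \<Rightarrow> bool" where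
  "prob_atom M F A \<longleftrightarrow> A \<in> sets F \<and> measure M A > 0 \<and>
     (\<forall>B\<in>sets F. B \<subseteq> A \<longrightarrow> measure M B = 0 \<or> measure M B = measure M A)"

definition atom_decomposition :: "'a measure \<Rightarrow> 'a measure \<Rightarrow> 'a set set \<Rightarrow> bool" where
  "atom_decomposition M F C \<longleftrightarrow>
     countable C \<and> disjoint C \<and> (\<forall>A\<in>C. prob_atom M F A) \<and> measure M (\<Union>C) = 1"

definition purely_atomic :: "'a measure \<Rightarrow> 'a measure \<Rightarrow> bool" where
  "purely_atomic M F \<longleftrightarrow> (\<exists>C. atom_decomposition M F C)"

text \<open>Two atom decompositions of the same \<sigma>-field agree up to null sets, so the sum does not
  depend on the one chosen. Its terms are nonnegative, hence \<^const>\<open>ennreal\<close> truncates nothing.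
  A \<sigma>-field that is not purely atomic has entropy \<^term>\<open>\<infinity>\<close> by the usual convention.\<close>

definition field_entropy :: "'a measure \<Rightarrow> 'a measure \<Rightarrow> ennreal" where
  "field_entropy M F =
     (if purely_atomic M F
      then \<Sum>\<^sub>\<infinity>A\<in>(SOME C. atom_decomposition M F C). ennreal (- (measure M A * ln (measure M A)))
      else \<infinity>)"

text \<open>The \<sigma>-field \<open>\<sigma>(X\<^sub>k, k \<in> K)\<close>, where the \<open>X\<^sub>k\<close> take values in the measurable space \<^term>\<open>N\<close>.\<close>

definition generated_field ::
    "'a measure \<Rightarrow> 's measure \<Rightarrow> (int \<Rightarrow> 'a \<Rightarrow> 's) \<Rightarrow> int set \<Rightarrow> 'a measure" where
  "generated_field M N X K =
     sigma (space M) {X k -` E \<inter> space M | k E. k \<in> K \<and> E \<in> sets N}"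

definition rho_mix :: "'a measure \<Rightarrow> 's measure \<Rightarrow> (int \<Rightarrow> 'a \<Rightarrow> 's) \<Rightarrow> nat \<Rightarrow> ereal" where
  "rho_mix M N X n =
     rho_coeff M (generated_field M N X {..0}) (generated_field M N X {int n..})"

definition beta_mix :: "'a measure \<Rightarrow> 's measure \<Rightarrow> (int \<Rightarrow> 'a \<Rightarrow> 's) \<Rightarrow> nat \<Rightarrow> ereal" where
  "beta_mix M N X n =
     beta_coeff M (generated_field M N X {..0}) (generated_field M N X {int n..})"

definition info_mix :: "'a measure \<Rightarrow> 's measure \<Rightarrow> (int \<Rightarrow> 'a \<Rightarrow> 's) \<Rightarrow> nat \<Rightarrow> ereal" where
  "info_mix M N X n =
     info_coeff M (generated_field M N X {..0}) (generated_field M N X {int n..})"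

definition index_dist :: "int set \<Rightarrow> int set \<Rightarrow> nat" where
  \<comment> \<open>for nonempty \<open>S\<close> and \<open>T\<close> the infimum of this set of naturals is its minimum\<close>
  "index_dist S T = Inf {nat \<bar>s - t\<bar> | s t. s \<in> S \<and> t \<in> T}"

definition rho_star :: "'a measure \<Rightarrow> 's measure \<Rightarrow> (int \<Rightarrow> 'a \<Rightarrow> 's) \<Rightarrow> nat \<Rightarrow> ereal" where
  "rho_star M N X n =
     (SUP (S, T) \<in> {(S, T). S \<noteq> {} \<and> T \<noteq> {} \<and> S \<inter> T = {} \<and> n \<le> index_dist S T}.
        rho_coeff M (generated_field M N X S) (generated_field M N X T))"

definition path_law ::
    "'a measure \<Rightarrow> 's measure \<Rightarrow> (int \<Rightarrow> 'a \<Rightarrow> 's) \<Rightarrow> (int \<Rightarrow> 's) measure" where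
  "path_law M N X = distr M (PiM UNIV (\<lambda>_. N)) (\<lambda>\<omega> k. X k \<omega>)"

definition strictly_stationary ::
    "'a measure \<Rightarrow> 's measure \<Rightarrow> (int \<Rightarrow> 'a \<Rightarrow> 's) \<Rightarrow> bool" where
  "strictly_stationary M N X \<longleftrightarrow>
     (\<forall>k. X k \<in> measurable M N) \<and> (\<forall>m. path_law M N (\<lambda>k. X (k + m)) = path_law M N X)"

definition reversible ::
    "'a measure \<Rightarrow> 's measure \<Rightarrow> (int \<Rightarrow> 'a \<Rightarrow> 's) \<Rightarrow> bool" where
  "reversible M N X \<longleftrightarrow> path_law M N (\<lambda>k. X (- k)) = path_law M N X"

definition countable_state_markov_chain ::
    "'a measure \<Rightarrow> 's set \<Rightarrow> (int \<Rightarrow> 'a \<Rightarrow> 's) \<Rightarrow> bool" where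
  "countable_state_markov_chain M S X \<longleftrightarrow>
     countable S \<and> (\<forall>k. X k \<in> measurable M (count_space S)) \<and>
     (\<forall>k m x. \<forall>y\<in>S. \<P>(\<omega> in M. \<forall>i\<in>{k - int m..k}. X i \<omega> = x i) > 0 \<longrightarrow>
        \<P>(\<omega> in M. X (k + 1) \<omega> = y \<bar> \<forall>i\<in>{k - int m..k}. X i \<omega> = x i) =
        \<P>(\<omega> in M. X (k + 1) \<omega> = y \<bar> X k \<omega> = x k))"

text \<open>The next two notions are for stationary chains, whose \<open>n\<close>-step transition probabilities
  are those from time \<open>0\<close> to time \<open>n\<close>. As conditioning on a null event gives \<open>0\<close>, irreducibility
  on \<^term>\<open>S\<close> implies that every state in \<^term>\<open>S\<close> has positive probability.\<close>

definition irreducible_chain :: "'a measure \<Rightarrow> 's set \<Rightarrow> (int \<Rightarrow> 'a \<Rightarrow> 's) \<Rightarrow> bool" where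
  "irreducible_chain M S X \<longleftrightarrow>
     (\<forall>i\<in>S. \<forall>j\<in>S. \<exists>n\<ge>1. \<P>(\<omega> in M. X (int n) \<omega> = j \<bar> X 0 \<omega> = i) > 0)"

definition aperiodic_chain :: "'a measure \<Rightarrow> 's set \<Rightarrow> (int \<Rightarrow> 'a \<Rightarrow> 's) \<Rightarrow> bool" where
  "aperiodic_chain M S X \<longleftrightarrow>
     (\<forall>i\<in>S. Gcd {n::nat. n \<ge> 1 \<and> \<P>(\<omega> in M. X (int n) \<omega> = i \<bar> X 0 \<omega> = i) > 0} = 1)"

end

theory Submission
  imports Defs
begin

text \<open>
  If the joint law of \<open>(X\<^sub>0, X\<^sub>n)\<close> has density \<open>h\<^sub>n\<close> with respect to the product of its marginals, then by the
  Markov property \<open>h\<^sub>n(X\<^sub>0, X\<^sub>n)\<close> is the density of the joint law of past and future, and by the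
  Cauchy-Schwarz inequality \<open>\<rho>(X, n)\<^sup>2\<close>, \<open>\<beta>(X, n)\<^sup>2\<close> and \<open>I(X, n)\<close> are at most \<open>\<chi>\<^sup>2(n) = E (h\<^sub>n - 1)\<^sup>2\<close> (for \<open>I\<close> one uses
  \<open>ln t \<le> t - 1\<close>). This is a squared Hilbert-Schmidt norm, hence \<open>\<chi>\<^sup>2(n) \<le> \<chi>\<^sup>2(1)\<^sup>n\<close>, and it suffices to
  make \<open>\<chi>\<^sup>2(1) \<le> r\<^sup>2\<close>.

  The chain is a random walk on a weighted graph in which infinitely many ``spiders'' are attached to
  one base vertex. From the centre of a spider the walk very likely runs straight down one of the many legs,
  and conversely a walk that is found at level \<open>n\<close> of two different legs at times \<open>-n\<close> and \<open>n\<close> must be at the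
  centre at time \<open>0\<close>, unless it has passed through the base. For small weights the latter is much less
  likely than a visit to the centre. So the indicators of \<open>X\<^sub>0 =\<close> centre and of this event for \<open>(X\<^sub>-\<^sub>n, X\<^sub>n)\<close>
  have correlation tending to \<open>1\<close> along the spiders.
\<close>

section \<open>Path measures\<close>

text \<open>The obstacle is that past and future may each know almost nothing about the present,
  while together they must determine it. One leg vertex at level \<open>n\<close> is poor evidence
  for the centre \<open>n\<close> steps earlier: the masses grow outwards along a leg, and by
  reversibility the walk seen backwards from that vertex also tends to run outwards. Two vertices on
  different legs, however, are connected only through the centre or the base. Three quantities are
  balanced. Many legs make it unlikely that two independent runs from the centre choose the same
  one. A large ratio of consecutive weights keeps the runs from turning back, and it also pays for
  the size of the spider in the Hilbert-Schmidt norm. A small scale is needed because the mass of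
  the centre is of first order in it, whereas a path that starts in a spider, visits the base and
  ends in the same spider has a probability of second order. A single spider yields only a
  correlation close to 1. Both the number and the length of the legs grow with \<open>j\<close>, so
  one chain serves all \<open>n\<close> and all error levels.\<close>

abbreviation (input) coord :: "int \<Rightarrow> (int \<Rightarrow> nat) \<Rightarrow> nat" where "coord k \<omega> \<equiv> \<omega> k"

abbreviation (input) path_space :: "(int \<Rightarrow> nat) measure" where
  "path_space \<equiv> PiM UNIV (\<lambda>_. count_space UNIV)"

definition cyl :: "int set \<Rightarrow> (int \<Rightarrow> nat) \<Rightarrow> (int \<Rightarrow> nat) set" where
  "cyl I x = {\<omega>. \<forall>i\<in>I. \<omega> i = x i}"

text \<open>Over an increasing sequence of windows two cylinders are nested or disjoint, so adding
  the empty set makes the family stable under intersection, as a generator for uniqueness of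
  measures has to be.\<close>

definition cyls :: "(nat \<Rightarrow> int set) \<Rightarrow> (int \<Rightarrow> nat) set set" where
  "cyls I = insert {} {cyl (I n) x | n x. True}"

lemma countable_PiE_nat: "finite I \<Longrightarrow> countable (PiE I (\<lambda>_. UNIV :: nat set))"
  by (rule countable_PiE) auto

text \<open>The index functions are fixed outside \<open>I\<close>, which makes the union countable
  for finite \<open>I\<close>.\<close>

lemma Union_cyl: "(\<Union>x\<in>{x\<in>PiE I (\<lambda>_. UNIV). P x}. cyl I x) = {\<omega>. P (restrict \<omega> I)}"
proof (intro set_eqI iffI)
  fix \<omega> assume "\<omega> \<in> (\<Union>x\<in>{x\<in>PiE I (\<lambda>_. UNIV). P x}. cyl I x)"
  then obtain x where x: "x \<in> PiE I (\<lambda>_. UNIV)" "P x" "\<omega> \<in> cyl I x" by auto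
  have "restrict \<omega> I = x" using x(1,3) by (auto simp: cyl_def restrict_def PiE_def extensional_def)
  then show "\<omega> \<in> {\<omega>. P (restrict \<omega> I)}" using x(2) by simp
next
  fix \<omega> assume "\<omega> \<in> {\<omega>. P (restrict \<omega> I)}"
  then show "\<omega> \<in> (\<Union>x\<in>{x\<in>PiE I (\<lambda>_. UNIV). P x}. cyl I x)"
    by (intro UN_I[of "restrict \<omega> I"]) (auto simp: cyl_def)
qed

lemma Int_stable_cyls:
  assumes "incseq I" shows "Int_stable (cyls I)"
proof (rule Int_stableI)
  have *: "cyl (I m) x \<inter> cyl (I n) y \<in> cyls I" if "m \<le> n" for m n x y
  proof (cases "cyl (I m) x \<inter> cyl (I n) y = {}")
    case False
    then obtain \<omega> where w: "\<omega> \<in> cyl (I m) x" "\<omega> \<in> cyl (I n) y" by auto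
    have "I m \<subseteq> I n" using assms that by (simp add: incseqD)
    then have "cyl (I m) x \<inter> cyl (I n) y = cyl (I n) y" using w by (auto simp: cyl_def subset_iff)
    then show ?thesis by (auto simp: cyls_def)
  qed (auto simp: cyls_def)
  fix a b assume "a \<in> cyls I" "b \<in> cyls I"
  then consider "a = {} \<or> b = {}" | m x n y where "a = cyl (I m) x" "b = cyl (I n) y"
    by (auto simp: cyls_def)
  then show "a \<inter> b \<in> cyls I"
  proof cases
    case 2 then show ?thesis using *[of m n x y] *[of n m y x] by (metis Int_commute nle_le)
  qed (auto simp: cyls_def)
qed

lemma sets_generated_field_cyls:
  fixes M :: "(int \<Rightarrow> nat) measure"
  assumes I: "incseq I" "\<And>n. finite (I n)" "(\<Union>n. I n) = J" and sp: "space M = UNIV" and "J \<noteq> {}"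
  shows "sets (generated_field M (count_space UNIV) coord J) = sigma_sets UNIV (cyls I)"
proof -
  have "sigma_sets UNIV {coord k -` E \<inter> UNIV | k E. k \<in> J \<and> E \<in> sets (count_space UNIV)}
      = sigma_sets UNIV (cyls I)" (is "sigma_sets _ ?G = _")
  proof (rule sigma_sets_eqI)
    fix a assume "a \<in> ?G"
    then obtain k E where a: "a = coord k -` E" "k \<in> J" by auto
    then obtain n where n: "k \<in> I n" using I(3) by auto
    \<comment> \<open>An event about time \<open>k\<close> is a countable union of cylinders over
      any window that contains \<open>k\<close>.\<close>
    have "a = (\<Union>x\<in>{x\<in>PiE (I n) (\<lambda>_. UNIV). x k \<in> E}. cyl (I n) x)"
      unfolding Union_cyl using n a by auto
    also have "\<dots> \<in> sigma_sets UNIV (cyls I)"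
      by (rule sigma_sets_UNION)
        (auto intro!: countable_image countable_subset[OF _ countable_PiE_nat[OF I(2)[of n]]] sigma_sets.Basic simp: cyls_def)
    finally show "a \<in> sigma_sets UNIV (cyls I)" .
  next
    fix b assume "b \<in> cyls I"
    then consider "b = {}" | n x where "b = cyl (I n) x" by (auto simp: cyls_def)
    then show "b \<in> sigma_sets UNIV ?G"
    proof cases
      case 2
      interpret sigma_algebra UNIV "sigma_sets UNIV ?G" by (rule sigma_algebra_sigma_sets) auto
      have "{\<omega>\<in>UNIV. \<forall>i\<in>I n. \<omega> i = x i} \<in> sigma_sets UNIV ?G"
      proof (rule sets_Collect_finite_All)
        fix i assume "i \<in> I n"
        then have "i \<in> J" using I(3) by auto
        moreover have "{\<omega>\<in>UNIV. \<omega> i = x i} = coord i -` {x i} \<inter> UNIV" by auto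
        ultimately have "{\<omega>\<in>UNIV. \<omega> i = x i} \<in> ?G"
          by (intro CollectI exI[of _ i] exI[of _ "{x i}"]) auto
        then show "{\<omega>\<in>UNIV. \<omega> i = x i} \<in> sigma_sets UNIV ?G" by (rule sigma_sets.Basic)
      qed (rule I(2))
      then show ?thesis using 2 by (simp add: cyl_def)
    qed (simp add: sigma_sets.Empty)
  qed
  then show ?thesis by (simp add: generated_field_def sp)
qed

lemma sets_path_space_cyls:
  assumes I: "incseq I" "\<And>n. finite (I n)" "(\<Union>n. I n) = UNIV"
  shows "sets path_space = sigma_sets UNIV (cyls I)"
proof -
  have "sets path_space = sets (generated_field path_space (count_space UNIV) coord UNIV)"
    by (auto simp: generated_field_def space_PiM sets_PiM_single intro!: arg_cong[where f="sigma_sets UNIV"])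
  also have "\<dots> = sigma_sets UNIV (cyls I)"
    by (rule sets_generated_field_cyls[OF I]) (auto simp: space_PiM)
  finally show ?thesis .
qed

lemma cyl_sets [measurable]: "finite I \<Longrightarrow> cyl I x \<in> sets path_space"
proof -
  assume "finite I"
  then have "{\<omega>\<in>space path_space. \<forall>i\<in>I. \<omega> i = x i} \<in> sets path_space"
    by measurable
  then show ?thesis by (simp add: cyl_def space_PiM)
qed

text \<open>The chain is driven by independent \<open>Y\<^sub>k\<^sub>,\<^sub>x \<sim> K x\<close>: from state \<open>x\<close> the chain moves to
  \<open>Y\<^sub>k\<^sub>,\<^sub>x\<close> at time \<open>k\<close>, both into the future and, by reversibility, into the past.\<close>

fun fwd :: "(int \<times> nat \<Rightarrow> nat) \<Rightarrow> nat \<Rightarrow> nat" where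
  "fwd Y 0 = Y (0, 0)"
| "fwd Y (Suc n) = Y (int (Suc n), fwd Y n)"

fun bwd :: "(int \<times> nat \<Rightarrow> nat) \<Rightarrow> nat \<Rightarrow> nat" where
  "bwd Y 0 = Y (0, 0)"
| "bwd Y (Suc n) = Y (- int (Suc n), bwd Y n)"

definition path_of :: "(int \<times> nat \<Rightarrow> nat) \<Rightarrow> int \<Rightarrow> nat" where
  "path_of Y k = (if k \<ge> 0 then fwd Y (nat k) else bwd Y (nat (- k)))"

text \<open>The state from which the move that produces the value at time \<open>k\<close> starts;
  it sits at the neighbour of \<open>k\<close> closer to 0. At time 0 the path reads
  \<open>Y (0, 0)\<close>, hence the dummy value 0.\<close>

definition src :: "(int \<Rightarrow> nat) \<Rightarrow> int \<Rightarrow> nat" where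
  "src x k = (if k = 0 then 0 else if k > 0 then x (k - 1) else x (k + 1))"

lemma path_of_rec: "path_of Y k = Y (k, src (path_of Y) k)"
proof -
  consider "k = 0" | n where "k = int (Suc n)" | n where "k = - int (Suc n)"
    by (metis int_cases not0_implies_Suc of_nat_0)
  then show ?thesis
  proof cases
    case 2 then show ?thesis by (simp add: path_of_def src_def nat_add_distrib)
  next
    case 3
    then have "k + 1 = - int n" "nat (- k) = Suc n" "k < 0" by auto
    then show ?thesis using 3 by (cases "n = 0") (auto simp: path_of_def src_def)
  qed (simp add: path_of_def src_def)
qed

text \<open>Following a prescribed path on a window that contains 0 tests exactly one driving
  variable per time. These variables have different indices, so independence turns the probability
  into a product.\<close>

lemma path_of_cyl_iff:
  assumes "a \<le> 0" "0 \<le> b"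
  shows "path_of Y \<in> cyl {a..b} x \<longleftrightarrow> (\<forall>k\<in>{a..b}. Y (k, src x k) = x k)"
proof
  assume L: "path_of Y \<in> cyl {a..b} x"
  have "src (path_of Y) k = src x k" if "k \<in> {a..b}" for k
    using L that assms by (auto simp: cyl_def src_def)
  then show "\<forall>k\<in>{a..b}. Y (k, src x k) = x k" using L path_of_rec[of Y] by (auto simp: cyl_def)
next
  assume R: "\<forall>k\<in>{a..b}. Y (k, src x k) = x k"
  have "fwd Y n = x (int n)" if "int n \<le> b" for n using that
  proof (induction n)
    case 0 then show ?case using R assms by (force simp: src_def)
  next
    case (Suc n) then show ?case using bspec[OF R, of "int (Suc n)"] assms by (auto simp: src_def)
  qed
  moreover have "bwd Y n = x (- int n)" if "- int n \<ge> a" for n using that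
  proof (induction n)
    case 0 then show ?case using R assms by (force simp: src_def)
  next
    case (Suc n) 
    have "src x (- int (Suc n)) = x (- int n)" by (auto simp: src_def)
    then show ?case using bspec[OF R, of "- int (Suc n)"] Suc assms by auto
  qed
  ultimately show "path_of Y \<in> cyl {a..b} x" by (auto simp: cyl_def path_of_def)
qed

lemma path_of_measurable [measurable]:
  "path_of \<in> measurable (PiM UNIV (\<lambda>_. count_space UNIV)) path_space"
proof -
  have f[measurable]: "(\<lambda>Y. fwd Y n) \<in> measurable (PiM UNIV (\<lambda>_. count_space UNIV)) (count_space UNIV)" for n
  proof (induction n)
    case (Suc n)
    note [measurable] = Suc
    show ?case unfolding fwd.simps 
      by (rule measurable_compose_countable[where g="\<lambda>Y. fwd Y n"]) auto
  qed simp
  have b[measurable]: "(\<lambda>Y. bwd Y n) \<in> measurable (PiM UNIV (\<lambda>_. count_space UNIV)) (count_space UNIV)" for n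
  proof (induction n)
    case (Suc n)
    note [measurable] = Suc
    show ?case unfolding bwd.simps 
      by (rule measurable_compose_countable[where g="\<lambda>Y. bwd Y n"]) auto
  qed simp
  show ?thesis
  proof (rule measurable_PiM_single')
    fix k :: int
    show "(\<lambda>Y. path_of Y k) \<in> measurable (PiM UNIV (\<lambda>_. count_space UNIV)) (count_space UNIV)"
      unfolding path_of_def by (cases "k \<ge> 0") auto
  qed auto
qed

section \<open>Two-sided path measure of a reversible kernel\<close>

locale reversible_kernel =
  fixes p :: "nat pmf" and K :: "nat \<Rightarrow> nat pmf"
  assumes balance: "pmf p x * pmf (K x) y = pmf p y * pmf (K y) x"
    and p_pos: "pmf p x > 0"
begin

definition path_weight :: "int \<Rightarrow> int \<Rightarrow> (int \<Rightarrow> nat) \<Rightarrow> real" where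
  "path_weight a b x = pmf p (x a) * (\<Prod>i\<in>{a<..b}. pmf (K (x (i - 1))) (x i))"

definition drive :: "int \<times> nat \<Rightarrow> nat measure" where
  "drive i = measure_pmf (if fst i = 0 then p else K (snd i))"

definition path_measure :: "(int \<Rightarrow> nat) measure" where
  "path_measure = distr (PiM UNIV drive) path_space path_of"

text \<open>Detailed balance moves the factor of \<open>p\<close> along the path, one edge per
  induction step, and turns each backward transition into a forward one.\<close>

lemma path_weight_backward:
  "n \<ge> 0 \<Longrightarrow> pmf p (x 0) * (\<Prod>i\<in>{-int n..<0}. pmf (K (x (i + 1))) (x i)) = path_weight (- int n) 0 x"
proof (induction n)
  case 0 then show ?case by (simp add: path_weight_def)
next
  case (Suc n)
  let ?m = "- int (Suc n)"
  have 1: "{?m..<0} = insert ?m {- int n..<0}" by auto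
  have 2: "{?m<..0} = insert (- int n) {- int n<..0}" by auto
  have "pmf p (x 0) * (\<Prod>i\<in>{?m..<0}. pmf (K (x (i + 1))) (x i))
    = pmf (K (x (- int n))) (x ?m) * path_weight (- int n) 0 x"
    unfolding 1 using Suc by (subst prod.insert) auto
  also have "\<dots> = (pmf p (x (- int n)) * pmf (K (x (- int n))) (x ?m)) * (\<Prod>i\<in>{- int n<..0}. pmf (K (x (i - 1))) (x i))"
    by (simp add: path_weight_def)
  also have "\<dots> = (pmf p (x ?m) * pmf (K (x ?m)) (x (- int n))) * (\<Prod>i\<in>{- int n<..0}. pmf (K (x (i - 1))) (x i))"
    by (subst balance) (rule refl)
  also have "\<dots> = path_weight ?m 0 x"
  proof -
    have "(\<Prod>i\<in>{?m<..0}. pmf (K (x (i - 1))) (x i)) =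
        pmf (K (x (- int n - 1))) (x (- int n)) * (\<Prod>i\<in>{- int n<..0}. pmf (K (x (i - 1))) (x i))"
      unfolding 2 by (subst prod.insert) auto
    moreover have "- int n - 1 = ?m" by simp
    ultimately show ?thesis unfolding path_weight_def by (simp only: mult.assoc)
  qed
  finally show ?case .
qed

lemma path_of_measurable_pmf:
  "path_of \<in> measurable (PiM UNIV drive) path_space"
proof -
  have "sets (PiM UNIV drive) = sets (PiM UNIV (\<lambda>_. count_space UNIV))"
    by (rule sets_PiM_cong) (auto simp: drive_def)
  then show ?thesis using path_of_measurable measurable_cong_sets[OF _ refl] by blast
qed

lemma prob_space_path_measure: "prob_space path_measure"
proof -
  have "prob_space (PiM UNIV drive)"
    by (rule prob_space_PiM) (auto simp: drive_def measure_pmf.prob_space_axioms)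
  then show ?thesis unfolding path_measure_def
    using path_of_measurable_pmf by (rule prob_space.prob_space_distr)
qed

lemma sets_path_measure [measurable_cong]: "sets path_measure = sets path_space"
  by (simp add: path_measure_def)

lemma space_path_measure [simp]: "space path_measure = UNIV"
  by (simp add: path_measure_def space_PiM)

text \<open>The window has to contain 0 because the construction starts there;
  \<open>measure_cyl\<close> removes this restriction once stationarity is known.\<close>

lemma measure_cyl_around_0:
  assumes ab: "a \<le> 0" "0 \<le> b"
  shows "measure path_measure (cyl {a..b} x) = path_weight a b x"
proof -
  let ?J = "(\<lambda>k. (k, src x k)) ` {a..b}"
  note pm = path_of_measurable_pmf
  have sp: "space (PiM UNIV drive) = UNIV" by (auto simp: space_PiM drive_def)
  have spd: "space (drive i) = UNIV" for i by (simp add: drive_def)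
  have vim: "path_of -` cyl {a..b} x \<inter> space (PiM UNIV drive) = prod_emb UNIV drive ?J (Pi\<^sub>E ?J (\<lambda>i. {x (fst i)}))"
    (is "_ = ?E")
  proof (rule set_eqI)
    fix Y
    have "Y \<in> ?E \<longleftrightarrow> (\<forall>i\<in>?J. Y i = x (fst i))"
      by (auto simp: prod_emb_def space_PiM spd restrict_PiE_iff simp del: restrict_PiE)
    then show "Y \<in> path_of -` cyl {a..b} x \<inter> space (PiM UNIV drive) \<longleftrightarrow> Y \<in> ?E"
      unfolding sp using path_of_cyl_iff[OF ab, of Y x] by simp
  qed
  have "measure path_measure (cyl {a..b} x) = measure (PiM UNIV drive) (prod_emb UNIV drive ?J (Pi\<^sub>E ?J (\<lambda>i. {x (fst i)})))"
    unfolding path_measure_def vim[symmetric] by (rule measure_distr[OF pm]) simp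
  also have "\<dots> = (\<Prod>i\<in>?J. measure (drive i) {x (fst i)})"
  proof -
    have "emeasure (PiM UNIV drive) (prod_emb UNIV drive ?J (Pi\<^sub>E ?J (\<lambda>i. {x (fst i)})))
        = (\<Prod>i\<in>?J. emeasure (drive i) {x (fst i)})"
      by (rule emeasure_PiM_emb) (simp_all add: drive_def measure_pmf.prob_space_axioms)
    also have "\<dots> = ennreal (\<Prod>i\<in>?J. measure (drive i) {x (fst i)})"
      by (subst prod_ennreal[symmetric]) (simp_all add: drive_def measure_pmf.emeasure_eq_measure)
    finally show ?thesis by (simp add: measure_def prod_nonneg)
  qed
  also have "\<dots> = (\<Prod>k\<in>{a..b}. pmf (if k = 0 then p else K (src x k)) (x k))"
    by (subst prod.reindex) (auto simp: inj_on_def drive_def measure_pmf_single intro!: prod.cong)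
  finally have *: "measure path_measure (cyl {a..b} x) = \<dots>" .
  have split: "{a..b} = insert 0 ({a..<0} \<union> {0<..b})" using ab by auto
  have "(\<Prod>k\<in>{a..b}. pmf (if k = 0 then p else K (src x k)) (x k))
     = pmf p (x 0) * ((\<Prod>k\<in>{a..<0}. pmf (if k = 0 then p else K (src x k)) (x k)) * (\<Prod>k\<in>{0<..b}. pmf (if k = 0 then p else K (src x k)) (x k)))"
    unfolding split by (subst prod.insert; (subst prod.union_disjoint)?) auto
  also have "(\<Prod>k\<in>{a..<0}. pmf (if k = 0 then p else K (src x k)) (x k)) = (\<Prod>k\<in>{a..<0}. pmf (K (x (k + 1))) (x k))"
    by (rule prod.cong) (auto simp: src_def)
  also have "(\<Prod>k\<in>{0<..b}. pmf (if k = 0 then p else K (src x k)) (x k)) = (\<Prod>k\<in>{0<..b}. pmf (K (x (k - 1))) (x k))"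
    by (rule prod.cong) (auto simp: src_def)
  also have "pmf p (x 0) * ((\<Prod>k\<in>{a..<0}. pmf (K (x (k + 1))) (x k)) * (\<Prod>k\<in>{0<..b}. pmf (K (x (k - 1))) (x k)))
     = path_weight a 0 x * (\<Prod>k\<in>{0<..b}. pmf (K (x (k - 1))) (x k))"
    using path_weight_backward[of "nat (- a)" x] ab by simp
  also have "\<dots> = path_weight a b x"
  proof -
    have "{a<..b} = {a<..0} \<union> {0<..b}" using ab by auto
    then show ?thesis unfolding path_weight_def by (simp add: prod.union_disjoint)
  qed
  finally show ?thesis using * by simp
qed

end

section \<open>Dependence coefficients and the \<open>\<chi>\<^sup>2\<close>-distance\<close>

text \<open>Includes \<open>v = 0\<close>, where the quotient is 0 by convention, just as the
  correlation with a constant variable is.\<close>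

lemma abs_div_le: "\<bar>c\<bar> \<le> v * s \<Longrightarrow> 0 \<le> v \<Longrightarrow> 0 \<le> s \<Longrightarrow> \<bar>c / v\<bar> \<le> s" for c v s :: real
  by (cases "v = 0") (simp_all add: abs_divide divide_le_eq mult.commute)

text \<open>The law of \<open>(\<omega>, \<omega>)\<close> on the product of the two sub-fields is
  their joint law. It has to agree with the density \<open>h\<close> only on that product, although
  \<open>h\<close> itself lives on the product of the full spaces.\<close>

locale square_density = prob_space M for M :: "'a measure" +
  fixes F G :: "'a measure" and h :: "'a \<times> 'a \<Rightarrow> real"
  assumes sub: "subalgebra M F" "subalgebra M G"
    and h_meas [measurable]: "h \<in> borel_measurable (M \<Otimes>\<^sub>M M)" and h_nonneg: "\<And>z. h z \<ge> 0"
    and joint: "distr M (F \<Otimes>\<^sub>M G) (\<lambda>\<omega>. (\<omega>, \<omega>)) = distr (density (M \<Otimes>\<^sub>M M) h) (F \<Otimes>\<^sub>M G) (\<lambda>z. z)"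
    and h_sq: "integrable (M \<Otimes>\<^sub>M M) (\<lambda>z. (h z - 1)\<^sup>2)"
begin

sublocale MM: pair_prob_space M M ..

definition chi2 :: real where "chi2 = (\<integral>z. (h z - 1)\<^sup>2 \<partial>(M \<Otimes>\<^sub>M M))"

lemma chi2_nonneg: "chi2 \<ge> 0" by (simp add: chi2_def)

lemma meas_sub:
  "f \<in> borel_measurable F \<Longrightarrow> f \<in> borel_measurable M" "g \<in> borel_measurable G \<Longrightarrow> g \<in> borel_measurable M"
  using measurable_from_subalg sub by blast+

text \<open>The sets \<open>C\<close> and \<open>D\<close> localise the bound: taken to be the whole space they give the correlation
  coefficient, taken with indicators they give the single cells of a pair of partitions.\<close>

lemma cov_square_le:
  assumes f: "f \<in> square_integrable M F" and g: "g \<in> square_integrable M G"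
    and C: "C \<in> sets F" "\<And>x. x \<in> space M - C \<Longrightarrow> f x = 0" and D: "D \<in> sets G" "\<And>x. x \<in> space M - D \<Longrightarrow> g x = 0"
  shows "((\<integral>x. f x * g x \<partial>M) - (\<integral>x. f x \<partial>M) * (\<integral>x. g x \<partial>M))\<^sup>2
     \<le> (\<integral>x. (f x)\<^sup>2 \<partial>M) * (\<integral>x. (g x)\<^sup>2 \<partial>M) * (\<integral>z. indicator (C \<times> D) z * (h z - 1)\<^sup>2 \<partial>(M \<Otimes>\<^sub>M M))"
proof -
  have fF[measurable]: "f \<in> borel_measurable F" and gG[measurable]: "g \<in> borel_measurable G"
    and f2: "integrable M (\<lambda>x. (f x)\<^sup>2)" and g2: "integrable M (\<lambda>x. (g x)\<^sup>2)"
    using f g by (auto simp: square_integrable_def)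
  note [measurable] = meas_sub(1)[OF fF] meas_sub(2)[OF gG]
  have [measurable]: "C \<in> sets M" "D \<in> sets M" using C D sub by (auto simp: subalgebra_def)
  have idF: "(\<lambda>x. x) \<in> measurable M F" "(\<lambda>x. x) \<in> measurable M G"
    using sub by (auto simp: subalgebra_def measurable_def intro!: sets.Int)
  have diag: "(\<lambda>\<omega>. (\<omega>, \<omega>)) \<in> measurable M (F \<Otimes>\<^sub>M G)"
    using idF by measurable
  have id2: "(\<lambda>z. z) \<in> measurable (M \<Otimes>\<^sub>M M) (F \<Otimes>\<^sub>M G)"
  proof -
    have "(\<lambda>z. (fst z, snd z)) \<in> measurable (M \<Otimes>\<^sub>M M) (F \<Otimes>\<^sub>M G)"
      using measurable_compose[OF measurable_fst idF(1)] measurable_compose[OF measurable_snd idF(2)]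
      by (rule measurable_Pair)
    then show ?thesis by simp
  qed
  have id3: "(\<lambda>z. z) \<in> measurable (density (M \<Otimes>\<^sub>M M) h) (F \<Otimes>\<^sub>M G)" using id2 by simp
  let ?k = "\<lambda>z. f (fst z) * g (snd z)"
  have k: "?k \<in> borel_measurable (F \<Otimes>\<^sub>M G)" by measurable
  have int1: "integrable M f" "integrable M g"
    by (auto intro!: square_integrable_imp_integrable f2 g2)
  have intfg: "integrable M (\<lambda>x. f x * g x)"
  proof (rule Bochner_Integration.integrable_bound)
    show "integrable M (\<lambda>x. (f x)\<^sup>2 + (g x)\<^sup>2)" using f2 g2 by simp
    have "norm (f x * g x) \<le> norm ((f x)\<^sup>2 + (g x)\<^sup>2)" for x
    proof -
      have "2 * (\<bar>f x\<bar> * \<bar>g x\<bar>) \<le> (f x)\<^sup>2 + (g x)\<^sup>2" "0 \<le> \<bar>f x\<bar> * \<bar>g x\<bar>"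
        using sum_squares_bound[of "\<bar>f x\<bar>" "\<bar>g x\<bar>"] by auto
      then have "\<bar>f x\<bar> * \<bar>g x\<bar> \<le> (f x)\<^sup>2 + (g x)\<^sup>2" by linarith
      then show ?thesis by (simp add: abs_mult)
    qed
    then show "AE x in M. norm (f x * g x) \<le> norm ((f x)\<^sup>2 + (g x)\<^sup>2)" by simp
  qed simp
  have "integrable (distr M (F \<Otimes>\<^sub>M G) (\<lambda>\<omega>. (\<omega>, \<omega>))) ?k"
    using intfg by (subst integrable_distr_eq[OF diag k]) simp
  then have ih: "integrable (M \<Otimes>\<^sub>M M) (\<lambda>z. h z * ?k z)"
    unfolding joint integrable_distr_eq[OF id3 k] using h_nonneg
    by (subst (asm) integrable_density) auto
  have "(\<integral>x. f x * g x \<partial>M) = (\<integral>z. ?k z \<partial>distr M (F \<Otimes>\<^sub>M G) (\<lambda>\<omega>. (\<omega>, \<omega>)))"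
    by (subst integral_distr[OF diag k]) simp
  also have "\<dots> = (\<integral>z. h z * ?k z \<partial>(M \<Otimes>\<^sub>M M))"
    unfolding joint integral_distr[OF id3 k] using h_nonneg
    by (subst integral_density) auto
  finally have 1: "(\<integral>x. f x * g x \<partial>M) = (\<integral>z. h z * ?k z \<partial>(M \<Otimes>\<^sub>M M))" .
  have ik: "integrable (M \<Otimes>\<^sub>M M) ?k"
  proof (rule MM.Fubini_integrable)
    have "(\<lambda>x. \<integral>y. norm (?k (x, y)) \<partial>M) = (\<lambda>x. \<bar>f x\<bar> * (\<integral>y. \<bar>g y\<bar> \<partial>M))"
      by (auto simp: abs_mult)
    then show "integrable M (\<lambda>x. \<integral>y. norm (?k (x, y)) \<partial>M)" using int1 by simp
  qed (use int1 in auto)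
  have 2: "(\<integral>x. f x \<partial>M) * (\<integral>x. g x \<partial>M) = (\<integral>z. ?k z \<partial>(M \<Otimes>\<^sub>M M))"
    using MM.integral_fst'[OF ik] by simp
  have "(\<integral>x. f x * g x \<partial>M) - (\<integral>x. f x \<partial>M) * (\<integral>x. g x \<partial>M) = (\<integral>z. ?k z * (h z - 1) \<partial>(M \<Otimes>\<^sub>M M))"
    unfolding 1 2 by (subst Bochner_Integration.integral_diff[symmetric, OF ih ik]) (simp add: algebra_simps)
  also have "\<dots> = (\<integral>z. ?k z * (indicator (C \<times> D) z * (h z - 1)) \<partial>(M \<Otimes>\<^sub>M M))"
  proof (rule Bochner_Integration.integral_cong[OF refl])
    fix z assume "z \<in> space (M \<Otimes>\<^sub>M M)"
    then have "f (fst z) = 0 \<or> fst z \<in> C" "g (snd z) = 0 \<or> snd z \<in> D"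
      using C(2)[of "fst z"] D(2)[of "snd z"] by (auto simp: space_pair_measure)
    then show "?k z * (h z - 1) = ?k z * (indicator (C \<times> D) z * (h z - 1))"
      by (cases z) (auto simp: indicator_def)
  qed
  finally have eq: "(\<integral>x. f x * g x \<partial>M) - (\<integral>x. f x \<partial>M) * (\<integral>x. g x \<partial>M) = (\<integral>z. ?k z * (indicator (C \<times> D) z * (h z - 1)) \<partial>(M \<Otimes>\<^sub>M M))" .
  let ?v = "\<lambda>z. indicator (C \<times> D) z * (h z - 1)"
  have sq: "ennreal (\<bar>x\<bar> ^ 2) = ennreal \<bar>x\<bar> ^ 2" for x by (simp add: ennreal_power)
  have iv: "integrable (M \<Otimes>\<^sub>M M) (\<lambda>z. indicator (C \<times> D) z * (h z - 1)\<^sup>2)"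
    by (rule Bochner_Integration.integrable_bound[OF h_sq]) (auto simp: indicator_def)
  \<comment> \<open>A Bochner integral that does not exist has the value 0, so the bound holds in
    either case and no integrability of the product is needed.\<close>
  have "ennreal (\<bar>\<integral>z. ?k z * ?v z \<partial>(M \<Otimes>\<^sub>M M)\<bar>) \<le> (\<integral>\<^sup>+z. ennreal (\<bar>?k z * ?v z\<bar>) \<partial>(M \<Otimes>\<^sub>M M))"
  proof (cases "integrable (M \<Otimes>\<^sub>M M) (\<lambda>z. ?k z * ?v z)")
    case True
    then show ?thesis using integral_norm_bound_ennreal[OF True] by simp
  qed (simp add: not_integrable_integral_eq)
  also have "\<dots> = (\<integral>\<^sup>+z. ennreal (\<bar>?k z\<bar>) * ennreal (\<bar>?v z\<bar>) \<partial>(M \<Otimes>\<^sub>M M))"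
    by (simp add: abs_mult ennreal_mult)
  finally have "(ennreal (\<bar>\<integral>z. ?k z * ?v z \<partial>(M \<Otimes>\<^sub>M M)\<bar>))\<^sup>2 \<le> (\<integral>\<^sup>+z. ennreal (\<bar>?k z\<bar>) * ennreal (\<bar>?v z\<bar>) \<partial>(M \<Otimes>\<^sub>M M))\<^sup>2"
    by (rule power_mono) simp
  also have "\<dots> \<le> (\<integral>\<^sup>+z. ennreal (\<bar>?k z\<bar>)^2 \<partial>(M \<Otimes>\<^sub>M M)) * (\<integral>\<^sup>+z. ennreal (\<bar>?v z\<bar>)^2 \<partial>(M \<Otimes>\<^sub>M M))"
    by (rule Cauchy_Schwarz_nn_integral) measurable
  also have "(\<integral>\<^sup>+z. ennreal (\<bar>?k z\<bar>)^2 \<partial>(M \<Otimes>\<^sub>M M)) = (\<integral>\<^sup>+x. \<integral>\<^sup>+y. ennreal ((f x)\<^sup>2) * ennreal ((g y)\<^sup>2) \<partial>M \<partial>M)"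
    by (subst nn_integral_fst[symmetric]) (auto simp: sq[symmetric] power_mult_distrib ennreal_mult)
  also have "\<dots> = ennreal ((\<integral>x. (f x)\<^sup>2 \<partial>M) * (\<integral>x. (g x)\<^sup>2 \<partial>M))"
    using f2 g2 by (simp add: nn_integral_cmult nn_integral_multc nn_integral_eq_integral ennreal_mult)
  also have "(\<integral>\<^sup>+z. ennreal (\<bar>?v z\<bar>)^2 \<partial>(M \<Otimes>\<^sub>M M)) = (\<integral>\<^sup>+z. ennreal (indicator (C \<times> D) z * (h z - 1)\<^sup>2) \<partial>(M \<Otimes>\<^sub>M M))"
    by (rule nn_integral_cong) (auto simp: sq[symmetric] power_mult_distrib indicator_def)
  also have "\<dots> = ennreal (\<integral>z. indicator (C \<times> D) z * (h z - 1)\<^sup>2 \<partial>(M \<Otimes>\<^sub>M M))"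
    by (rule nn_integral_eq_integral[OF iv]) auto
  finally show ?thesis unfolding eq 
    by (simp add: ennreal_power ennreal_mult[symmetric] ennreal_le_iff)
qed

lemma rho_coeff_le: "rho_coeff M F G \<le> ereal (sqrt chi2)"
  unfolding rho_coeff_def
proof (rule SUP_least, clarify)
  fix f g assume f: "f \<in> square_integrable M F" and g: "g \<in> square_integrable M G"
  define f' where "f' = (\<lambda>x. f x - expectation f)"
  define g' where "g' = (\<lambda>x. g x - expectation g)"
  have cen: "k \<in> square_integrable M H \<Longrightarrow> subalgebra M H \<Longrightarrow> (\<lambda>x. k x - expectation k) \<in> square_integrable M H \<and> (\<integral>x. k x - expectation k \<partial>M) = 0" for k H
  proof -
    assume k: "k \<in> square_integrable M H" and H: "subalgebra M H"
    have kM: "k \<in> borel_measurable M" "integrable M (\<lambda>x. (k x)\<^sup>2)"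
      using k H measurable_from_subalg by (auto simp: square_integrable_def)
    then have i: "integrable M k" by (rule square_integrable_imp_integrable)
    show ?thesis using k kM(2) i by (auto simp: square_integrable_def power2_diff prob_space)
  qed
  have f': "f' \<in> square_integrable M F" "expectation f' = 0" using cen[OF f sub(1)] by (auto simp: f'_def)
  have g': "g' \<in> square_integrable M G" "expectation g' = 0" using cen[OF g sub(2)] by (auto simp: g'_def)
  have top: "space M \<in> sets F" "space M \<in> sets G" using sub by (metis sets.top subalgebra_def)+
  have "(\<integral>z. indicator (space M \<times> space M) z * (h z - 1)\<^sup>2 \<partial>(M \<Otimes>\<^sub>M M)) = chi2"
    unfolding chi2_def by (rule Bochner_Integration.integral_cong) (auto simp: space_pair_measure)
  then have *: "(\<integral>x. f' x * g' x \<partial>M)\<^sup>2 \<le> (\<integral>x. (f' x)\<^sup>2 \<partial>M) * (\<integral>x. (g' x)\<^sup>2 \<partial>M) * chi2"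
    using cov_square_le[OF f'(1) g'(1) top(1) _ top(2)] f'(2) g'(2) by simp
  let ?V = "(\<integral>x. (f' x)\<^sup>2 \<partial>M) * (\<integral>x. (g' x)\<^sup>2 \<partial>M)"
  have "\<bar>\<integral>x. f' x * g' x \<partial>M\<bar> \<le> sqrt ?V * sqrt chi2"
    using real_sqrt_le_mono[OF *] by (simp add: real_sqrt_mult)
  moreover have "corr M f g = (\<integral>x. f' x * g' x \<partial>M) / sqrt ?V"
    by (simp add: corr_def f'_def g'_def)
  moreover have "?V \<ge> 0" by simp
  ultimately have "\<bar>corr M f g\<bar> \<le> sqrt chi2"
    using chi2_nonneg abs_div_le[of "\<integral>x. f' x * g' x \<partial>M" "sqrt ?V"] by simp
  then show "ereal \<bar>corr M f g\<bar> \<le> ereal (sqrt chi2)" by simp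
qed

lemma cell_le:
  assumes C: "C \<in> sets F" and D: "D \<in> sets G"
  shows "(prob (C \<inter> D) - prob C * prob D)\<^sup>2
     \<le> prob C * prob D * (\<integral>z. indicator (C \<times> D) z * (h z - 1)\<^sup>2 \<partial>(M \<Otimes>\<^sub>M M))"
proof -
  have [measurable]: "C \<in> sets M" "D \<in> sets M" using C D sub by (auto simp: subalgebra_def)
  have *: "indicator C \<in> square_integrable M F" "indicator D \<in> square_integrable M G"
    using C D by (auto simp: square_integrable_def power2_eq_square indicator_inter_arith[symmetric]
      intro!: integrable_real_indicator emeasure_finite less_top[THEN iffD1])
  have "(\<integral>x. indicator C x * indicator D x \<partial>M) = prob (C \<inter> D)"
    by (simp add: indicator_inter_arith[symmetric])
  moreover have "(\<integral>x. (indicator C x)\<^sup>2 \<partial>M) = prob C" "(\<integral>x. (indicator D x)\<^sup>2 \<partial>M) = prob D"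
    by (simp_all add: power2_eq_square indicator_inter_arith[symmetric])
  ultimately show ?thesis using cov_square_le[OF * C _ D] by simp
qed

text \<open>The gain from localising: the cells \<open>C \<times> D\<close> tile the product space,
  so the local integrals add up to \<open>chi2\<close> itself, however fine the partitions
  are.\<close>

lemma sum_cells:
  assumes P: "P \<in> positive_partitions M F" and Q: "Q \<in> positive_partitions M G"
  shows "(\<Sum>C\<in>P. \<Sum>D\<in>Q. \<integral>z. indicator (C \<times> D) z * (h z - 1)\<^sup>2 \<partial>(M \<Otimes>\<^sub>M M)) = chi2"
    and "(\<Sum>C\<in>P. prob C) = 1" "(\<Sum>D\<in>Q. prob D) = 1"
    and "(\<Sum>C\<in>P. \<Sum>D\<in>Q. prob (C \<inter> D)) = 1"
proof -
  have fin: "finite P" "finite Q" and part: "partition_on (space M) P" "partition_on (space M) Q"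
    and PF: "P \<subseteq> sets F" "Q \<subseteq> sets G"
    using P Q by (auto simp: positive_partitions_def)
  have PM: "P \<subseteq> sets M" "Q \<subseteq> sets M" using PF sub by (auto simp: subalgebra_def)
  have one: "(\<Sum>C\<in>R. indicator C x) = (1::real)" if R: "partition_on (space M) R" "finite R" "x \<in> space M" for R x
  proof -
    obtain C where C: "C \<in> R" "x \<in> C" using R by (auto simp: partition_on_def)
    have "indicator C' x = (if C' = C then 1 else 0 :: real)" if "C' \<in> R" for C'
      using that C \<open>partition_on (space M) R\<close> by (auto simp: partition_on_def disjoint_def indicator_def)
    then have "(\<Sum>C\<in>R. indicator C x) = (\<Sum>C'\<in>R. if C' = C then 1 else 0 :: real)" by (intro sum.cong) auto
    then show ?thesis using C R(2) by simp
  qed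
  have pr: "(\<Sum>C\<in>R. prob (C \<inter> B)) = prob B" if "partition_on (space M) R" "finite R" "R \<subseteq> sets M" "B \<in> sets M" for R B
  proof -
    have "(\<Sum>C\<in>R. prob (C \<inter> B)) = prob (\<Union>C\<in>R. C \<inter> B)"
      using that by (intro finite_measure_finite_Union[symmetric])
        (auto simp: partition_on_def disjoint_family_on_def disjoint_def, blast+)
    also have "(\<Union>C\<in>R. C \<inter> B) = B" using that sets.sets_into_space[OF that(4)] by (auto simp: partition_on_def)
    finally show ?thesis .
  qed
  show 1: "(\<Sum>C\<in>P. prob C) = 1" "(\<Sum>D\<in>Q. prob D) = 1"
    using pr[OF part(1) fin(1) PM(1) sets.top] pr[OF part(2) fin(2) PM(2) sets.top] PM
    by (simp_all add: prob_space subset_iff cong: sum.cong)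
  show "(\<Sum>C\<in>P. \<Sum>D\<in>Q. prob (C \<inter> D)) = 1"
    using PM pr[OF part(2) fin(2) PM(2)] 1 by (simp add: Int_commute[of _ "_::'a set"] subset_iff cong: sum.cong)
  have i: "integrable (M \<Otimes>\<^sub>M M) (\<lambda>z. indicator (C \<times> D) z * (h z - 1)\<^sup>2)" if "C \<in> P" "D \<in> Q" for C D
  proof -
    have [measurable]: "C \<in> sets M" "D \<in> sets M" using that PM by auto
    show ?thesis by (rule Bochner_Integration.integrable_bound[OF h_sq]) (auto simp: indicator_def)
  qed
  have "(\<Sum>C\<in>P. \<Sum>D\<in>Q. \<integral>z. indicator (C \<times> D) z * (h z - 1)\<^sup>2 \<partial>(M \<Otimes>\<^sub>M M))
     = (\<integral>z. (\<Sum>C\<in>P. \<Sum>D\<in>Q. indicator (C \<times> D) z * (h z - 1)\<^sup>2) \<partial>(M \<Otimes>\<^sub>M M))"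
    using i by (subst Bochner_Integration.integral_sum; simp add: Bochner_Integration.integral_sum)
  also have "\<dots> = chi2" unfolding chi2_def
  proof (rule Bochner_Integration.integral_cong[OF refl])
    fix z assume "z \<in> space (M \<Otimes>\<^sub>M M)"
    then obtain x y where z: "z = (x, y)" "x \<in> space M" "y \<in> space M" by (auto simp: space_pair_measure)
    have "(\<Sum>C\<in>P. \<Sum>D\<in>Q. indicator (C \<times> D) z * (h z - 1)\<^sup>2) = (\<Sum>C\<in>P. indicator C x) * (\<Sum>D\<in>Q. indicator D y) * (h z - 1)\<^sup>2"
      by (simp add: z(1) indicator_times sum_distrib_left sum_distrib_right) (rule sum.swap)
    then show "(\<Sum>C\<in>P. \<Sum>D\<in>Q. indicator (C \<times> D) z * (h z - 1)\<^sup>2) = (h z - 1)\<^sup>2"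
      using one z part fin by simp
  qed
  finally show "(\<Sum>C\<in>P. \<Sum>D\<in>Q. \<integral>z. indicator (C \<times> D) z * (h z - 1)\<^sup>2 \<partial>(M \<Otimes>\<^sub>M M)) = chi2" .
qed

text \<open>Cauchy-Schwarz over the cells: by \<open>cell_le\<close> each difference is at most the
  square root of a cell weight times the square root of a local integral; the former sum to 1, the
  latter to \<open>chi2\<close>.\<close>

lemma beta_coeff_le: "beta_coeff M F G \<le> ereal (sqrt chi2)"
  unfolding beta_coeff_def
proof (rule SUP_least, clarify)
  fix P Q assume P: "P \<in> positive_partitions M F" and Q: "Q \<in> positive_partitions M G"
  define q where "q C D = (\<integral>z. indicator (C \<times> D) z * (h z - 1)\<^sup>2 \<partial>(M \<Otimes>\<^sub>M M))" for C D
  have PF: "P \<subseteq> sets F" "Q \<subseteq> sets G" using P Q by (auto simp: positive_partitions_def)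
  let ?S = "\<Sum>C\<in>P. \<Sum>D\<in>Q. \<bar>prob (C \<inter> D) - prob C * prob D\<bar>"
  have "\<bar>prob (C \<inter> D) - prob C * prob D\<bar> \<le> sqrt (prob C * prob D) * sqrt (q C D)" if "C \<in> P" "D \<in> Q" for C D
    using real_sqrt_le_mono[OF cell_le[of C D]] that PF by (auto simp: q_def real_sqrt_mult)
  then have "?S \<le> (\<Sum>C\<in>P. \<Sum>D\<in>Q. sqrt (prob C * prob D) * sqrt (q C D))"
    by (intro sum_mono) auto
  also have "\<dots> = (\<Sum>(C, D)\<in>P \<times> Q. sqrt (prob C * prob D) * sqrt (q C D))"
    by (simp add: sum.cartesian_product)
  finally have "?S\<^sup>2 \<le> (\<Sum>(C, D)\<in>P \<times> Q. sqrt (prob C * prob D) * sqrt (q C D))\<^sup>2"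
    by (rule power_mono) (simp add: sum_nonneg)
  also have "\<dots> \<le> (\<Sum>z\<in>P \<times> Q. (sqrt (prob (fst z) * prob (snd z)))\<^sup>2) * (\<Sum>z\<in>P \<times> Q. (sqrt (q (fst z) (snd z)))\<^sup>2)"
    unfolding case_prod_beta by (rule Cauchy_Schwarz_ineq_sum)
  also have "(\<Sum>z\<in>P \<times> Q. (sqrt (q (fst z) (snd z)))\<^sup>2) = (\<Sum>(C, D)\<in>P \<times> Q. q C D)"
    by (simp add: q_def case_prod_beta)
  also have "\<dots> = chi2"
    using sum_cells(1)[OF P Q] by (simp add: sum.cartesian_product q_def)
  also have "(\<Sum>z\<in>P \<times> Q. (sqrt (prob (fst z) * prob (snd z)))\<^sup>2) = (\<Sum>(C, D)\<in>P \<times> Q. prob C * prob D)"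
    by (simp add: case_prod_beta)
  also have "\<dots> = 1" using sum_cells(2,3)[OF P Q] by (simp add: sum.cartesian_product[symmetric] sum_product[symmetric])
  finally have "sqrt (?S\<^sup>2) \<le> sqrt chi2" by (intro real_sqrt_le_mono) simp
  then have "?S \<le> sqrt chi2" by simp
  moreover have "0 \<le> sqrt chi2" using chi2_nonneg by simp
  \<comment> \<open>The factor 1/2 of the definition is given away.\<close>
  ultimately have "1 / 2 * ?S \<le> sqrt chi2" by linarith
  then show "ereal (1 / 2 * ?S) \<le> ereal (sqrt chi2)" by simp
qed

text \<open>For a cell with ratio \<open>t\<close>, \<open>t * ln t \<le> t * (t - 1)\<close>, and
  the right side is the square of \<open>t - 1\<close> plus \<open>t - 1\<close>. The linear parts
  cancel in the sum because joint and product weights both sum to 1, so the bound is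
  \<open>chi2\<close> without a square root.\<close>

lemma info_coeff_le: "info_coeff M F G \<le> ereal chi2"
  unfolding info_coeff_def
proof (rule SUP_least, clarify)
  fix P Q assume P: "P \<in> positive_partitions M F" and Q: "Q \<in> positive_partitions M G"
  define q where "q C D = (\<integral>z. indicator (C \<times> D) z * (h z - 1)\<^sup>2 \<partial>(M \<Otimes>\<^sub>M M))" for C D
  define a where "a C D = prob (C \<inter> D) - prob C * prob D" for C D
  have cell: "eta M C D * ln (eta M C D) * (prob C * prob D) \<le> q C D + a C D" if "C \<in> P" "D \<in> Q" for C D
  proof -
    let ?w = "prob C * prob D" and ?t = "eta M C D"
    have w: "?w > 0" using that P Q by (auto simp: positive_partitions_def)
    have t: "?t * ?w = prob (C \<inter> D)" "?t \<ge> 0" using w by (auto simp: eta_def)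
    have alg: "t * (t - 1) * w = (t * w - w)\<^sup>2 / w + (t * w - w)" if "0 < w" for t w :: real
      using that by (simp add: power2_eq_square divide_simps) (simp add: algebra_simps)
    have "?t * ln ?t \<le> ?t * (?t - 1)"
      using t(2) ln_le_minus_one[of ?t] by (cases "?t = 0") (auto intro!: mult_left_mono)
    then have "?t * ln ?t * ?w \<le> ?t * (?t - 1) * ?w" using w by (intro mult_right_mono) auto
    also have "\<dots> = (?t * ?w - ?w)\<^sup>2 / ?w + (?t * ?w - ?w)"
      using alg[OF w] .
    also have "\<dots> = (a C D)\<^sup>2 / ?w + a C D" by (simp add: t a_def)
    also have "(a C D)\<^sup>2 / ?w \<le> q C D"
      using cell_le[of C D] that P Q w by (auto simp: a_def q_def field_simps positive_partitions_def)
    finally show ?thesis by simp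
  qed
  have "(\<Sum>C\<in>P. \<Sum>D\<in>Q. eta M C D * ln (eta M C D) * (prob C * prob D)) \<le> (\<Sum>C\<in>P. \<Sum>D\<in>Q. q C D + a C D)"
    using cell by (intro sum_mono) auto
  also have "\<dots> = chi2"
    using sum_cells[OF P Q] by (simp add: q_def a_def sum.distrib sum_subtractf sum_product[symmetric])
  finally show "ereal (\<Sum>C\<in>P. \<Sum>D\<in>Q. eta M C D * ln (eta M C D) * (prob C * prob D)) \<le> ereal chi2" by simp
qed

end

section \<open>Reversible chains with countably many states\<close>

lemma cyl_in_cyls: "cyl (I n) x \<in> cyls I"
  by (auto simp: cyls_def)

text \<open>The countable cover by generators that the uniqueness theorem for measures asks
  for.\<close>

lemma cyl_cover:
  shows "\<Union> (cyl (I 0) ` PiE (I 0) (\<lambda>_. UNIV)) = UNIV"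
    and "cyl (I 0) ` PiE (I 0) (\<lambda>_. UNIV) \<subseteq> cyls I"
    and "finite (I 0) \<Longrightarrow> countable (cyl (I 0) ` PiE (I 0) (\<lambda>_. UNIV))"
proof -
  show "\<Union> (cyl (I 0) ` PiE (I 0) (\<lambda>_. UNIV)) = UNIV"
    using Union_cyl[of "I 0" "\<lambda>_. True"] by simp
  show "cyl (I 0) ` PiE (I 0) (\<lambda>_. UNIV) \<subseteq> cyls I"
    by (rule image_subsetI) (rule cyl_in_cyls)
  show "finite (I 0) \<Longrightarrow> countable (cyl (I 0) ` PiE (I 0) (\<lambda>_. UNIV))"
    by (intro countable_image countable_PiE_nat)
qed

text \<open>Large symmetric windows already generate everything; the threshold \<open>N\<close>
  leaves room to compare only those that are large relative to a shift.\<close>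

lemma path_measure_eqI:
  fixes N :: nat
  assumes sets: "sets \<mu> = sets path_space" "sets \<nu> = sets path_space"
    and prob: "prob_space \<mu>" "prob_space \<nu>"
    and eq: "\<And>n x. n \<ge> N \<Longrightarrow> measure \<mu> (cyl {- int n..int n} x) = measure \<nu> (cyl {- int n..int n} x)"
  shows "\<mu> = \<nu>"
proof -
  interpret mu: prob_space \<mu> by fact
  interpret nu: prob_space \<nu> by fact
  let ?I = "\<lambda>n. {- int (n + N)..int (n + N)}"
  have I: "incseq ?I" "\<And>n. finite (?I n)" "(\<Union>n. ?I n) = UNIV"
  proof -
    show "(\<Union>n. ?I n) = UNIV"
    proof (intro set_eqI iffI UNIV_I)
      fix k :: int show "k \<in> (\<Union>n. ?I n)" by (rule UN_I[of "nat \<bar>k\<bar>"]) auto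
    qed
  qed (auto simp: incseq_def)
  show ?thesis
  proof (rule measure_eqI_generator_eq_countable[where E="cyls ?I" and \<Omega>=UNIV and A="cyl (?I 0) ` PiE (?I 0) (\<lambda>_. UNIV)"])
    show "emeasure \<mu> X = emeasure \<nu> X" if "X \<in> cyls ?I" for X
      using that eq[of "_ + N"] by (auto simp: cyls_def mu.emeasure_eq_measure nu.emeasure_eq_measure)
  qed (use sets sets_path_space_cyls[OF I] Int_stable_cyls[OF I(1)] mu.emeasure_finite cyl_cover[of ?I] in \<open>auto simp: I(2)\<close>)
qed

section \<open>Stationarity, time reversal and the Markov property\<close>

context reversible_kernel begin

sublocale PM: prob_space path_measure by (rule prob_space_path_measure)

text \<open>Seen from time 0 the weight treats the two directions of time alike, which is what makes
  \<open>path_weight_reverse\<close> a mere renaming of indices.\<close>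

lemma path_weight_split:
  assumes "a \<le> 0" "0 \<le> b"
  shows "path_weight a b x = pmf p (x 0) * (\<Prod>k\<in>{a..<0}. pmf (K (x (k + 1))) (x k)) * (\<Prod>k\<in>{0<..b}. pmf (K (x (k - 1))) (x k))"
proof -
  have "{a<..b} = {a<..0} \<union> {0<..b}" using assms by auto
  then have "path_weight a b x = path_weight a 0 x * (\<Prod>k\<in>{0<..b}. pmf (K (x (k - 1))) (x k))"
    unfolding path_weight_def by (simp add: prod.union_disjoint)
  then show ?thesis using path_weight_backward[of "nat (- a)" x] assms by simp
qed

lemma path_weight_shift: "path_weight (a + m) (b + m) x = path_weight a b (\<lambda>i. x (i + m))"
proof -
  have "(\<Prod>i\<in>{a + m<..b + m}. pmf (K (x (i - 1))) (x i)) = (\<Prod>i\<in>{a<..b}. pmf (K (x (i - 1 + m))) (x (i + m)))"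
    by (rule prod.reindex_bij_witness[of _ "\<lambda>i. i + m" "\<lambda>i. i - m"]) auto
  then show ?thesis by (simp add: path_weight_def)
qed

lemma path_weight_reverse:
  assumes "a \<le> 0" "0 \<le> b"
  shows "path_weight (- b) (- a) (\<lambda>i. x (- i)) = path_weight a b x"
proof -
  have 1: "(\<Prod>k\<in>{- b..<0}. pmf (K (x (- (k + 1)))) (x (- k))) = (\<Prod>k\<in>{0<..b}. pmf (K (x (k - 1))) (x k))"
    by (rule prod.reindex_bij_witness[of _ uminus uminus]) auto
  have 2: "(\<Prod>k\<in>{0<..- a}. pmf (K (x (- (k - 1)))) (x (- k))) = (\<Prod>k\<in>{a..<0}. pmf (K (x (k + 1))) (x k))"
    by (rule prod.reindex_bij_witness[of _ uminus uminus]) (auto simp: algebra_simps)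
  show ?thesis
    using assms 1 2 by (simp add: path_weight_split)
qed

lemma shift_measurable: "(\<lambda>\<omega> k. \<omega> (f k)) \<in> measurable path_space path_space" for f :: "int \<Rightarrow> int"
  by (rule measurable_PiM_single') (auto intro!: measurable_component_singleton)

lemma distr_shift: "distr path_measure path_space (\<lambda>\<omega> k. \<omega> (k + m)) = path_measure"
proof (rule path_measure_eqI[where N="nat \<bar>m\<bar>"])
  have meas: "(\<lambda>\<omega> k. \<omega> (k + m)) \<in> measurable path_measure path_space"
    using shift_measurable[of "\<lambda>k. k + m"] by (simp add: measurable_cong_sets[OF sets_path_measure refl])
  show "prob_space (distr path_measure path_space (\<lambda>\<omega> k. \<omega> (k + m)))"
    by (rule PM.prob_space_distr[OF meas])
  \<comment> \<open>For such \<open>n\<close> the shifted window still contains 0, so both cylinder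
    probabilities are known.\<close>
  fix n x assume n: "nat \<bar>m\<bar> \<le> n"
  let ?a = "- int n" and ?b = "int n"
  have "(\<lambda>\<omega> k. \<omega> (k + m)) -` cyl {?a..?b} x \<inter> space path_measure = cyl {?a + m..?b + m} (\<lambda>i. x (i - m))"
  proof (intro set_eqI iffI)
    fix \<omega> :: "int \<Rightarrow> nat" assume "\<omega> \<in> (\<lambda>\<omega> k. \<omega> (k + m)) -` cyl {?a..?b} x \<inter> space path_measure"
    then have *: "\<omega> (k + m) = x k" if "k \<in> {?a..?b}" for k using that by (auto simp: cyl_def)
    show "\<omega> \<in> cyl {?a + m..?b + m} (\<lambda>i. x (i - m))" unfolding cyl_def
    proof safe
      fix i assume "i \<in> {?a + m..?b + m}"
      then show "\<omega> i = x (i - m)" using *[of "i - m"] by auto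
    qed
  qed (auto simp: cyl_def)
  then have "measure (distr path_measure path_space (\<lambda>\<omega> k. \<omega> (k + m))) (cyl {?a..?b} x)
      = measure path_measure (cyl {?a + m..?b + m} (\<lambda>i. x (i - m)))"
    by (subst measure_distr[OF meas]) auto
  also have "\<dots> = path_weight ?a ?b x"
    using n path_weight_shift[of ?a m ?b "\<lambda>i. x (i - m)"] by (subst measure_cyl_around_0) auto
  also have "\<dots> = measure path_measure (cyl {?a..?b} x)" by (rule measure_cyl_around_0[symmetric]) auto
  finally show "measure (distr path_measure path_space (\<lambda>\<omega> k. \<omega> (k + m))) (cyl {?a..?b} x) = \<dots>" .
qed (simp_all add: sets_path_measure PM.prob_space_axioms)

lemma distr_reverse: "distr path_measure path_space (\<lambda>\<omega> k. \<omega> (- k)) = path_measure"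
proof (rule path_measure_eqI[where N=0])
  have meas: "(\<lambda>\<omega> k. \<omega> (- k)) \<in> measurable path_measure path_space"
    using shift_measurable[of uminus] by (simp add: measurable_cong_sets[OF sets_path_measure refl])
  show "prob_space (distr path_measure path_space (\<lambda>\<omega> k. \<omega> (- k)))"
    by (rule PM.prob_space_distr[OF meas])
  fix n x
  let ?b = "int n"
  have "(\<lambda>\<omega> k. \<omega> (- k)) -` cyl {- ?b..?b} x \<inter> space path_measure = cyl {- ?b..?b} (\<lambda>i. x (- i))"
  proof (intro set_eqI iffI)
    fix \<omega> :: "int \<Rightarrow> nat" assume "\<omega> \<in> (\<lambda>\<omega> k. \<omega> (- k)) -` cyl {- ?b..?b} x \<inter> space path_measure"
    then have *: "\<omega> (- k) = x k" if "k \<in> {- ?b..?b}" for k using that by (auto simp: cyl_def)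
    show "\<omega> \<in> cyl {- ?b..?b} (\<lambda>i. x (- i))" unfolding cyl_def
    proof safe
      fix i assume "i \<in> {- ?b..?b}"
      then show "\<omega> i = x (- i)" using *[of "- i"] by auto
    qed
  qed (auto simp: cyl_def)
  then have "measure (distr path_measure path_space (\<lambda>\<omega> k. \<omega> (- k))) (cyl {- ?b..?b} x)
      = measure path_measure (cyl {- ?b..?b} (\<lambda>i. x (- i)))"
    by (subst measure_distr[OF meas]) auto
  also have "\<dots> = measure path_measure (cyl {- ?b..?b} x)"
    using path_weight_reverse[of "- ?b" ?b x] by (simp add: measure_cyl_around_0)
  finally show "measure (distr path_measure path_space (\<lambda>\<omega> k. \<omega> (- k))) (cyl {- ?b..?b} x) = \<dots>" .
qed (simp_all add: sets_path_measure PM.prob_space_axioms)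

text \<open>Stationarity carries any window to one that starts at 0.\<close>

lemma measure_cyl:
  assumes "a \<le> b" shows "measure path_measure (cyl {a..b} x) = path_weight a b x"
proof -
  have meas: "(\<lambda>\<omega> k. \<omega> (k + a)) \<in> measurable path_measure path_space"
    using shift_measurable[of "\<lambda>k. k + a"] by (simp add: measurable_cong_sets[OF sets_path_measure refl])
  have "(\<lambda>\<omega> k. \<omega> (k + a)) -` cyl {0..b - a} (\<lambda>i. x (i + a)) \<inter> space path_measure = cyl {a..b} x"
  proof (intro set_eqI iffI)
    fix \<omega> :: "int \<Rightarrow> nat" assume "\<omega> \<in> (\<lambda>\<omega> k. \<omega> (k + a)) -` cyl {0..b - a} (\<lambda>i. x (i + a)) \<inter> space path_measure"
    then have *: "\<omega> (k + a) = x (k + a)" if "k \<in> {0..b - a}" for k using that by (auto simp: cyl_def)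
    show "\<omega> \<in> cyl {a..b} x" unfolding cyl_def
    proof safe
      fix i assume "i \<in> {a..b}"
      then show "\<omega> i = x i" using *[of "i - a"] by auto
    qed
  qed (auto simp: cyl_def)
  then have "measure path_measure (cyl {a..b} x) = measure (distr path_measure path_space (\<lambda>\<omega> k. \<omega> (k + a))) (cyl {0..b - a} (\<lambda>i. x (i + a)))"
    by (subst measure_distr[OF meas]) auto
  also have "\<dots> = path_weight a b x"
    using assms path_weight_shift[of 0 a "b - a" x] by (simp add: distr_shift measure_cyl_around_0)
  finally show ?thesis .
qed

primrec kstep :: "nat \<Rightarrow> nat \<Rightarrow> nat pmf" where
  "kstep 0 x = return_pmf x"
| "kstep (Suc n) x = bind_pmf (K x) (kstep n)"

lemma path_weight_extend:
  assumes "a \<le> b" shows "path_weight a (b + 1) x = path_weight a b x * pmf (K (x b)) (x (b + 1))"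
proof -
  have "{a<..b + 1} = insert (b + 1) {a<..b}" using assms by auto
  then show ?thesis by (simp add: path_weight_def)
qed

lemma path_weight_append:
  assumes "a \<le> b" "b < d" 
  shows "path_weight a d x = path_weight a b x * pmf (K (x b)) (x (b + 1)) * (path_weight (b + 1) d x / pmf p (x (b + 1)))"
proof -
  have "{a<..d} = {a<..b} \<union> insert (b + 1) {b + 1<..d}" using assms by auto
  then show ?thesis using p_pos[of "x (b + 1)"] by (simp add: path_weight_def prod.union_disjoint)
qed

lemma path_weight_cong: "a \<le> b \<Longrightarrow> (\<And>i. i \<in> {a..b} \<Longrightarrow> x i = y i) \<Longrightarrow> path_weight a b x = path_weight a b y"
  unfolding path_weight_def by (intro arg_cong2[where f="(*)"] prod.cong) auto

lemma cyl_events [measurable]: "finite I \<Longrightarrow> cyl I x \<in> PM.events"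
  by (simp add: sets_path_measure)

text \<open>The Markov property in integrated form: the last quotient is the conditional probability
  of the later segment given its first state. A gap is shortened by summing over the state at time
  \<open>b + 1\<close>.\<close>

lemma measure_cyl_gap:
  assumes "a \<le> b" "c \<le> d" "c = b + int n"
  shows "measure path_measure (cyl ({a..b} \<union> {c..d}) x)
    = path_weight a b x * pmf (kstep n (x b)) (x c) * (path_weight c d x / pmf p (x c))"
  using assms
proof (induction n arbitrary: b x)
  case 0
  then have "{a..b} \<union> {c..d} = {a..d}" by auto
  moreover have "{a<..d} = {a<..b} \<union> {b<..d}" using 0 by auto
  ultimately show ?case using 0 p_pos[of "x b"] by (simp add: measure_cyl path_weight_def prod.union_disjoint)
next
  case (Suc n)
  show ?case
  proof (cases n)
    \<comment> \<open>The windows are adjacent, so the state at time \<open>b + 1\<close> is already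
      prescribed and there is nothing to sum over.\<close>
    case 0
    then have "{a..b} \<union> {c..d} = {a..d}" using Suc by auto
    moreover have "kstep 0 = return_pmf" by (simp add: fun_eq_iff)
    ultimately show ?thesis using 0 Suc path_weight_append[of a b d x] by (simp add: measure_cyl bind_return_pmf')
  next
    case (Suc m)
    let ?W = "path_weight c d x / pmf p (x c)"
    let ?A = "\<lambda>y. cyl ({a..b + 1} \<union> {c..d}) (x(b + 1 := y))"
    have W: "?W \<ge> 0" by (simp add: path_weight_def prod_nonneg)
    have bc: "b + 1 < c" using Suc.prems Suc by simp
    have U: "cyl ({a..b} \<union> {c..d}) x = (\<Union>y. ?A y)"
    proof (intro set_eqI iffI)
      fix \<omega> assume "\<omega> \<in> cyl ({a..b} \<union> {c..d}) x"
      then have "\<omega> \<in> ?A (\<omega> (b + 1))" using bc by (auto simp: cyl_def)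
      then show "\<omega> \<in> (\<Union>y. ?A y)" by blast
    next
      fix \<omega> assume "\<omega> \<in> (\<Union>y. ?A y)"
      then obtain y where "\<omega> \<in> ?A y" by blast
      then have *: "\<omega> i = (x(b + 1 := y)) i" if "i \<in> {a..b + 1} \<union> {c..d}" for i using that by (auto simp: cyl_def)
      show "\<omega> \<in> cyl ({a..b} \<union> {c..d}) x" unfolding cyl_def
        using * bc by (auto split: if_splits)
    qed
    have dj: "disjoint_family ?A"
    proof (unfold disjoint_family_on_def, safe)
      fix m n \<omega> assume "m \<noteq> n" "\<omega> \<in> ?A m" "\<omega> \<in> ?A n"
      moreover have "b + 1 \<in> {a..b + 1} \<union> {c..d}" using Suc.prems by auto
      ultimately show "\<omega> \<in> {}" by (force simp: cyl_def)
    qed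
    have A: "measure path_measure (?A y) = path_weight a b x * (pmf (K (x b)) y * pmf (kstep n y) (x c)) * ?W" for y
    proof -
      have "measure path_measure (?A y) = path_weight a (b + 1) (x(b + 1 := y)) * pmf (kstep n ((x(b + 1 := y)) (b + 1))) ((x(b + 1 := y)) c)
         * (path_weight c d (x(b + 1 := y)) / pmf p ((x(b + 1 := y)) c))"
        using Suc.prems by (intro Suc.IH) auto
      also have "path_weight c d (x(b + 1 := y)) = path_weight c d x"
        using Suc.prems bc by (intro path_weight_cong) auto
      also have "path_weight a (b + 1) (x(b + 1 := y)) = path_weight a b x * pmf (K (x b)) y"
        using Suc.prems path_weight_cong[of a b "x(b + 1 := y)" x] by (simp add: path_weight_extend)
      finally show ?thesis using bc by (simp add: mult.assoc fun_upd_def)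
    qed
    have "emeasure path_measure (cyl ({a..b} \<union> {c..d}) x) = (\<integral>\<^sup>+y. emeasure path_measure (?A y) \<partial>count_space UNIV)"
      unfolding U using dj by (intro emeasure_UN_countable) auto
    also have "\<dots> = (\<integral>\<^sup>+y. ennreal (path_weight a b x * ?W) * (ennreal (pmf (K (x b)) y) * ennreal (pmf (kstep n y) (x c))) \<partial>count_space UNIV)"
      unfolding PM.emeasure_eq_measure A using W
      by (intro nn_integral_cong) (simp add: ennreal_mult[symmetric] mult.commute mult.left_commute prod_nonneg path_weight_def)
    also have "\<dots> = ennreal (path_weight a b x * ?W) * (\<integral>\<^sup>+y. ennreal (pmf (K (x b)) y) * ennreal (pmf (kstep n y) (x c)) \<partial>count_space UNIV)"
      by (rule nn_integral_cmult) simp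
    also have "(\<integral>\<^sup>+y. ennreal (pmf (K (x b)) y) * ennreal (pmf (kstep n y) (x c)) \<partial>count_space UNIV) = ennreal (pmf (kstep (Suc n) (x b)) (x c))"
      by (simp add: ennreal_pmf_bind nn_integral_measure_pmf)
    also have "ennreal (path_weight a b x * ?W) * \<dots> = ennreal (path_weight a b x * ?W * pmf (kstep (Suc n) (x b)) (x c))"
      using W by (simp add: ennreal_mult path_weight_def prod_nonneg)
    finally have "measure path_measure (cyl ({a..b} \<union> {c..d}) x) = path_weight a b x * ?W * pmf (kstep (Suc n) (x b)) (x c)"
      using W by (simp add: PM.emeasure_eq_measure path_weight_def prod_nonneg)
    then show ?thesis by (simp only: mult.assoc mult.left_commute mult.commute)
  qed
qed

lemma measure_two_times:
  "measure path_measure {\<omega>. \<omega> k = x \<and> \<omega> (k + int n) = y} = pmf p x * pmf (kstep n x) y"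
proof (cases "n = 0 \<and> x \<noteq> y")
  case False
  \<comment> \<open>One function can prescribe both values: either the two times differ or the
    values agree.\<close>
  let ?x = "(\<lambda>_. y)(k := x)"
  have "{\<omega>. \<omega> k = x \<and> \<omega> (k + int n) = y} = cyl ({k..k} \<union> {k + int n..k + int n}) ?x"
    using False by (auto simp: cyl_def)
  then have "measure path_measure {\<omega>. \<omega> k = x \<and> \<omega> (k + int n) = y} = path_weight k k ?x * pmf (kstep n (?x k)) (?x (k + int n))
     * (path_weight (k + int n) (k + int n) ?x / pmf p (?x (k + int n)))"
    by (simp only: measure_cyl_gap[of k k "k + int n" "k + int n" n])
  then show ?thesis using False p_pos[of y] p_pos[of x] by (auto simp: path_weight_def)
next
  case True
  then have e: "{\<omega>. \<omega> k = x \<and> \<omega> (k + int n) = y} = {}" by auto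
  show ?thesis unfolding e using True by simp
qed

lemma measure_one_time: "measure path_measure {\<omega>. \<omega> k = x} = pmf p x"
  using measure_two_times[of k x 0 x] by simp

end

lemma count_space_pair_nat: "(count_space UNIV :: nat measure) \<Otimes>\<^sub>M (count_space UNIV :: nat measure) = count_space UNIV"
  using pair_measure_countable[of "UNIV::nat set" "UNIV::nat set"] by simp

section \<open>Joint law of past and future\<close>

context reversible_kernel begin

definition past :: "(int \<Rightarrow> nat) measure" where
  "past = generated_field path_measure (count_space UNIV) coord {..0}"

definition future :: "nat \<Rightarrow> (int \<Rightarrow> nat) measure" where
  "future n = generated_field path_measure (count_space UNIV) coord {int n..}"

lemma space_generated [simp]: "space (generated_field path_measure N X J) = UNIV"
  by (simp add: generated_field_def space_measure_of_conv)

lemma past_intervals: "incseq (\<lambda>m. {- int m..0})" "(\<Union>m. {- int m..0}) = {..0}"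
proof -
  show "(\<Union>m. {- int m..0}) = {..0}"
  proof (intro set_eqI iffI)
    fix k :: int assume "k \<in> {..0}"
    then show "k \<in> (\<Union>m. {- int m..0})" by (intro UN_I[of "nat (- k)"]) auto
  qed auto
qed (auto simp: incseq_def)

lemma future_intervals: "incseq (\<lambda>m. {int n..int (n + m)})" "(\<Union>m. {int n..int (n + m)}) = {int n..}"
proof -
  show "(\<Union>m. {int n..int (n + m)}) = {int n..}"
  proof (intro set_eqI iffI)
    fix k :: int assume "k \<in> {int n..}"
    then show "k \<in> (\<Union>m. {int n..int (n + m)})" by (intro UN_I[of "nat k"]) auto
  qed auto
qed (auto simp: incseq_def)

lemma sets_past: "sets past = sigma_sets UNIV (cyls (\<lambda>m. {- int m..0}))"
  unfolding past_def by (rule sets_generated_field_cyls) (use past_intervals in auto)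

lemma sets_future: "sets (future n) = sigma_sets UNIV (cyls (\<lambda>m. {int n..int (n + m)}))"
  unfolding future_def by (rule sets_generated_field_cyls) (use future_intervals in auto)

lemma coord_measurable: "coord k \<in> measurable path_measure (count_space UNIV)"
  by (simp add: measurable_cong_sets[OF sets_path_measure refl])

lemma subalgebra_generated: "subalgebra path_measure (generated_field path_measure (count_space UNIV) coord J)"
proof -
  have "{coord k -` E \<inter> UNIV |k E. k \<in> J \<and> E \<in> sets (count_space UNIV)} \<subseteq> PM.events"
    using measurable_sets[OF coord_measurable] by auto
  then show ?thesis
    by (auto simp: subalgebra_def generated_field_def space_measure_of_conv intro!: sets.sigma_sets_subset[where M=path_measure, simplified])
qed

definition step_density :: "nat \<Rightarrow> (int \<Rightarrow> nat) \<times> (int \<Rightarrow> nat) \<Rightarrow> real" where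
  "step_density n z = pmf (kstep n (fst z 0)) (snd z (int n)) / pmf p (snd z (int n))"

lemma step_density_measurable [measurable]: "step_density n \<in> borel_measurable (path_measure \<Otimes>\<^sub>M path_measure)"
proof -
  note [measurable] = coord_measurable
  have *: "(\<lambda>z. (fst z 0, snd z (int n))) \<in> measurable (path_measure \<Otimes>\<^sub>M path_measure) (count_space UNIV)"
    unfolding count_space_pair_nat[symmetric] by measurable
  have "(\<lambda>(x, y). pmf (kstep n x) y / pmf p y) \<in> borel_measurable (count_space UNIV)" by simp
  from measurable_compose[OF * this] show ?thesis by (simp add: step_density_def[abs_def])
qed

lemma measure_past_future_cyl:
  "measure path_measure (cyl {- int l..0} x \<inter> cyl {int n..int (n + m)} y)
    = pmf (kstep n (x 0)) (y (int n)) / pmf p (y (int n)) * (measure path_measure (cyl {- int l..0} x) * measure path_measure (cyl {int n..int (n + m)} y))"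
proof (cases "n = 0 \<and> x 0 \<noteq> y 0")
  case True
  then have e: "cyl {- int l..0} x \<inter> cyl {int n..int (n + m)} y = {}" by (force simp: cyl_def)
  show ?thesis unfolding e using True by simp
next
  case False
  \<comment> \<open>The two prescriptions spliced into one path; if \<open>n = 0\<close> they share
    time 0, where they agree by the case assumption.\<close>
  let ?z = "\<lambda>i. if i \<le> 0 then x i else y i"
  have zy: "?z i = y i" if "i \<in> {int n..int (n + m)}" for i
    using that False by (cases "i = 0") auto
  have zn: "?z (int n) = y (int n)" by (rule zy) simp
  have "cyl {- int l..0} x \<inter> cyl {int n..int (n + m)} y = cyl ({- int l..0} \<union> {int n..int (n + m)}) ?z"
  proof -
    have "(\<forall>i\<in>{- int l..0}. \<omega> i = x i) \<and> (\<forall>i\<in>{int n..int (n + m)}. \<omega> i = y i)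
      \<longleftrightarrow> (\<forall>i\<in>{- int l..0} \<union> {int n..int (n + m)}. \<omega> i = ?z i)" for \<omega> :: "int \<Rightarrow> nat"
    proof -
      have "?z i = x i" if "i \<in> {- int l..0}" for i using that by simp
      then show ?thesis using zy by (metis (no_types, lifting) UnE UnI1 UnI2)
    qed
    then show ?thesis unfolding cyl_def by blast
  qed
  then have "measure path_measure (cyl {- int l..0} x \<inter> cyl {int n..int (n + m)} y)
     = path_weight (- int l) 0 ?z * pmf (kstep n (?z 0)) (?z (int n)) * (path_weight (int n) (int (n + m)) ?z / pmf p (?z (int n)))"
    by (simp only: measure_cyl_gap[of "- int l" 0 "int n" "int (n + m)" n])
  also have "path_weight (- int l) 0 ?z = path_weight (- int l) 0 x"
    by (rule path_weight_cong) auto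
  also have "path_weight (int n) (int (n + m)) ?z = path_weight (int n) (int (n + m)) y"
    using zy by (intro path_weight_cong) auto
  finally show ?thesis unfolding zn by (simp add: measure_cyl)
qed

lemma past_future_measurable:
  shows "(\<lambda>\<omega>. (\<omega>, \<omega>)) \<in> measurable path_measure (past \<Otimes>\<^sub>M future n)"
    and "(\<lambda>z. z) \<in> measurable (density (path_measure \<Otimes>\<^sub>M path_measure) f) (past \<Otimes>\<^sub>M future n)"
proof -
  have "subalgebra path_measure past" "subalgebra path_measure (future n)"
    by (simp_all add: past_def future_def subalgebra_generated)
  then have id1: "(\<lambda>x. x) \<in> measurable path_measure past" "(\<lambda>x. x) \<in> measurable path_measure (future n)"
    by (auto simp: subalgebra_def measurable_def)
  then show "(\<lambda>\<omega>. (\<omega>, \<omega>)) \<in> measurable path_measure (past \<Otimes>\<^sub>M future n)"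
    by (rule measurable_Pair)
  have "(\<lambda>z. (fst z, snd z)) \<in> measurable (path_measure \<Otimes>\<^sub>M path_measure) (past \<Otimes>\<^sub>M future n)"
    using measurable_compose[OF measurable_fst id1(1)] measurable_compose[OF measurable_snd id1(2)]
    by (rule measurable_Pair)
  then show "(\<lambda>z. z) \<in> measurable (density (path_measure \<Otimes>\<^sub>M path_measure) f) (past \<Otimes>\<^sub>M future n)"
    by simp
qed

text \<open>Rectangles of cylinders form an intersection-stable generator, and on a nonempty one the
  density is constant because the windows contain the times 0 and \<open>int n\<close>. For
  \<open>n = 0\<close> the density is \<open>1 / p\<close> on the diagonal; this case yields the
  conditional independence in \<open>markov_at_0\<close>.\<close>

lemma joint_past_future:
  "distr path_measure (past \<Otimes>\<^sub>M future n) (\<lambda>\<omega>. (\<omega>, \<omega>))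
    = distr (density (path_measure \<Otimes>\<^sub>M path_measure) (step_density n)) (past \<Otimes>\<^sub>M future n) (\<lambda>z. z)"
  (is "?L = ?R")
proof -
  let ?I = "\<lambda>m. {- int m..0}" and ?J = "\<lambda>m. {int n..int (n + m)}"
  let ?E = "{a \<times> b | a b. a \<in> cyls ?I \<and> b \<in> cyls ?J}"
  let ?CI = "cyl (?I 0) ` PiE (?I 0) (\<lambda>_. UNIV)" and ?CJ = "cyl (?J 0) ` PiE (?J 0) (\<lambda>_. UNIV)"
  have sp: "space past = UNIV" "space (future n) = UNIV" by (simp_all add: past_def future_def)
  note diag = past_future_measurable(1)[of n] and id2 = past_future_measurable(2)[of "step_density n" n]
  have sets: "sets (past \<Otimes>\<^sub>M future n) = sigma_sets UNIV ?E"
    using sets_pair_eq[of "cyls ?I" past ?CI "cyls ?J" "future n" ?CJ] cyl_cover[of ?I] cyl_cover[of ?J]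
    by (auto simp: sp sets_past sets_future)
  have E1: "a \<in> cyls ?I \<Longrightarrow> a \<in> PM.events" "a \<in> cyls ?J \<Longrightarrow> a \<in> PM.events" for a
    by (auto simp: cyls_def)
  have S1: "a \<in> cyls ?I \<Longrightarrow> a \<in> sets past" "a \<in> cyls ?J \<Longrightarrow> a \<in> sets (future n)" for a
    by (auto simp: sets_past sets_future)
  interpret PP: pair_prob_space path_measure path_measure ..
  show ?thesis
  proof (rule measure_eqI_generator_eq_countable[where E="?E" and \<Omega>=UNIV and A="(\<lambda>(a, b). a \<times> b) ` (?CI \<times> ?CJ)"])
    show "Int_stable ?E"
    proof (rule Int_stableI, safe)
      fix a b a' b' assume *: "a \<in> cyls ?I" "b \<in> cyls ?J" "a' \<in> cyls ?I" "b' \<in> cyls ?J"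
      have "a \<inter> a' \<in> cyls ?I" "b \<inter> b' \<in> cyls ?J"
        using Int_stable_cyls[OF past_intervals(1)] Int_stable_cyls[OF future_intervals(1)] * by (auto simp: Int_stable_def)
      then show "\<exists>c d. a \<times> b \<inter> a' \<times> b' = c \<times> d \<and> c \<in> cyls ?I \<and> d \<in> cyls ?J"
        by (intro exI[of _ "a \<inter> a'"] exI[of _ "b \<inter> b'"]) auto
    qed
    show "emeasure ?L X = emeasure ?R X" if Xin: "X \<in> ?E" for X
    proof -
      obtain a b where ab: "X = a \<times> b" "a \<in> cyls ?I" "b \<in> cyls ?J" using Xin by blast
      have ev [measurable]: "a \<in> PM.events" "b \<in> PM.events" using ab E1 by auto
      have X: "X \<in> sets (past \<Otimes>\<^sub>M future n)" using ab S1 by auto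
      have L: "emeasure ?L X = emeasure path_measure (a \<inter> b)"
        unfolding emeasure_distr[OF diag X] by (rule arg_cong[where f="emeasure path_measure"]) (auto simp: ab)
      have R: "emeasure ?R X = (\<integral>\<^sup>+z. ennreal (step_density n z) * indicator (a \<times> b) z \<partial>(path_measure \<Otimes>\<^sub>M path_measure))"
        using ab(1) X ev by (subst emeasure_distr[OF id2 X]) (auto simp: emeasure_density space_pair_measure)
      show ?thesis
      proof (cases "a = {} \<or> b = {}")
        case True then show ?thesis unfolding L R by auto
      next
        case False
        then obtain l m x y where xy: "a = cyl (?I l) x" "b = cyl (?J m) y" using ab by (auto simp: cyls_def)
        let ?c = "pmf (kstep n (x 0)) (y (int n)) / pmf p (y (int n))"
        have "(\<integral>\<^sup>+z. ennreal (step_density n z) * indicator (a \<times> b) z \<partial>(path_measure \<Otimes>\<^sub>M path_measure))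
           = (\<integral>\<^sup>+z. ennreal ?c * indicator (a \<times> b) z \<partial>(path_measure \<Otimes>\<^sub>M path_measure))"
          by (rule nn_integral_cong) (auto simp: indicator_def step_density_def xy cyl_def)
        also have "\<dots> = ennreal ?c * emeasure (path_measure \<Otimes>\<^sub>M path_measure) (a \<times> b)"
          using ev by (subst nn_integral_cmult_indicator) auto
        also have "\<dots> = ennreal (?c * (measure path_measure a * measure path_measure b))"
          using ev by (simp add: PM.emeasure_pair_measure_Times PM.emeasure_eq_measure ennreal_mult[symmetric] del: times_divide_eq_left)
        also have "\<dots> = emeasure path_measure (a \<inter> b)"
          using measure_past_future_cyl[of l x n m y] by (simp add: xy PM.emeasure_eq_measure)
        finally show ?thesis unfolding L R by simp
      qed
    qed
    show "\<Union> ((\<lambda>(a, b). a \<times> b) ` (?CI \<times> ?CJ)) = UNIV"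
    proof -
      have "\<Union> ((\<lambda>(a, b). a \<times> b) ` (?CI \<times> ?CJ)) = \<Union>?CI \<times> \<Union>?CJ" by blast
      then show ?thesis using cyl_cover(1)[of ?I] cyl_cover(1)[of ?J] by simp
    qed
    show "countable ((\<lambda>(a, b). a \<times> b) ` (?CI \<times> ?CJ))"
      by (intro countable_image countable_SIGMA countable_PiE_nat) auto
    show "(\<lambda>(a, b). a \<times> b) ` (?CI \<times> ?CJ) \<subseteq> ?E"
    proof safe
      fix x y
      show "\<exists>a b. cyl (?I 0) x \<times> cyl (?J 0) y = a \<times> b \<and> a \<in> cyls ?I \<and> b \<in> cyls ?J"
        by (rule exI[of _ "cyl (?I 0) x"], rule exI[of _ "cyl (?J 0) y"])
          (intro conjI refl cyl_in_cyls[of ?I] cyl_in_cyls[of ?J])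
    qed
    show "emeasure ?L a \<noteq> \<infinity>" for a
    proof -
      interpret L: prob_space ?L by (rule PM.prob_space_distr[OF diag])
      show ?thesis by simp
    qed
  qed (use sets in auto)
qed

section \<open>Decay of the Hilbert-Schmidt norm and mixing rates\<close>

lemma coord_law: "distr path_measure (count_space UNIV) (coord k) = measure_pmf p"
proof (rule measure_eqI_countable[where A=UNIV])
  fix x
  have "emeasure (distr path_measure (count_space UNIV) (coord k)) {x} = emeasure path_measure {\<omega>. \<omega> k = x}"
    by (subst emeasure_distr[OF coord_measurable]) (auto intro!: arg_cong[where f="emeasure path_measure"])
  then show "emeasure (distr path_measure (count_space UNIV) (coord k)) {x} = emeasure (measure_pmf p) {x}"
    by (simp add: PM.emeasure_eq_measure measure_one_time emeasure_pmf_single)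
qed auto

text \<open>The squared Hilbert-Schmidt norm of the \<open>n\<close>-step transition operator on the functions of mean \<open>0\<close>.\<close>

definition step_chi2 :: "nat \<Rightarrow> ennreal" where
  "step_chi2 n = (\<integral>\<^sup>+x. \<integral>\<^sup>+y. ennreal ((pmf (kstep n x) y / pmf p y - 1)\<^sup>2) \<partial>measure_pmf p \<partial>measure_pmf p)"

lemma nn_integral_step_density:
  "(\<integral>\<^sup>+z. ennreal ((step_density n z - 1)\<^sup>2) \<partial>(path_measure \<Otimes>\<^sub>M path_measure)) = step_chi2 n"
proof -
  note [measurable] = coord_measurable
  let ?f = "\<lambda>x y. ennreal ((pmf (kstep n x) y / pmf p y - 1)\<^sup>2)"
  have "(\<integral>\<^sup>+z. ennreal ((step_density n z - 1)\<^sup>2) \<partial>(path_measure \<Otimes>\<^sub>M path_measure))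
    = (\<integral>\<^sup>+\<omega>. \<integral>\<^sup>+\<omega>'. ?f (\<omega> 0) (\<omega>' (int n)) \<partial>path_measure \<partial>path_measure)"
    by (subst PM.nn_integral_fst[symmetric]) (simp_all add: step_density_def)
  also have "\<dots> = (\<integral>\<^sup>+\<omega>. \<integral>\<^sup>+y. ?f (\<omega> 0) y \<partial>distr path_measure (count_space UNIV) (coord (int n)) \<partial>path_measure)"
    by (intro nn_integral_cong) (simp add: nn_integral_distr)
  also have "\<dots> = (\<integral>\<^sup>+\<omega>. \<integral>\<^sup>+y. ?f (\<omega> 0) y \<partial>measure_pmf p \<partial>path_measure)"
    by (simp only: coord_law)
  also have "\<dots> = (\<integral>\<^sup>+x. \<integral>\<^sup>+y. ?f x y \<partial>measure_pmf p \<partial>distr path_measure (count_space UNIV) (coord 0))"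
    by (simp add: nn_integral_distr)
  finally show ?thesis by (simp only: coord_law step_chi2_def)
qed

text \<open>Since \<open>p\<close> charges every state, every law on the states is absolutely
  continuous with respect to it.\<close>

lemma pmf_density: "measure_pmf q = density (measure_pmf p) (\<lambda>y. ennreal (pmf q y / pmf p y))"
proof (rule measure_eqI_countable[where A=UNIV])
  fix x
  have "emeasure (density (measure_pmf p) (\<lambda>y. ennreal (pmf q y / pmf p y))) {x} = ennreal (pmf q x / pmf p x) * ennreal (pmf p x)"
    by (subst emeasure_density) (simp_all add: nn_integral_cmult_indicator emeasure_pmf_single)
  also have "\<dots> = ennreal (pmf q x)" using p_pos[of x] by (simp add: ennreal_mult[symmetric])
  finally show "emeasure (measure_pmf q) {x} = emeasure (density (measure_pmf p) (\<lambda>y. ennreal (pmf q y / pmf p y))) {x}"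
    by (simp add: emeasure_pmf_single)
qed auto

lemma bind_p_K: "bind_pmf p K = p"
proof (rule pmf_eqI)
  fix z
  have "ennreal (pmf (bind_pmf p K) z) = (\<integral>\<^sup>+y. ennreal (pmf p y) * ennreal (pmf (K y) z) \<partial>count_space UNIV)"
    by (simp add: ennreal_pmf_bind nn_integral_measure_pmf)
  also have "\<dots> = (\<integral>\<^sup>+y. ennreal (pmf p z) * ennreal (pmf (K z) y) \<partial>count_space UNIV)"
    by (simp add: ennreal_mult[symmetric] balance)
  also have "\<dots> = ennreal (pmf p z)"
    by (simp add: nn_integral_cmult nn_integral_pmf)
  finally show "pmf (bind_pmf p K) z = pmf p z" by simp
qed

lemma bind_p_kstep: "bind_pmf p (kstep n) = p"
proof (induction n)
  case 0
  have "kstep 0 = return_pmf" by (simp add: fun_eq_iff)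
  then show ?case by (simp add: bind_return_pmf')
next
  case (Suc n)
  have "kstep (Suc n) = (\<lambda>x. bind_pmf (K x) (kstep n))" by (simp add: fun_eq_iff)
  then show ?case using Suc by (simp add: bind_assoc_pmf[symmetric] bind_p_K)
qed

lemma kstep_1: "kstep (Suc 0) x = K x"
proof -
  have "kstep 0 = return_pmf" by (simp add: fun_eq_iff)
  then show ?thesis by (simp add: bind_return_pmf')
qed

text \<open>The centred densities compose like kernels: integrating \<open>u 1 x y * u n y z\<close>
  over \<open>y\<close> with respect to \<open>p\<close> gives \<open>u (Suc n) x z\<close>.
  Cauchy-Schwarz in \<open>y\<close>, followed by integration over \<open>x\<close> and
  \<open>z\<close>, makes the squared norm submultiplicative.\<close>

lemma step_chi2_Suc: "step_chi2 (Suc n) \<le> step_chi2 1 * step_chi2 n"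
proof -
  define u where "u n x y = pmf (kstep n x) y / pmf p y - 1" for n x y
  define N where "N k x = (\<integral>\<^sup>+y. ennreal ((u k x y)\<^sup>2) \<partial>measure_pmf p)" for k x
  have sq: "ennreal (\<bar>x\<bar>) ^ 2 = ennreal (x ^ 2)" for x by (simp add: ennreal_power)
  have rec: "ennreal ((u (Suc n) x z)\<^sup>2) \<le> N 1 x * (\<integral>\<^sup>+y. ennreal ((u n y z)\<^sup>2) \<partial>measure_pmf p)" for x z
  proof -
    let ?a = "\<lambda>y. pmf (K x) y / pmf p y" and ?b = "\<lambda>y. pmf (kstep n y) z / pmf p z"
    have b: "?b \<in> borel_measurable (measure_pmf q)" "integrable (measure_pmf q) ?b" for q
    proof -
      show "integrable (measure_pmf q) ?b"
        by (rule measure_pmf.integrable_const_bound[of _ "1 / pmf p z"])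
          (auto simp: pmf_le_1 divide_right_mono)
    qed simp
    have i1: "integrable (measure_pmf p) ?a" and i1v: "(\<integral>y. ?a y \<partial>measure_pmf p) = 1"
    proof -
      have "integrable (density (measure_pmf p) (\<lambda>y. ennreal (?a y))) (\<lambda>_. 1 :: real)"
        unfolding pmf_density[symmetric] by simp
      then show "integrable (measure_pmf p) ?a" by (subst (asm) integrable_density) auto
      have "(\<integral>y. 1 \<partial>measure_pmf (K x)) = (\<integral>y. ?a y \<partial>measure_pmf p)"
        unfolding pmf_density[of "K x"] by (subst integral_density) auto
      then show "(\<integral>y. ?a y \<partial>measure_pmf p) = 1" by simp
    qed
    have i3: "integrable (measure_pmf p) (\<lambda>y. ?a y * ?b y)"
      and i3v: "(\<integral>y. ?a y * ?b y \<partial>measure_pmf p) = pmf (kstep (Suc n) x) z / pmf p z"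
    proof -
      have "integrable (density (measure_pmf p) (\<lambda>y. ennreal (?a y))) ?b"
        unfolding pmf_density[symmetric] by (rule b)
      then show "integrable (measure_pmf p) (\<lambda>y. ?a y * ?b y)" by (subst (asm) integrable_density) auto
      have "(\<integral>y. ?b y \<partial>measure_pmf (K x)) = (\<integral>y. ?a y * ?b y \<partial>measure_pmf p)"
        unfolding pmf_density[of "K x"] by (subst integral_density) auto
      then show "(\<integral>y. ?a y * ?b y \<partial>measure_pmf p) = pmf (kstep (Suc n) x) z / pmf p z"
        by (simp add: pmf_bind)
    qed
    have i2v: "(\<integral>y. ?b y \<partial>measure_pmf p) = 1"
      using p_pos[of z] pmf_bind[of p "kstep n" z] by (simp add: bind_p_kstep)
    \<comment> \<open>Both single factors integrate to 1, \<open>?a\<close> because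
      \<open>K x\<close> is a probability and \<open>?b\<close> because \<open>p\<close> is
      stationary. The cross terms therefore leave exactly the centring constant of the composed
      kernel.\<close>
    have u: "u 1 x y * u n y z = ?a y * ?b y - ?a y - ?b y + 1" for y
    proof -
      have "u 1 x y = ?a y - 1" by (simp add: u_def kstep_1 del: kstep.simps)
      moreover have "u n y z = ?b y - 1" by (simp add: u_def)
      moreover have "(a - 1) * (b - 1) = a * b - a - b + 1" for a b :: real by (simp add: algebra_simps)
      ultimately show ?thesis by (simp only:)
    qed
    have iu: "integrable (measure_pmf p) (\<lambda>y. u 1 x y * u n y z)"
      unfolding u using i1 i3 b(2) by (intro Bochner_Integration.integrable_add Bochner_Integration.integrable_diff) auto
    have "(\<integral>y. u 1 x y * u n y z \<partial>measure_pmf p) = u (Suc n) x z"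
    proof -
      have "(\<integral>y. u 1 x y * u n y z \<partial>measure_pmf p)
         = (\<integral>y. ?a y * ?b y \<partial>measure_pmf p) - (\<integral>y. ?a y \<partial>measure_pmf p) - (\<integral>y. ?b y \<partial>measure_pmf p) + 1"
        unfolding u using i1 i3 b(2)[of p]
        by (simp only: Bochner_Integration.integral_add Bochner_Integration.integral_diff
            Bochner_Integration.integrable_diff measure_pmf.integrable_const) simp
      then show ?thesis unfolding i3v i1v i2v by (simp add: u_def)
    qed
    then have "ennreal \<bar>u (Suc n) x z\<bar> \<le> (\<integral>\<^sup>+y. ennreal \<bar>u 1 x y * u n y z\<bar> \<partial>measure_pmf p)"
      using integral_norm_bound_ennreal[OF iu] by simp
    also have "\<dots> = (\<integral>\<^sup>+y. ennreal \<bar>u 1 x y\<bar> * ennreal \<bar>u n y z\<bar> \<partial>measure_pmf p)"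
      by (simp add: abs_mult ennreal_mult)
    finally have "(ennreal \<bar>u (Suc n) x z\<bar>)\<^sup>2 \<le> (\<integral>\<^sup>+y. ennreal \<bar>u 1 x y\<bar> * ennreal \<bar>u n y z\<bar> \<partial>measure_pmf p)\<^sup>2"
      by (rule power_mono) simp
    also have "\<dots> \<le> (\<integral>\<^sup>+y. (ennreal \<bar>u 1 x y\<bar>)\<^sup>2 \<partial>measure_pmf p) * (\<integral>\<^sup>+y. (ennreal \<bar>u n y z\<bar>)\<^sup>2 \<partial>measure_pmf p)"
      by (rule Cauchy_Schwarz_nn_integral) simp_all
    finally show ?thesis by (simp only: sq N_def)
  qed
  have "step_chi2 (Suc n) = (\<integral>\<^sup>+x. \<integral>\<^sup>+z. ennreal ((u (Suc n) x z)\<^sup>2) \<partial>measure_pmf p \<partial>measure_pmf p)"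
    by (simp only: step_chi2_def u_def)
  also have "\<dots> \<le> (\<integral>\<^sup>+x. \<integral>\<^sup>+z. N 1 x * (\<integral>\<^sup>+y. ennreal ((u n y z)\<^sup>2) \<partial>measure_pmf p) \<partial>measure_pmf p \<partial>measure_pmf p)"
    by (intro nn_integral_mono rec)
  also have "\<dots> = (\<integral>\<^sup>+x. N 1 x \<partial>measure_pmf p) * (\<integral>\<^sup>+z. \<integral>\<^sup>+y. ennreal ((u n y z)\<^sup>2) \<partial>measure_pmf p \<partial>measure_pmf p)"
    by (simp add: nn_integral_cmult nn_integral_multc)
  also have "(\<integral>\<^sup>+z. \<integral>\<^sup>+y. ennreal ((u n y z)\<^sup>2) \<partial>measure_pmf p \<partial>measure_pmf p)
     = (\<integral>\<^sup>+y. \<integral>\<^sup>+z. ennreal ((u n y z)\<^sup>2) \<partial>measure_pmf p \<partial>measure_pmf p)"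
  proof (rule pair_sigma_finite.Fubini')
    show "pair_sigma_finite (measure_pmf p) (measure_pmf p)"
      by (simp add: pair_sigma_finite_def measure_pmf.sigma_finite_measure_axioms)
    have "sets (measure_pmf p \<Otimes>\<^sub>M measure_pmf p) = sets (count_space UNIV \<Otimes>\<^sub>M count_space UNIV)"
      by (rule sets_pair_measure_cong) simp_all
    also have "\<dots> = sets (count_space UNIV)" by (rule arg_cong[where f=sets, OF count_space_pair_nat])
    finally have "sets (measure_pmf p \<Otimes>\<^sub>M measure_pmf p) = sets (count_space UNIV)" .
    then show "(\<lambda>(y, z). ennreal ((u n y z)\<^sup>2)) \<in> borel_measurable (measure_pmf p \<Otimes>\<^sub>M measure_pmf p)"
      by (simp add: measurable_cong_sets)
  qed
  finally show ?thesis by (simp only: step_chi2_def u_def N_def)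
qed

lemma step_chi2_le:
  assumes "step_chi2 1 \<le> ennreal c" "0 \<le> c" "n \<ge> 1"
  shows "step_chi2 n \<le> ennreal (c ^ n)"
  using assms(3)
proof (induction n rule: dec_induct)
  case base
  then show ?case using assms by simp
next
  case (step n)
  have "step_chi2 (Suc n) \<le> step_chi2 1 * step_chi2 n" by (rule step_chi2_Suc)
  also have "\<dots> \<le> ennreal c * ennreal (c ^ n)" using assms step by (intro mult_mono) auto
  finally show ?case using assms by (simp add: ennreal_mult)
qed

text \<open>The assumption has the square of \<open>c\<close> because the bounds for the correlation
  and for the total variation cost a square root.\<close>

lemma mixing_bounds:
  assumes c: "step_chi2 1 \<le> ennreal (c\<^sup>2)" "0 \<le> c" "c \<le> 1" and n: "n \<ge> 1"
  shows "rho_mix path_measure (count_space UNIV) coord n \<le> ereal (c ^ n)"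
    and "beta_mix path_measure (count_space UNIV) coord n \<le> ereal (c ^ n)"
    and "info_mix path_measure (count_space UNIV) coord n \<le> ereal (c ^ n)"
proof -
  have X: "step_chi2 n \<le> ennreal ((c ^ n)\<^sup>2)"
    using step_chi2_le[OF c(1) _ n] by (simp add: power_mult[symmetric] mult.commute)
  interpret PP: pair_prob_space path_measure path_measure ..
  have sq: "integrable (path_measure \<Otimes>\<^sub>M path_measure) (\<lambda>z. (step_density n z - 1)\<^sup>2)"
  proof (rule integrableI_bounded)
    show "(\<integral>\<^sup>+z. ennreal (norm ((step_density n z - 1)\<^sup>2)) \<partial>(path_measure \<Otimes>\<^sub>M path_measure)) < \<infinity>"
      using X nn_integral_step_density[of n] by (simp add: le_less_trans[OF _ ennreal_less_top])
  qed simp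
  interpret D: square_density path_measure past "future n" "step_density n"
  proof
    show "subalgebra path_measure past" "subalgebra path_measure (future n)"
      by (simp_all add: past_def future_def subalgebra_generated)
  qed (use sq joint_past_future in \<open>auto simp: step_density_def[abs_def]\<close>)
  have "ennreal D.chi2 = step_chi2 n"
    unfolding D.chi2_def nn_integral_step_density[symmetric]
    by (rule nn_integral_eq_integral[symmetric, OF sq]) simp
  then have le: "D.chi2 \<le> (c ^ n)\<^sup>2" using X by (metis ennreal_le_iff zero_le_power2)
  then have "sqrt D.chi2 \<le> c ^ n" using real_sqrt_le_mono[OF le] c by simp
  then show "rho_mix path_measure (count_space UNIV) coord n \<le> ereal (c ^ n)"
    "beta_mix path_measure (count_space UNIV) coord n \<le> ereal (c ^ n)"
    using D.rho_coeff_le D.beta_coeff_le order_trans ereal_less_eq(3)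
    unfolding rho_mix_def beta_mix_def past_def future_def by metis+
  \<comment> \<open>The information bound comes without a square root, hence with room to
    spare.\<close>
  have "(c ^ n)\<^sup>2 \<le> c ^ n" using c by (simp add: power2_eq_square mult_left_le power_le_one)
  then have "ereal D.chi2 \<le> ereal (c ^ n)" using le by simp
  with D.info_coeff_le show "info_mix path_measure (count_space UNIV) coord n \<le> ereal (c ^ n)"
    unfolding info_mix_def past_def future_def by (rule order_trans)
qed

end

section \<open>Correlation of nearly equal events\<close>

lemma (in prob_space) abs_corr_le_1:
  assumes f: "f \<in> borel_measurable M" "integrable M (\<lambda>x. (f x)\<^sup>2)"
    and g: "g \<in> borel_measurable M" "integrable M (\<lambda>x. (g x)\<^sup>2)"
  shows "\<bar>corr M f g\<bar> \<le> 1"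
proof -
  define u where "u = (\<lambda>x. f x - expectation f)"
  define v where "v = (\<lambda>x. g x - expectation g)"
  have if1: "integrable M f" "integrable M g" by (rule square_integrable_imp_integrable; fact)+
  have [measurable]: "u \<in> borel_measurable M" "v \<in> borel_measurable M" using f g by (auto simp: u_def v_def)
  have u2: "integrable M (\<lambda>x. (u x)\<^sup>2)" and v2: "integrable M (\<lambda>x. (v x)\<^sup>2)"
    using f g if1 by (auto simp: u_def v_def power2_diff)
  have sq: "ennreal \<bar>x\<bar> ^ 2 = ennreal (x\<^sup>2)" for x by (simp add: ennreal_power)
  have "ennreal \<bar>expectation (\<lambda>x. u x * v x)\<bar> \<le> (\<integral>\<^sup>+x. ennreal \<bar>u x * v x\<bar> \<partial>M)"
  proof (cases "integrable M (\<lambda>x. u x * v x)")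
    case True then show ?thesis using integral_norm_bound_ennreal[OF True] by simp
  qed (simp add: not_integrable_integral_eq)
  also have "\<dots> = (\<integral>\<^sup>+x. ennreal \<bar>u x\<bar> * ennreal \<bar>v x\<bar> \<partial>M)" by (simp add: abs_mult ennreal_mult)
  finally have "(ennreal \<bar>expectation (\<lambda>x. u x * v x)\<bar>)\<^sup>2 \<le> (\<integral>\<^sup>+x. ennreal \<bar>u x\<bar> * ennreal \<bar>v x\<bar> \<partial>M)\<^sup>2"
    by (rule power_mono) simp
  also have "\<dots> \<le> (\<integral>\<^sup>+x. (ennreal \<bar>u x\<bar>)\<^sup>2 \<partial>M) * (\<integral>\<^sup>+x. (ennreal \<bar>v x\<bar>)\<^sup>2 \<partial>M)"
    by (rule Cauchy_Schwarz_nn_integral) measurable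
  also have "\<dots> = ennreal (expectation (\<lambda>x. (u x)\<^sup>2) * expectation (\<lambda>x. (v x)\<^sup>2))"
    unfolding sq using u2 v2 by (simp add: nn_integral_eq_integral ennreal_mult)
  finally have le: "(expectation (\<lambda>x. u x * v x))\<^sup>2 \<le> expectation (\<lambda>x. (u x)\<^sup>2) * expectation (\<lambda>x. (v x)\<^sup>2)"
    unfolding sq by (simp add: ennreal_le_iff)
  have c: "corr M f g = expectation (\<lambda>x. u x * v x) / sqrt (expectation (\<lambda>x. (u x)\<^sup>2) * expectation (\<lambda>x. (v x)\<^sup>2))"
    by (simp add: corr_def u_def v_def)
  show ?thesis unfolding c using real_sqrt_le_mono[OF le] by (intro abs_div_le) auto
qed

lemma (in prob_space) rho_coeff_le_1:
  assumes "subalgebra M F" "subalgebra M G"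
  shows "rho_coeff M F G \<le> 1"
  unfolding rho_coeff_def
proof (rule SUP_least, clarify)
  fix f g assume "f \<in> square_integrable M F" "g \<in> square_integrable M G"
  then have "\<bar>corr M f g\<bar> \<le> 1"
    using assms by (intro abs_corr_le_1) (auto simp: square_integrable_def intro: measurable_from_subalg)
  then show "ereal \<bar>corr M f g\<bar> \<le> 1" by (simp add: one_ereal_def)
qed

lemma (in prob_space) corr_indicator:
  assumes [measurable]: "A \<in> events" "B \<in> events"
  shows "corr M (indicator A) (indicator B)
    = (prob (A \<inter> B) - prob A * prob B) / sqrt ((prob A * (1 - prob A)) * (prob B * (1 - prob B)))"
proof -
  have cov: "(\<integral>x. (indicator C x - prob C) * (indicator D x - prob D) \<partial>M) = prob (C \<inter> D) - prob C * prob D"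
    if [measurable]: "C \<in> events" "D \<in> events" for C D
  proof -
    have i: "integrable M (indicator E :: 'a \<Rightarrow> real)" if "E \<in> events" for E
      using that by (simp add: emeasure_eq_measure)
    have "(\<integral>x. (indicator C x - prob C) * (indicator D x - prob D) \<partial>M)
        = (\<integral>x. indicator (C \<inter> D) x - prob C * indicator D x - prob D * indicator C x + prob C * prob D \<partial>M)"
      by (rule Bochner_Integration.integral_cong) (auto simp: indicator_def algebra_simps)
    also have "\<dots> = prob (C \<inter> D) - prob C * prob D"
      using i[of "C \<inter> D"] i[of C] i[of D] by (simp add: prob_space)
    finally show ?thesis .
  qed
  have "(\<integral>x. (indicator C x - prob C)\<^sup>2 \<partial>M) = prob C * (1 - prob C)" if "C \<in> events" for C
    using cov[OF that that] by (simp add: power2_eq_square algebra_simps)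
  then show ?thesis by (simp add: corr_def cov)
qed

text \<open>The errors are measured relative to \<open>prob A\<close>, as \<open>A\<close> may be
  tiny. The covariance is at least \<open>(1 - 2 * e - e * e) * prob A\<close> and the product of
  the standard deviations at most \<open>(1 + e) * prob A\<close>; the constant 4 is a convenient
  one for which \<open>(1 - 4 * e) * (1 + e)\<close> stays below the first factor.\<close>

lemma (in prob_space) corr_indicator_ge:
  assumes ev: "A \<in> events" "B \<in> events" and e: "0 < e" "e < 1 / 4"
    and A: "0 < prob A" "prob A \<le> e" "prob (A \<inter> B) \<ge> (1 - e) * prob A" and B: "prob (B - A) \<le> e * prob A"
  shows "corr M (indicator A) (indicator B) \<ge> 1 - 4 * e"
proof -
  let ?a = "prob A" and ?b = "prob B"
  have "?b = prob (A \<inter> B) + prob (B - A)"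
    using finite_measure_Diff'[OF ev(2,1)] by (simp add: Int_commute)
  moreover have "prob (A \<inter> B) \<le> ?a" using ev by (intro finite_measure_mono) auto
  ultimately have b: "?b \<le> (1 + e) * ?a" using B by (simp add: algebra_simps)
  have b0: "0 < ?b"
  proof -
    have "0 < (1 - e) * ?a" using A e by simp
    also have "\<dots> \<le> prob (A \<inter> B)" by (rule A)
    also have "\<dots> \<le> ?b" using ev by (intro finite_measure_mono) auto
    finally show ?thesis .
  qed
  have b1: "?b < 1"
  proof -
    have "(1 + e) * ?a \<le> (1 + e) * e" using A e by (intro mult_left_mono) auto
    also have "\<dots> \<le> (1 + 1/2) * e" using e by (intro mult_right_mono) auto
    also have "\<dots> < 1" using e by simp
    finally show ?thesis using b by simp
  qed
  let ?d = "sqrt ((?a * (1 - ?a)) * (?b * (1 - ?b)))"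
  have pos: "0 < (?a * (1 - ?a)) * (?b * (1 - ?b))" using A b0 b1 e by simp
  have "(?a * (1 - ?a)) * (?b * (1 - ?b)) \<le> ?a * ?b"
    using A b0 b1 e by (intro mult_mono) (auto simp: mult_left_le)
  also have "\<dots> \<le> ?a * ((1 + e) * ?a)" using A b by (intro mult_left_mono) auto
  also have "\<dots> \<le> ((1 + e) * ?a)\<^sup>2" using A e by (simp add: power2_eq_square algebra_simps)
  finally have d: "?d \<le> (1 + e) * ?a" using real_le_lsqrt A e by (simp add: real_sqrt_le_iff real_le_lsqrt)
  have "?a * ?b \<le> ?a * ((1 + e) * ?a)" using A b by (intro mult_left_mono) auto
  also have "\<dots> \<le> ?a * ((1 + e) * e)" using A e by (intro mult_left_mono) auto
  finally have num: "prob (A \<inter> B) - ?a * ?b \<ge> (1 - e - (1 + e) * e) * ?a" using A by (simp add: algebra_simps)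
  have "(1 - 4 * e) * ?d \<le> prob (A \<inter> B) - ?a * ?b"
  proof -
    have "(1 - 4 * e) * ?d \<le> (1 - 4 * e) * ((1 + e) * ?a)" using d e by (intro mult_left_mono) auto
    also have "\<dots> \<le> (1 - e - (1 + e) * e) * ?a"
      unfolding mult.assoc[symmetric] using A e by (intro mult_right_mono) (auto simp: algebra_simps)
    finally show ?thesis using num by simp
  qed
  then show ?thesis using pos ev by (simp add: corr_indicator le_divide_eq)
qed

section \<open>Irreducibility, entropy and two-sided correlation of a reversible chain\<close>

context reversible_kernel begin

lemma stationary: "strictly_stationary path_measure (count_space UNIV) coord"
  using coord_measurable distr_shift distr_shift[of 0] by (simp add: strictly_stationary_def path_law_def)

lemma reversible_path_measure: "reversible path_measure (count_space UNIV) coord"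
  using distr_reverse distr_shift[of 0] by (simp add: reversible_def path_law_def)

lemma markov_chain: "countable_state_markov_chain path_measure UNIV coord"
  unfolding countable_state_markov_chain_def
proof (intro conjI allI ballI impI)
  fix k :: int and m :: nat and x :: "int \<Rightarrow> nat" and y :: nat
  let ?a = "k - int m" and ?y = "x(k + 1 := y)"
  assume pos: "\<P>(\<omega> in path_measure. \<forall>i\<in>{?a..k}. \<omega> i = x i) > 0"
  have 1: "\<P>(\<omega> in path_measure. \<forall>i\<in>{?a..k}. \<omega> i = x i) = path_weight ?a k x"
    using measure_cyl[of ?a k x] by (simp add: cyl_def)
  have "{\<omega>. \<omega> (k + 1) = y \<and> (\<forall>i\<in>{?a..k}. \<omega> i = x i)} = cyl {?a..k + 1} ?y"
  proof -
    have "{?a..k + 1} = insert (k + 1) {?a..k}" by auto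
    then show ?thesis by (auto simp: cyl_def)
  qed
  then have 2: "\<P>(\<omega> in path_measure. \<omega> (k + 1) = y \<and> (\<forall>i\<in>{?a..k}. \<omega> i = x i)) = path_weight ?a k x * pmf (K (x k)) y"
    using measure_cyl[of ?a "k + 1" ?y] path_weight_extend[of ?a k ?y] path_weight_cong[of ?a k ?y x] by simp
  have 3: "\<P>(\<omega> in path_measure. \<omega> (k + 1) = y \<and> \<omega> k = x k) = pmf p (x k) * pmf (K (x k)) y"
    using measure_two_times[of k "x k" 1 y] kstep_1[of "x k"] by (simp add: conj_commute del: kstep.simps)
  show "\<P>(\<omega> in path_measure. \<omega> (k + 1) = y \<bar> \<forall>i\<in>{?a..k}. \<omega> i = x i) = \<P>(\<omega> in path_measure. \<omega> (k + 1) = y \<bar> \<omega> k = x k)"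
    unfolding cond_prob_def 1 2 3 using pos[unfolded 1] p_pos[of "x k"] by (simp add: measure_one_time)
qed (use coord_measurable in auto)

definition edges :: "(nat \<times> nat) set" where "edges = {(x, y). pmf (K x) y > 0}"

lemma sym_edges: "sym edges"
proof (rule symI)
  fix x y assume "(x, y) \<in> edges"
  then have "0 < pmf p y * pmf (K y) x" using p_pos[of x] balance[of x y] by (simp add: edges_def flip: balance)
  then show "(y, x) \<in> edges" using p_pos[of y] by (simp add: edges_def zero_less_mult_iff)
qed

lemma kstep_pos_iff: "pmf (kstep n x) y > 0 \<longleftrightarrow> (x, y) \<in> edges ^^ n"
proof (induction n arbitrary: x)
  case 0 then show ?case by (auto simp: indicator_def)
next
  case (Suc n)
  have "pmf (kstep (Suc n) x) y > 0 \<longleftrightarrow> y \<in> set_pmf (kstep (Suc n) x)" by (simp add: pmf_positive_iff)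
  also have "\<dots> \<longleftrightarrow> (\<exists>z. pmf (K x) z > 0 \<and> pmf (kstep n z) y > 0)" by (auto simp: pmf_positive_iff)
  also have "\<dots> \<longleftrightarrow> (x, y) \<in> edges O edges ^^ n" using Suc by (auto simp: edges_def)
  finally show ?case by (simp add: relpow_commute)
qed

lemma cond_prob_step: "\<P>(\<omega> in path_measure. \<omega> (int n) = y \<bar> \<omega> 0 = x) = pmf (kstep n x) y"
  using measure_two_times[of 0 x n y] measure_one_time[of 0 x] p_pos[of x]
  by (simp add: cond_prob_def conj_commute)

text \<open>Walk from \<open>x\<close> to \<open>z\<close>, wait there \<open>k\<close> steps on the
  loop, and follow the reversed walk to \<open>y\<close>. The free \<open>k\<close> gives
  irreducibility and, with two consecutive values, return times whose gcd is 1.\<close>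

lemma return_path:
  assumes z: "pmf (K z) z > 0" and x: "(x, z) \<in> edges ^^ m" and y: "(y, z) \<in> edges ^^ n"
  shows "pmf (kstep (m + n + k) x) y > 0"
proof -
  have zz: "(z, z) \<in> edges ^^ k"
  proof (induction k)
    case (Suc k) then show ?case using z by (auto simp: edges_def intro!: relcompI)
  qed simp
  have "sym (edges ^^ n)"
  proof (induction n)
    case (Suc n) then show ?case using sym_edges by (auto simp: sym_def) (metis relcompI relpow_commute relpow.simps(2))
  qed (simp add: sym_Id)
  then have "(z, y) \<in> edges ^^ n" using y by (auto dest: symD)
  then have "(x, y) \<in> edges ^^ m O edges ^^ k O edges ^^ n" using x zz by blast
  then have "(x, y) \<in> edges ^^ (m + n + k)" by (simp add: relpow_add[symmetric] add.commute add.left_commute)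
  then show ?thesis by (simp add: kstep_pos_iff)
qed

lemma irreducible_aperiodic:
  assumes z: "pmf (K z) z > 0" and conn: "\<And>x. (x, z) \<in> edges\<^sup>*"
  shows "irreducible_chain path_measure UNIV coord" "aperiodic_chain path_measure UNIV coord"
proof -
  have *: "\<exists>n. (x, z) \<in> edges ^^ n" for x using conn rtrancl_power by blast
  show "irreducible_chain path_measure UNIV coord"
    unfolding irreducible_chain_def cond_prob_step
  proof safe
    fix x y
    obtain m n where "(x, z) \<in> edges ^^ m" "(y, z) \<in> edges ^^ n" using * by blast
    from return_path[OF z this, of 1] show "\<exists>n\<ge>1. pmf (kstep n x) y > 0" by (intro exI[of _ "m + n + 1"]) simp
  qed
  show "aperiodic_chain path_measure UNIV coord"
    unfolding aperiodic_chain_def cond_prob_step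
  proof safe
    fix x
    obtain m where m: "(x, z) \<in> edges ^^ m" using * by blast
    let ?S = "{n. n \<ge> 1 \<and> pmf (kstep n x) x > 0}"
    have "m + m + 1 \<in> ?S" "m + m + 2 \<in> ?S" using return_path[OF z m m, of 1] return_path[OF z m m, of 2] by auto
    then have "Gcd ?S dvd m + m + 1" "Gcd ?S dvd m + m + 2" by (auto intro: Gcd_dvd)
    then have "Gcd ?S dvd (m + m + 2) - (m + m + 1)" by (rule dvd_diff_nat[rotated])
    then show "Gcd ?S = 1" by simp
  qed
qed

text \<open>Preimages under a single map already form a \<sigma>-field. The exact description is
  needed to identify the atoms.\<close>

lemma sets_field_0: "A \<in> sets (generated_field path_measure (count_space UNIV) coord {0}) \<longleftrightarrow> (\<exists>E. A = {\<omega>. \<omega> 0 \<in> E})"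
proof
  assume "A \<in> sets (generated_field path_measure (count_space UNIV) coord {0})"
  then have "A \<in> sigma_sets UNIV {coord k -` E \<inter> UNIV |k E. k \<in> {0} \<and> E \<in> sets (count_space UNIV)}"
    by (simp add: generated_field_def)
  then show "\<exists>E. A = {\<omega>. \<omega> 0 \<in> E}"
  proof induction
    case (Basic a) then show ?case by auto
  next
    case Empty show ?case by (intro exI[of _ "{}"]) auto
  next
    case (Compl a)
    then obtain E where "a = {\<omega>. \<omega> 0 \<in> E}" by blast
    then show ?case by (intro exI[of _ "- E"]) auto
  next
    case (Union a)
    then obtain E where "\<And>i. a i = {\<omega>. \<omega> 0 \<in> E i}" by metis
    then show ?case by (intro exI[of _ "\<Union>i. E i"]) auto
  qed
next
  assume "\<exists>E. A = {\<omega>. \<omega> 0 \<in> E}"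
  then obtain E where "A = coord 0 -` E \<inter> UNIV" by auto
  then show "A \<in> sets (generated_field path_measure (count_space UNIV) coord {0})"
    by (auto simp: generated_field_def intro!: sigma_sets.Basic)
qed

lemma measure_coord_in: "measure path_measure {\<omega>. \<omega> k \<in> E} = measure p E"
proof -
  have "measure p E = measure (distr path_measure (count_space UNIV) (coord k)) E" by (simp add: coord_law)
  also have "\<dots> = measure path_measure {\<omega>. \<omega> k \<in> E}"
    by (subst measure_distr[OF coord_measurable]) (auto intro!: arg_cong[where f="measure path_measure"])
  finally show ?thesis by simp
qed

text \<open>The definition of entropy picks an arbitrary atom decomposition. As every state has
  positive mass, each atom is a fibre of \<open>\<omega> 0\<close>, so the chosen decomposition is a
  subfamily of the fibres and its sum is controlled by finite sums over states.\<close>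

lemma field_entropy_le:
  assumes "\<And>F. finite F \<Longrightarrow> (\<Sum>x\<in>F. - (pmf p x * ln (pmf p x))) \<le> r"
  shows "field_entropy path_measure (generated_field path_measure (count_space UNIV) coord {0}) \<le> ennreal r"
proof -
  let ?G = "generated_field path_measure (count_space UNIV) coord {0}"
  let ?a = "\<lambda>x. {\<omega>. \<omega> 0 = x} :: (int \<Rightarrow> nat) set"
  let ?g = "\<lambda>A. ennreal (- (measure path_measure A * ln (measure path_measure A)))"
  have atom: "prob_atom path_measure ?G (?a x)" for x
    unfolding prob_atom_def
  proof (intro conjI ballI impI)
    show "?a x \<in> sets ?G" unfolding sets_field_0 by (intro exI[of _ "{x}"]) auto
    show "0 < measure path_measure (?a x)" by (simp add: measure_one_time p_pos)
    fix B assume "B \<in> sets ?G" "B \<subseteq> ?a x"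
    then obtain E where E: "B = {\<omega>. \<omega> 0 \<in> E}" "{\<omega>. \<omega> 0 \<in> E} \<subseteq> ?a x" unfolding sets_field_0 by blast
    have "E \<subseteq> {x}"
    proof
      fix y assume "y \<in> E"
      then have "(\<lambda>_. y) \<in> ?a x" using E(2) by auto
      then show "y \<in> {x}" by simp
    qed
    then have "E = {} \<or> E = {x}" by auto
    then show "measure path_measure B = 0 \<or> measure path_measure B = measure path_measure (?a x)"
      using E(1) by auto
  qed
  have "atom_decomposition path_measure ?G (range ?a)"
    unfolding atom_decomposition_def
  proof (intro conjI)
    have "\<Union>(range ?a) = UNIV" by auto
    then show "measure path_measure (\<Union>(range ?a)) = 1" using PM.prob_space by simp
  qed (use atom in \<open>auto simp: disjoint_def\<close>)
  then have ex: "\<exists>C. atom_decomposition path_measure ?G C" by blast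
  define C where "C = (SOME C. atom_decomposition path_measure ?G C)"
  have C: "atom_decomposition path_measure ?G C" unfolding C_def by (rule someI_ex[OF ex])
  have sub: "C \<subseteq> range ?a"
  proof
    fix A assume "A \<in> C"
    then have A: "prob_atom path_measure ?G A" using C by (auto simp: atom_decomposition_def)
    then obtain E where E: "A = {\<omega>. \<omega> 0 \<in> E}" unfolding prob_atom_def sets_field_0 by blast
    have "E \<noteq> {}" using A E by (auto simp: prob_atom_def)
    then obtain x where x: "x \<in> E" by blast
    have "?a x \<in> sets ?G" "?a x \<subseteq> A" using atom x E by (auto simp: prob_atom_def)
    then have "measure path_measure (?a x) = 0 \<or> measure path_measure (?a x) = measure path_measure A"
      using A by (auto simp: prob_atom_def)
    then have m: "measure p E = pmf p x"
      using p_pos[of x] by (simp add: measure_one_time E measure_coord_in)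
    \<comment> \<open>A second state in \<open>E\<close> would add positive mass, but the atom has
      the same mass as the fibre of \<open>x\<close> inside it.\<close>
    have "E = {x}"
    proof (rule ccontr)
      assume "E \<noteq> {x}"
      then obtain y where y: "y \<in> E" "y \<noteq> x" using x by blast
      have "pmf p x + pmf p y = measure p {x, y}" using y by (simp add: measure_measure_pmf_finite)
      also have "\<dots> \<le> measure p E" using x y by (intro measure_pmf.finite_measure_mono) auto
      finally show False using m p_pos[of y] by simp
    qed
    then show "A \<in> range ?a" using E by auto
  qed
  have "(\<Sum>\<^sub>\<infinity>A\<in>C. ?g A) \<le> ennreal r"
  proof (rule infsum_le_finite_sums)
    fix F assume F: "finite F" "F \<subseteq> C"
    then obtain T where T: "F = ?a ` T" using sub by (meson subset_imageE order_trans)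
    have inj: "inj_on ?a T"
    proof (rule inj_onI)
      fix x y assume "?a x = ?a y"
      then have "(\<lambda>_. x) \<in> ?a x \<longleftrightarrow> (\<lambda>_. x) \<in> ?a y" by (simp only:)
      then show "x = y" by simp
    qed
    have fin: "finite T" using F T inj finite_imageD by blast
    have "sum ?g F = (\<Sum>x\<in>T. ennreal (- (pmf p x * ln (pmf p x))))"
      unfolding T sum.reindex[OF inj] by (simp add: measure_one_time)
    also have "\<dots> = ennreal (\<Sum>x\<in>T. - (pmf p x * ln (pmf p x)))"
      using p_pos by (intro sum_ennreal) (auto simp: mult_le_0_iff ln_le_zero_iff pmf_le_1 less_imp_le)
    also have "\<dots> \<le> ennreal r" by (rule ennreal_leI[OF assms[OF fin]])
    finally show "sum ?g F \<le> ennreal r" .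
  qed (rule nonneg_summable_on_complete, simp)
  then show ?thesis unfolding field_entropy_def purely_atomic_def using ex by (simp add: C_def)
qed

text \<open>The pair \<open>{0}\<close> and \<open>{- int n, int n}\<close> is admissible in the
  supremum, and no coefficient exceeds 1, so it suffices that this one coefficient reaches 1. The
  hypothesis supplies events of the two fields that agree up to a fraction \<open>e\<close> of their
  size.\<close>

lemma rho_star_eq_1:
  assumes "n \<ge> 1"
    and ex: "\<And>e. 0 < e \<Longrightarrow> e < 1 / 4 \<Longrightarrow> \<exists>x D. 0 < pmf p x \<and> pmf p x \<le> e
      \<and> measure path_measure {\<omega>. \<omega> 0 = x \<and> (\<omega> (- int n), \<omega> (int n)) \<in> D} \<ge> (1 - e) * pmf p x
      \<and> measure path_measure {\<omega>. \<omega> 0 \<noteq> x \<and> (\<omega> (- int n), \<omega> (int n)) \<in> D} \<le> e * pmf p x"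
  shows "rho_star path_measure (count_space UNIV) coord n = rho_coeff path_measure (generated_field path_measure (count_space UNIV) coord {0})
           (generated_field path_measure (count_space UNIV) coord {- int n, int n})"
    and "rho_coeff path_measure (generated_field path_measure (count_space UNIV) coord {0})
           (generated_field path_measure (count_space UNIV) coord {- int n, int n}) = 1"
proof -
  let ?F = "generated_field path_measure (count_space UNIV) coord {0}"
  let ?G = "generated_field path_measure (count_space UNIV) coord {- int n, int n}"
  let ?rho = "rho_coeff path_measure ?F ?G"
  have ge: "?rho \<ge> ereal (1 - 4 * e)" if e: "0 < e" "e < 1 / 4" for e
  proof -
    obtain x D where xD: "0 < pmf p x" "pmf p x \<le> e"
      "measure path_measure {\<omega>. \<omega> 0 = x \<and> (\<omega> (- int n), \<omega> (int n)) \<in> D} \<ge> (1 - e) * pmf p x"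
      "measure path_measure {\<omega>. \<omega> 0 \<noteq> x \<and> (\<omega> (- int n), \<omega> (int n)) \<in> D} \<le> e * pmf p x"
      using ex[OF e] by blast
    define A where "A = {\<omega> :: int \<Rightarrow> nat. \<omega> 0 = x}"
    define B where "B = {\<omega> :: int \<Rightarrow> nat. (\<omega> (- int n), \<omega> (int n)) \<in> D}"
    have A: "A \<in> sets ?F" unfolding sets_field_0 A_def by (intro exI[of _ "{x}"]) auto
    have B: "B \<in> sets ?G"
    proof -
      have c: "coord k \<in> measurable ?G (count_space UNIV)" if "k \<in> {- int n, int n}" for k
      proof (rule measurableI)
        fix E :: "nat set"
        have "coord k -` E \<inter> UNIV \<in> {coord k -` E \<inter> UNIV |k E. k \<in> {- int n, int n} \<and> E \<in> sets (count_space UNIV)}"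
          using that by (intro CollectI exI[of _ k] exI[of _ E]) simp
        then show "coord k -` E \<inter> space ?G \<in> sets ?G"
          by (simp only: space_generated) (simp add: generated_field_def sigma_sets.Basic)
      qed simp
      have "(\<lambda>\<omega>. (\<omega> (- int n), \<omega> (int n))) \<in> measurable ?G (count_space UNIV \<Otimes>\<^sub>M count_space UNIV)"
        using c by (intro measurable_Pair) auto
      then have "(\<lambda>\<omega>. (\<omega> (- int n), \<omega> (int n))) \<in> measurable ?G (count_space UNIV)"
        by (simp add: count_space_pair_nat)
      from measurable_sets[OF this, of D] show ?thesis by (simp add: B_def vimage_def)
    qed
    have ev: "A \<in> PM.events" "B \<in> PM.events"
      using A B subalgebra_generated by (auto simp: subalgebra_def)
    have "corr path_measure (indicator A) (indicator B) \<ge> 1 - 4 * e"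
    proof (rule PM.corr_indicator_ge[OF ev e])
      have "A \<inter> B = {\<omega>. \<omega> 0 = x \<and> (\<omega> (- int n), \<omega> (int n)) \<in> D}" "B - A = {\<omega>. \<omega> 0 \<noteq> x \<and> (\<omega> (- int n), \<omega> (int n)) \<in> D}"
        by (auto simp: A_def B_def)
      moreover have "PM.prob A = pmf p x" by (simp add: A_def measure_one_time)
      ultimately show "0 < PM.prob A" "PM.prob A \<le> e" "PM.prob (A \<inter> B) \<ge> (1 - e) * PM.prob A" "PM.prob (B - A) \<le> e * PM.prob A"
        using xD by simp_all
    qed
    then have "ereal (1 - 4 * e) \<le> ereal \<bar>corr path_measure (indicator A) (indicator B)\<bar>" by simp
    also have "\<dots> \<le> ?rho"
      unfolding rho_coeff_def
    proof (rule SUP_upper2[where i="(indicator A, indicator B)"])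
      have "integrable path_measure (\<lambda>\<omega>. (indicator E \<omega> :: real)\<^sup>2)" if "E \<in> PM.events" for E
        using that by (simp add: power2_eq_square indicator_inter_arith[symmetric] PM.emeasure_eq_measure)
      then show "(indicator A, indicator B) \<in> square_integrable path_measure ?F \<times> square_integrable path_measure ?G"
        using A B ev by (auto simp: square_integrable_def)
    qed simp
    finally show ?thesis .
  qed
  have le: "?rho \<le> 1" by (rule PM.rho_coeff_le_1) (rule subalgebra_generated)+
  have "1 \<le> ?rho"
  proof (rule ccontr)
    assume "\<not> 1 \<le> ?rho"
    then have l1: "?rho < 1" by simp
    have "?rho \<ge> ereal 0" using order_trans[OF _ ge[of "1/8"], of "ereal 0"] by simp
    then obtain s where s: "?rho = ereal s" "0 \<le> s" "s < 1" using l1 by (cases ?rho) auto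
    \<comment> \<open>With this \<open>e\<close> the lower bound is the midpoint of \<open>s\<close>
      and 1.\<close>
    have "ereal (1 - 4 * ((1 - s) / 8)) \<le> ereal s" using ge[of "(1 - s) / 8"] s by simp
    then have "1 - 4 * ((1 - s) / 8) \<le> s" by (simp only: ereal_less_eq)
    then show False using s(3) by (simp add: field_simps)
  qed
  with le show one: "?rho = 1" by simp
  have dist: "index_dist {0} {- int n, int n} = n"
  proof -
    have "{nat \<bar>s - t\<bar> | s t. s \<in> {0::int} \<and> t \<in> {- int n, int n}} = {n}" by (auto intro: exI[of _ "int n"])
    then show ?thesis by (simp add: index_dist_def)
  qed
  have "rho_star path_measure (count_space UNIV) coord n \<le> 1"
    unfolding rho_star_def by (rule SUP_least, clarify) (intro PM.rho_coeff_le_1 subalgebra_generated)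
  moreover have "?rho \<le> rho_star path_measure (count_space UNIV) coord n"
    unfolding rho_star_def using dist \<open>n \<ge> 1\<close>
    by (intro SUP_upper2[where i="({0}, {- int n, int n})"]) auto
  ultimately show "rho_star path_measure (count_space UNIV) coord n = ?rho" using one by simp
qed


text \<open>Conditional independence of past and future given the present: both events fix the state
  at time 0, so on \<open>A \<times> B\<close> the density for \<open>n = 0\<close> is the constant
  \<open>1 / pmf p y\<close>.\<close>

lemma markov_at_0:
  assumes A: "A \<in> sets past" "A \<subseteq> {\<omega>. \<omega> 0 = y}" and B: "B \<in> sets (future 0)" "B \<subseteq> {\<omega>. \<omega> 0 = y}"
  shows "measure path_measure (A \<inter> B) = measure path_measure A * measure path_measure B / pmf p y"
proof -
  have sub: "subalgebra path_measure past" "subalgebra path_measure (future 0)"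
    by (simp_all add: past_def future_def subalgebra_generated)
  have [measurable]: "A \<in> PM.events" "B \<in> PM.events" using A(1) B(1) sub unfolding subalgebra_def by blast+
  note diag = past_future_measurable(1)[of 0] and id2 = past_future_measurable(2)[of "step_density 0" 0]
  have AB: "A \<times> B \<in> sets (past \<Otimes>\<^sub>M future 0)" using A(1) B(1) by auto
  interpret PP: pair_prob_space path_measure path_measure ..
  have "emeasure path_measure (A \<inter> B) = emeasure (distr path_measure (past \<Otimes>\<^sub>M future 0) (\<lambda>\<omega>. (\<omega>, \<omega>))) (A \<times> B)"
    unfolding emeasure_distr[OF diag AB] by (rule arg_cong[where f="emeasure path_measure"]) auto
  also have "\<dots> = (\<integral>\<^sup>+z. ennreal (step_density 0 z) * indicator (A \<times> B) z \<partial>(path_measure \<Otimes>\<^sub>M path_measure))"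
    unfolding joint_past_future by (subst emeasure_distr[OF id2 AB]) (auto simp: emeasure_density space_pair_measure)
  also have "\<dots> = (\<integral>\<^sup>+z. ennreal (1 / pmf p y) * indicator (A \<times> B) z \<partial>(path_measure \<Otimes>\<^sub>M path_measure))"
  proof (rule nn_integral_cong)
    fix z
    show "ennreal (step_density 0 z) * indicator (A \<times> B) z = ennreal (1 / pmf p y) * indicator (A \<times> B) z"
    proof (cases "z \<in> A \<times> B")
      case True
      then have "fst z \<in> A" "snd z \<in> B" by auto
      then have "fst z 0 = y" "snd z 0 = y" using A(2) B(2) by blast+
      then show ?thesis by (simp add: step_density_def)
    qed simp
  qed
  also have "\<dots> = ennreal (1 / pmf p y) * (emeasure path_measure A * emeasure path_measure B)"
    by (subst nn_integral_cmult_indicator) (auto simp: PM.emeasure_pair_measure_Times)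
  also have "\<dots> = ennreal (measure path_measure A * measure path_measure B / pmf p y)"
    by (simp add: PM.emeasure_eq_measure ennreal_mult[symmetric])
  finally show ?thesis by (simp add: PM.emeasure_eq_measure)
qed

lemma coord_event: "k \<in> J \<Longrightarrow> {\<omega>. \<omega> k \<in> E} \<in> sets (generated_field path_measure (count_space UNIV) coord J)"
proof -
  assume "k \<in> J"
  then have "coord k -` E \<inter> UNIV \<in> {coord k -` E \<inter> UNIV |k E. k \<in> J \<and> E \<in> sets (count_space UNIV)}"
    by (intro CollectI exI[of _ k] exI[of _ E]) simp
  then show ?thesis by (simp add: generated_field_def vimage_def sigma_sets.Basic)
qed

lemma conj_subset: "{\<omega>. P \<omega> \<and> Q \<omega>} \<subseteq> {\<omega>. Q \<omega>}" "{\<omega>. P \<omega> \<and> Q \<omega>} \<subseteq> {\<omega>. P \<omega>}"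
  by blast+

lemma three_times_at_0:
  "measure path_measure {\<omega>. \<omega> (- int s) \<in> V \<and> \<omega> 0 = y \<and> \<omega> (int t) \<in> V'}
    = measure path_measure {\<omega>. \<omega> (- int s) \<in> V \<and> \<omega> 0 = y} * measure path_measure {\<omega>. \<omega> 0 = y \<and> \<omega> (int t) \<in> V'} / pmf p y"
proof -
  let ?A = "{\<omega> :: int \<Rightarrow> nat. \<omega> (- int s) \<in> V \<and> \<omega> 0 = y}" and ?B = "{\<omega> :: int \<Rightarrow> nat. \<omega> 0 = y \<and> \<omega> (int t) \<in> V'}"
  have eA: "?A = {\<omega>. \<omega> (- int s) \<in> V} \<inter> {\<omega>. \<omega> 0 \<in> {y}}" and eB: "?B = {\<omega>. \<omega> 0 \<in> {y}} \<inter> {\<omega>. \<omega> (int t) \<in> V'}"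
    by auto
  have "?A \<in> sets past"
    unfolding eA past_def by (rule sets.Int; rule coord_event) auto
  moreover have "?B \<in> sets (future 0)"
    unfolding eB future_def by (rule sets.Int; rule coord_event) auto
  ultimately have "measure path_measure (?A \<inter> ?B) = measure path_measure ?A * measure path_measure ?B / pmf p y"
    by (rule markov_at_0[OF _ conj_subset(1) _ conj_subset(2)])
  moreover have "?A \<inter> ?B = {\<omega>. \<omega> (- int s) \<in> V \<and> \<omega> 0 = y \<and> \<omega> (int t) \<in> V'}" by auto
  ultimately show ?thesis by simp
qed

lemma coord_triple_event: "{\<omega>. P (\<omega> k) (\<omega> l) (\<omega> m)} \<in> PM.events" for P :: "nat \<Rightarrow> nat \<Rightarrow> nat \<Rightarrow> bool"
proof -
  have ev: "{\<omega>. \<omega> i = x} \<in> PM.events" for i x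
    using measurable_sets[OF coord_measurable[of i], of "{x}"] by (simp add: vimage_def)
  have "{\<omega>. P (\<omega> k) (\<omega> l) (\<omega> m)}
    = (\<Union>d\<in>{(x, y, z). P x y z}. {\<omega>. \<omega> k = fst d} \<inter> {\<omega>. \<omega> l = fst (snd d)} \<inter> {\<omega>. \<omega> m = snd (snd d)})"
    (is "?L = ?R")
  proof (rule set_eqI)
    fix \<omega> show "\<omega> \<in> ?L \<longleftrightarrow> \<omega> \<in> ?R" by (auto intro!: exI[of _ "\<omega> k"] exI[of _ "\<omega> l"] exI[of _ "\<omega> m"])
  qed
  also have "\<dots> \<in> PM.events" using ev by (intro sets.countable_UN' sets.Int) auto
  finally show ?thesis .
qed

text \<open>Given the state at time 0 the two sides are independent, and reversibility gives the
  left side the same kernel as the right.\<close>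

lemma measure_at_0_pair: 
  "measure path_measure {\<omega>. \<omega> (- int n) = x \<and> \<omega> 0 = a \<and> \<omega> (int n) = y} = pmf p a * pmf (kstep n a) x * pmf (kstep n a) y"
proof -
  have 1: "measure path_measure {\<omega>. \<omega> 0 = a \<and> \<omega> (int n) = y} = pmf p a * pmf (kstep n a) y" for y
    using measure_two_times[of 0 a n y] by simp
  have "measure path_measure {\<omega>. \<omega> (- int n) = x \<and> \<omega> 0 = a} = measure (distr path_measure path_space (\<lambda>\<omega> k. \<omega> (- k))) {\<omega>. \<omega> (- int n) = x \<and> \<omega> 0 = a}"
    by (simp only: distr_reverse)
  also have "\<dots> = measure path_measure {\<omega>. \<omega> 0 = a \<and> \<omega> (int n) = x}"
  proof (subst measure_distr)
    show "(\<lambda>\<omega> k. \<omega> (- k)) \<in> measurable path_measure path_space"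
      using shift_measurable[of uminus] by (simp add: measurable_cong_sets[OF sets_path_measure refl])
    show "{\<omega>. \<omega> (- int n) = x \<and> \<omega> 0 = a} \<in> sets path_space"
      using coord_triple_event[of "\<lambda>u v w. u = x \<and> v = a" "- int n" 0 0] by (simp add: sets_path_measure)
  qed (auto intro!: arg_cong[where f="measure path_measure"])
  finally show ?thesis
    using three_times_at_0[of n "{x}" a n "{y}"] 1 p_pos[of a] by simp
qed

text \<open>Shift time \<open>t\<close> to 0 and condition on the visit to \<open>z\<close>. By
  stationarity each side contributes at most the mass of \<open>V\<close>, and the square of this
  mass is what makes such visits negligible for small weights.\<close>

lemma visit_bound:
  assumes t: "t \<in> {- int n<..<int n}"
  shows "measure path_measure {\<omega>. \<omega> (- int n) \<in> V \<and> \<omega> t = z \<and> \<omega> (int n) \<in> V} \<le> (measure p V)\<^sup>2 / pmf p z"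
proof -
  have meas: "(\<lambda>\<omega> k. \<omega> (k + t)) \<in> measurable path_measure path_space"
    using shift_measurable[of "\<lambda>k. k + t"] by (simp add: measurable_cong_sets[OF sets_path_measure refl])
  define s where "s = nat (int n + t)"
  define u where "u = nat (int n - t)"
  have su: "int s = int n + t" "int u = int n - t" using t by (auto simp: s_def u_def)
  let ?S = "{\<omega>. \<omega> (- int s) \<in> V \<and> \<omega> 0 = z \<and> \<omega> (int u) \<in> V}"
  have "measure path_measure {\<omega>. \<omega> (- int n) \<in> V \<and> \<omega> t = z \<and> \<omega> (int n) \<in> V} = measure (distr path_measure path_space (\<lambda>\<omega> k. \<omega> (k + t))) ?S"
  proof (subst measure_distr[OF meas])
    show "?S \<in> sets path_space"
      using coord_triple_event[of "\<lambda>u v w. u \<in> V \<and> v = z \<and> w \<in> V" "- int s" 0 "int u"] by (simp add: sets_path_measure)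
    have "- int s + t = - int n" "int u + t = int n" using su by auto
    then show "measure path_measure {\<omega>. \<omega> (- int n) \<in> V \<and> \<omega> t = z \<and> \<omega> (int n) \<in> V} = PM.prob ((\<lambda>\<omega> k. \<omega> (k + t)) -` ?S \<inter> space path_measure)"
      by simp
  qed
  also have "\<dots> = measure path_measure ?S" by (simp only: distr_shift)
  also have "\<dots> \<le> measure p V * measure p V / pmf p z"
    unfolding three_times_at_0
  proof (intro divide_right_mono mult_mono)
    have ev: "{\<omega>. \<omega> k \<in> V} \<in> PM.events" for k using coord_triple_event[of "\<lambda>u v w. u \<in> V" k k k] by simp
    show "PM.prob {\<omega>. \<omega> (- int s) \<in> V \<and> \<omega> 0 = z} \<le> measure p V"
      using PM.finite_measure_mono[OF conj_subset(2) ev[of "- int s"]] by (simp add: measure_coord_in)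
    show "PM.prob {\<omega>. \<omega> 0 = z \<and> \<omega> (int u) \<in> V} \<le> measure p V"
      using PM.finite_measure_mono[OF conj_subset(1) ev[of "int u"]] by (simp add: measure_coord_in)
  qed auto
  finally show ?thesis by (simp add: power2_eq_square)
qed

text \<open>One null set for all times at once, so that what happens between two times can be argued
  path by path.\<close>

lemma AE_edges: "AE \<omega> in path_measure. \<forall>t. (\<omega> t, \<omega> (t + 1)) \<in> edges"
proof (subst AE_all_countable, rule allI)
  fix t
  have "AE \<omega> in path_measure. \<forall>x y. (x, y) \<notin> edges \<longrightarrow> \<not> (\<omega> t = x \<and> \<omega> (t + 1) = y)"
  proof (subst AE_all_countable, rule allI, subst AE_all_countable, rule allI)
    fix x y
    show "AE \<omega> in path_measure. (x, y) \<notin> edges \<longrightarrow> \<not> (\<omega> t = x \<and> \<omega> (t + 1) = y)"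
    proof (cases "(x, y) \<in> edges")
      case False
      have "measure path_measure {\<omega>. \<omega> t = x \<and> \<omega> (t + 1) = y} = 0"
        using measure_two_times[of t x 1 y] False kstep_1[of x] by (simp add: edges_def not_less order_antisym del: kstep.simps)
      then have "{\<omega>. \<omega> t = x \<and> \<omega> (t + 1) = y} \<in> null_sets path_measure"
        using coord_triple_event[of "\<lambda>u v w. u = x \<and> v = y" t "t + 1" t]
        by (intro null_setsI) (auto simp: PM.emeasure_eq_measure)
      then show ?thesis by (rule AE_I') auto
    qed simp
  qed
  then show "AE \<omega> in path_measure. (\<omega> t, \<omega> (t + 1)) \<in> edges" by (rule AE_mp) auto
qed

text \<open>The premise \<open>forced\<close> is purely combinatorial. It places the bad event, up
  to a null set, in the union of the visits to \<open>z\<close> at fewer than \<open>2 * n\<close>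
  intermediate times when \<open>n\<close> is positive; for \<open>n = 0\<close> there are
  none.\<close>

lemma excursion_bound:
  assumes D: "D \<subseteq> V \<times> V"
    and forced: "\<And>\<omega>. \<lbrakk>\<And>t. (\<omega> t, \<omega> (t + 1)) \<in> edges; (\<omega> (- int n), \<omega> (int n)) \<in> D;
       \<And>t. t \<in> {- int n<..<int n} \<Longrightarrow> \<omega> t \<noteq> z\<rbrakk> \<Longrightarrow> \<omega> 0 = a"
  shows "measure path_measure {\<omega>. \<omega> 0 \<noteq> a \<and> (\<omega> (- int n), \<omega> (int n)) \<in> D} \<le> real (2 * n) * ((measure p V)\<^sup>2 / pmf p z)"
proof -
  let ?T = "{- int n<..<int n}"
  let ?E = "\<lambda>t. {\<omega>. \<omega> (- int n) \<in> V \<and> \<omega> t = z \<and> \<omega> (int n) \<in> V}"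
  have E: "?E t \<in> PM.events" for t
    using coord_triple_event[of "\<lambda>u v w. u \<in> V \<and> v = z \<and> w \<in> V" "- int n" t "int n"] by simp
  have "measure path_measure {\<omega>. \<omega> 0 \<noteq> a \<and> (\<omega> (- int n), \<omega> (int n)) \<in> D} \<le> measure path_measure (\<Union>t\<in>?T. ?E t)"
  proof (rule PM.finite_measure_mono_AE)
    show "AE \<omega> in path_measure. \<omega> \<in> {\<omega>. \<omega> 0 \<noteq> a \<and> (\<omega> (- int n), \<omega> (int n)) \<in> D} \<longrightarrow> \<omega> \<in> (\<Union>t\<in>?T. ?E t)"
      using AE_edges
    proof (rule AE_mp, intro AE_I2 impI)
      fix \<omega> assume e: "\<forall>t. (\<omega> t, \<omega> (t + 1)) \<in> edges" and w: "\<omega> \<in> {\<omega>. \<omega> 0 \<noteq> a \<and> (\<omega> (- int n), \<omega> (int n)) \<in> D}"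
      then obtain t where "t \<in> ?T" "\<omega> t = z" using forced[of \<omega>] by blast
      then show "\<omega> \<in> (\<Union>t\<in>?T. ?E t)" using w D by auto
    qed
  qed (use E in auto)
  also have "\<dots> \<le> (\<Sum>t\<in>?T. measure path_measure (?E t))"
    using E by (intro PM.finite_measure_subadditive_finite) auto
  also have "\<dots> \<le> (\<Sum>t\<in>?T. (measure p V)\<^sup>2 / pmf p z)" by (intro sum_mono visit_bound)
  also have "\<dots> = real (card ?T) * ((measure p V)\<^sup>2 / pmf p z)" by simp
  also have "\<dots> \<le> real (2 * n) * ((measure p V)\<^sup>2 / pmf p z)"
    by (intro mult_right_mono) (auto)
  finally show ?thesis .
qed

lemma centre_mass:
  assumes "finite D"
  shows "measure path_measure {\<omega>. \<omega> 0 = a \<and> (\<omega> (- int n), \<omega> (int n)) \<in> D}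
    = pmf p a * (\<Sum>(x, y)\<in>D. pmf (kstep n a) x * pmf (kstep n a) y)"
proof -
  let ?E = "\<lambda>d. {\<omega>. \<omega> (- int n) = fst d \<and> \<omega> 0 = a \<and> \<omega> (int n) = snd d}"
  have "{\<omega>. \<omega> 0 = a \<and> (\<omega> (- int n), \<omega> (int n)) \<in> D} = (\<Union>d\<in>D. ?E d)" by force
  then have "measure path_measure {\<omega>. \<omega> 0 = a \<and> (\<omega> (- int n), \<omega> (int n)) \<in> D} = (\<Sum>d\<in>D. measure path_measure (?E d))"
    using assms coord_triple_event[of "\<lambda>u v w. u = _ \<and> v = a \<and> w = _" "- int n" 0 "int n"]
    by (simp only:) (intro PM.finite_measure_finite_Union; force simp: disjoint_family_on_def)
  then show ?thesis by (simp add: measure_at_0_pair sum_distrib_left case_prod_beta mult.assoc)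
qed

lemma kstep_Suc_ge: "pmf (K x) y * pmf (kstep n y) z \<le> pmf (kstep (Suc n) x) z"
proof -
  have "ennreal (pmf (K x) y * pmf (kstep n y) z) \<le> (\<integral>\<^sup>+y. ennreal (pmf (K x) y) * ennreal (pmf (kstep n y) z) \<partial>count_space UNIV)"
    using nn_integral_ge_point[of y UNIV "\<lambda>y. ennreal (pmf (K x) y) * ennreal (pmf (kstep n y) z)"] by (simp add: ennreal_mult)
  also have "\<dots> = ennreal (pmf (kstep (Suc n) x) z)"
    by (simp add: ennreal_pmf_bind nn_integral_measure_pmf)
  finally show ?thesis by (simp add: ennreal_le_iff)
qed

end

section \<open>Chains given by symmetric edge weights\<close>

lemma nn_integral_nat_has_sum:
  fixes f :: "nat \<Rightarrow> real"
  assumes "(f has_sum s) UNIV" "\<And>x. 0 \<le> f x"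
  shows "(\<integral>\<^sup>+x. ennreal (f x) \<partial>count_space UNIV) = ennreal s"
  using assms by (simp add: nn_integral_count_space_nat suminf_ennreal_eq has_sum_imp_sums)

lemma nn_integral_nat_le:
  fixes f :: "nat \<Rightarrow> real"
  assumes "\<And>F. finite F \<Longrightarrow> sum f F \<le> c" "\<And>x. 0 \<le> f x"
  shows "(\<integral>\<^sup>+x. ennreal (f x) \<partial>count_space UNIV) \<le> ennreal c"
  unfolding nn_integral_count_space_nat
proof (rule suminf_le_const)
  show "(\<Sum>i<n. ennreal (f i)) \<le> ennreal c" for n
    using assms by (simp add: sum_ennreal ennreal_leI)
qed simp

text \<open>The random walk on a weighted graph: \<open>w x y\<close> is the stationary probability
  of the move from \<open>x\<close> to \<open>y\<close>, so symmetry of \<open>w\<close> is detailed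
  balance.\<close>

locale edge_weights =
  fixes w :: "nat \<Rightarrow> nat \<Rightarrow> real" and q :: "nat \<Rightarrow> real"
  assumes sym: "w x y = w y x" and nonneg: "0 \<le> w x y" and row: "(w x has_sum q x) UNIV"
    and q_pos: "0 < q x" and total: "(q has_sum 1) UNIV"
begin

definition p :: "nat pmf" where "p = embed_pmf q"

definition K :: "nat \<Rightarrow> nat pmf" where "K x = embed_pmf (\<lambda>y. w x y / q x)"

lemma pmf_p: "pmf p x = q x"
  unfolding p_def by (rule pmf_embed_pmf) (simp_all add: q_pos less_imp_le nn_integral_nat_has_sum[OF total])

lemma pmf_K: "pmf (K x) y = w x y / q x"
proof -
  have "((\<lambda>y. w x y * inverse (q x)) has_sum q x * inverse (q x)) UNIV"
    by (rule has_sum_cmult_left[OF row])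
  then have "((\<lambda>y. w x y / q x) has_sum 1) UNIV"
    using q_pos[of x] by (simp add: divide_inverse)
  then show ?thesis
    unfolding K_def using q_pos[of x] nonneg
    by (intro pmf_embed_pmf) (simp_all add: nn_integral_nat_has_sum less_imp_le)
qed

sublocale reversible_kernel p K
proof
  show "pmf p x * pmf (K x) y = pmf p y * pmf (K y) x" for x y
    using q_pos[of x] q_pos[of y] sym[of x y] by (simp add: pmf_p pmf_K)
qed (simp add: pmf_p q_pos)

lemma edges_iff: "(x, y) \<in> edges \<longleftrightarrow> w x y > 0"
  using q_pos[of x] by (simp add: edges_def pmf_K zero_less_divide_iff)

text \<open>Since the density \<open>h\<close> has mean 1, its variance is the second moment minus
  1, and the second moment is the sum of \<open>(w x y)\<^sup>2 / (q x * q y)\<close>. The 1 in the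
  bound on the row sums is the one that centring removes.\<close>

lemma step_chi2_from_rows:
  assumes rows: "\<And>x F. finite F \<Longrightarrow> (\<Sum>y\<in>F. (w x y)\<^sup>2 / (q x * q y)) \<le> g x"
    and g: "\<And>F. finite F \<Longrightarrow> (\<Sum>x\<in>F. g x) \<le> 1 + c" and c: "0 \<le> c"
  shows "step_chi2 1 \<le> ennreal c"
proof -
  define h where "h x y = pmf (K x) y / pmf p y" for x y
  have h0: "0 \<le> h x y" for x y by (simp add: h_def)
  have g0: "0 \<le> g x" for x using rows[of "{}" x] by simp
  have h2: "(\<integral>\<^sup>+y. ennreal ((h x y)\<^sup>2) \<partial>measure_pmf p) \<le> ennreal (g x / q x)" for x
  proof -
    have "(\<integral>\<^sup>+y. ennreal ((h x y)\<^sup>2) \<partial>measure_pmf p) = (\<integral>\<^sup>+y. ennreal ((w x y)\<^sup>2 / (q x * q y) / q x) \<partial>count_space UNIV)"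
      unfolding nn_integral_measure_pmf
    proof (rule nn_integral_cong)
      fix y
      have "q y * (h x y)\<^sup>2 = (w x y)\<^sup>2 / (q x * q y) / q x"
        using q_pos[of x] q_pos[of y] by (simp add: h_def pmf_p pmf_K power2_eq_square field_simps)
      then show "ennreal (pmf p y) * ennreal ((h x y)\<^sup>2) = ennreal ((w x y)\<^sup>2 / (q x * q y) / q x)"
        using q_pos[of y] by (simp add: pmf_p ennreal_mult[symmetric])
    qed
    also have "\<dots> \<le> ennreal (g x / q x)"
    proof (rule nn_integral_nat_le)
      show "(\<Sum>y\<in>F. (w x y)\<^sup>2 / (q x * q y) / q x) \<le> g x / q x" if "finite F" for F
        unfolding sum_divide_distrib[symmetric] using rows[OF that, of x] q_pos[of x] by (intro divide_right_mono) auto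
      show "0 \<le> (w x y)\<^sup>2 / (q x * q y) / q x" for y
        using q_pos[of x] q_pos[of y] by simp
    qed
    finally show ?thesis .
  qed
  have "(\<integral>\<^sup>+x. \<integral>\<^sup>+y. ennreal ((h x y)\<^sup>2) \<partial>measure_pmf p \<partial>measure_pmf p) \<le> (\<integral>\<^sup>+x. ennreal (g x / q x) \<partial>measure_pmf p)"
    by (intro nn_integral_mono h2)
  also have "\<dots> = (\<integral>\<^sup>+x. ennreal (g x) \<partial>count_space UNIV)"
    unfolding nn_integral_measure_pmf
  proof (rule nn_integral_cong)
    fix x show "ennreal (pmf p x) * ennreal (g x / q x) = ennreal (g x)"
      using q_pos[of x] g0[of x] by (simp add: pmf_p ennreal_mult[symmetric])
  qed
  also have "\<dots> \<le> ennreal (1 + c)" by (rule nn_integral_nat_le[OF g g0])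
  finally have H2: "(\<integral>\<^sup>+x. \<integral>\<^sup>+y. ennreal ((h x y)\<^sup>2) \<partial>measure_pmf p \<partial>measure_pmf p) \<le> ennreal (1 + c)" .
  have h1: "(\<integral>\<^sup>+y. ennreal (h x y) \<partial>measure_pmf p) = 1" for x
  proof -
    have "(\<integral>\<^sup>+y. ennreal (h x y) \<partial>measure_pmf p) = emeasure (density (measure_pmf p) (\<lambda>y. ennreal (h x y))) UNIV"
      by (subst emeasure_density) auto
    also have "\<dots> = emeasure (measure_pmf (K x)) UNIV" unfolding h_def pmf_density[symmetric] ..
    finally show ?thesis using measure_pmf.emeasure_space_1[of "K x"] by simp
  qed
  \<comment> \<open>The expansion is written without differences because subtraction on
    \<open>ennreal\<close> truncates; the common summand 2 is cancelled at the end.\<close>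
  have eq: "ennreal ((h x y - 1)\<^sup>2) + 2 * ennreal (h x y) = ennreal ((h x y)\<^sup>2) + 1" for x y
  proof -
    have "(h x y - 1)\<^sup>2 + 2 * h x y = (h x y)\<^sup>2 + 1" by (simp add: power2_eq_square algebra_simps)
    then have "ennreal ((h x y - 1)\<^sup>2 + 2 * h x y) = ennreal ((h x y)\<^sup>2 + 1)" by simp
    then show ?thesis using h0[of x y] by (simp add: ennreal_plus ennreal_mult)
  qed
  have "step_chi2 1 + 2 = (\<integral>\<^sup>+x. \<integral>\<^sup>+y. (ennreal ((h x y - 1)\<^sup>2) + 2 * ennreal (h x y)) \<partial>measure_pmf p \<partial>measure_pmf p)"
    by (simp add: step_chi2_def h_def[symmetric] kstep_1 nn_integral_add nn_integral_cmult h1 del: kstep.simps)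
  also have "\<dots> = (\<integral>\<^sup>+x. \<integral>\<^sup>+y. ennreal ((h x y)\<^sup>2) \<partial>measure_pmf p \<partial>measure_pmf p) + 1"
    unfolding eq by (simp add: nn_integral_add)
  also have "\<dots> \<le> ennreal (1 + c) + 1" using H2 by (rule add_right_mono)
  also have "\<dots> = ennreal c + (1 + 1)" using c by (simp add: add.commute add.left_commute del: one_add_one)
  also have "\<dots> = ennreal c + 2" by (simp only: one_add_one)
  finally have "2 + step_chi2 1 \<le> 2 + ennreal c" by (simp add: add.commute)
  then show ?thesis by (simp only: ennreal_add_left_cancel_le) simp
qed

end

section \<open>The spider chain\<close>

text \<open>The state \<open>(j, i, k)\<close> is the vertex at level \<open>k\<close> on leg \<open>i\<close> of the \<open>j\<close>-th spider, for \<open>i < j\<close> and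
  \<open>1 \<le> k \<le> j\<close>. All legs of the spider meet in its centre \<open>(j, 0, 0)\<close>, and their ends at level \<open>j\<close> are
  joined to the common base.\<close>

type_synonym spider_state = "nat \<times> nat \<times> nat"

definition block :: "nat \<Rightarrow> spider_state set" where
  "block j = insert (j, 0, 0) ((\<lambda>(i, k). (j, i, k)) ` ({..<j} \<times> {1..j}))"

text \<open>This triple would be the centre of a spider with index 0, so the spiders are numbered
  from 1.\<close>

definition base :: spider_state where "base = (0, 0, 0)"

definition blocks :: "spider_state set" where "blocks = (\<Union>j\<in>{1..}. block j)"

fun up :: "spider_state \<Rightarrow> spider_state \<Rightarrow> bool" where
  "up (j, i, k) (j', i', k') \<longleftrightarrow> j = j' \<and> k' = Suc k \<and> (k = 0 \<or> i = i')"

lemma in_block: "(j', i, k) \<in> block j \<longleftrightarrow> j' = j \<and> (i = 0 \<and> k = 0 \<or> i < j \<and> 1 \<le> k \<and> k \<le> j)"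
  by (auto simp: block_def image_iff)

lemma in_blocks: "(j, i, k) \<in> blocks \<longleftrightarrow> j \<ge> 1 \<and> (i = 0 \<and> k = 0 \<or> i < j \<and> 1 \<le> k \<and> k \<le> j)"
  by (auto simp: blocks_def in_block)

lemma base_notin: "base \<notin> blocks" by (simp add: base_def in_blocks)

lemma finite_block: "finite (block j)" by (simp add: block_def)

lemma card_block: "card (block j) \<le> j\<^sup>2 + 1"
proof -
  have "card (block j) \<le> Suc (card ((\<lambda>(i, k). (j, i, k)) ` ({..<j} \<times> {1..j})))"
    unfolding block_def by (rule card_insert_le_m1) auto
  also have "card ((\<lambda>(i, k). (j, i, k)) ` ({..<j} \<times> {1..j})) \<le> card ({..<j} \<times> {1..j})"
    by (rule card_image_le) auto
  finally show ?thesis by (simp add: power2_eq_square)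
qed

lemma in_block_fst: "x \<in> block j \<Longrightarrow> fst x = j"
  by (cases x) (simp add: in_block)

lemma sum_half_powers_le: "finite J \<Longrightarrow> J \<subseteq> {1..} \<Longrightarrow> (\<Sum>j\<in>J. (1 / 2) ^ j) \<le> (1 :: real)"
proof -
  assume J: "finite J" "J \<subseteq> {1..}"
  obtain N where "J \<subseteq> {..N}" using J(1) finite_nat_iff_bounded_le by blast
  then have JN: "J \<subseteq> {1..N}" using J(2) by auto
  have "(\<Sum>j\<in>J. (1 / 2) ^ j) \<le> (\<Sum>j=1..N. (1 / 2 :: real) ^ j)"
    by (rule sum_mono2[OF _ JN]) auto
  also have "\<dots> = 1 - (1 / 2) ^ N"
  proof (induction N)
    case (Suc N) then show ?case by (simp add: field_simps)
  qed simp
  also have "\<dots> \<le> 1" by simp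
  finally show ?thesis .
qed

text \<open>Spider \<open>j\<close> may use the share \<open>1 / 2 ^ j\<close> of a budget
  \<open>c\<close>. The finite set is enlarged to whole spiders, which costs nothing for nonnegative
  terms.\<close>

lemma sum_blocks_le:
  fixes f :: "spider_state \<Rightarrow> real"
  assumes F: "finite F" "F \<subseteq> blocks" and f0: "\<And>x. x \<in> blocks \<Longrightarrow> 0 \<le> f x" and c: "0 \<le> c"
    and le: "\<And>j. 1 \<le> j \<Longrightarrow> sum f (block j) \<le> c * (1 / 2) ^ j"
  shows "sum f F \<le> c"
proof -
  let ?J = "fst ` F"
  have J: "finite ?J" "?J \<subseteq> {1..}" using F by (auto simp: in_blocks)
  have FJ: "F \<subseteq> (\<Union>j\<in>?J. block j)"
  proof
    fix x assume "x \<in> F"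
    then obtain j where "x \<in> block j" using F by (auto simp: blocks_def)
    then show "x \<in> (\<Union>j\<in>?J. block j)" using \<open>x \<in> F\<close> in_block_fst[of x j] by blast
  qed
  have "sum f F \<le> sum f (\<Union>j\<in>?J. block j)"
  proof (rule sum_mono2[OF _ FJ])
    have "(\<Union>j\<in>?J. block j) \<subseteq> blocks" using J(2) unfolding blocks_def by (intro UN_mono) auto
    then show "0 \<le> f x" if "x \<in> (\<Union>j\<in>?J. block j) - F" for x using that by (intro f0) blast
  qed (rule finite_UN_I[OF J(1) finite_block])
  also have "\<dots> = (\<Sum>j\<in>?J. sum f (block j))"
    using J by (intro sum.UNION_disjoint) (auto simp: finite_block in_block)
  also have "\<dots> \<le> (\<Sum>j\<in>?J. c * (1 / 2) ^ j)" using J(2) le by (intro sum_mono) auto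
  also have "\<dots> = c * (\<Sum>j\<in>?J. (1 / 2) ^ j)" by (simp add: sum_distrib_left)
  also have "\<dots> \<le> c * 1" using c J by (intro mult_left_mono sum_half_powers_le) auto
  finally show ?thesis by simp
qed

text \<open>\<open>ln s \<le> s - 1\<close> at \<open>s = 1 / sqrt t\<close> trades the logarithm
  for a square root, which suits a scale \<open>eps\<close> that is defined as a square.\<close>

lemma entropy_term_le: "- (t * ln t) \<le> 2 * sqrt t" if "0 < t" for t :: real
proof -
  have "- ln (sqrt t) = ln (1 / sqrt t)" using that by (simp add: ln_div)
  also have "\<dots> \<le> 1 / sqrt t - 1" using that by (intro ln_le_minus_one) simp
  also have "\<dots> \<le> 1 / sqrt t" by simp
  finally have "- ln t \<le> 2 * (1 / sqrt t)" using that by (simp add: ln_sqrt)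
  then have "t * (- ln t) \<le> t * (2 * (1 / sqrt t))" using that by (intro mult_left_mono) auto
  also have "\<dots> = 2 * (t / sqrt t)" by simp
  also have "\<dots> = 2 * sqrt t" using that by (simp only: real_div_sqrt less_imp_le)
  finally show ?thesis by simp
qed

locale spider =
  fixes r :: real assumes r: "0 < r" "r < 1"
begin

text \<open>The edge above level \<open>k\<close> of a leg of the \<open>j\<close>-th spider has weight \<open>eps j * ratio j ^ k\<close>. The large ratio
  makes the Hilbert-Schmidt norm of a spider small and pushes the chain from the centre to the ends
  of the legs. The scale \<open>eps\<close>, chosen last, makes the square of the total mass of a spider
  negligible compared with the mass of its centre, so that two independent visits to the same spider
  are much rarer than a visit to the centre.\<close>

definition ratio :: "nat \<Rightarrow> real" where "ratio j = 2 / r\<^sup>2 * (real j ^ 2 + 1)\<^sup>2 * 2 ^ j"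

text \<open>The total weight of the edges at a vertex in units of \<open>eps j\<close>: the centre
  has \<open>j\<close> edges of weight 1, level \<open>k\<close> has one of weight
  \<open>ratio j ^ (k - 1)\<close> towards the centre and one of weight \<open>ratio j ^ k\<close>
  away from it.\<close>

fun wt :: "spider_state \<Rightarrow> real" where
  "wt (j, i, k) = (if k = 0 then real j else ratio j ^ (k - 1) * (1 + ratio j))"

definition vol :: "nat \<Rightarrow> real" where "vol j = sum wt (block j)"

definition eps :: "nat \<Rightarrow> real" where "eps j = (r / 4 * (1 / 2) ^ j / vol j)\<^sup>2"

definition mass :: "spider_state \<Rightarrow> real" where "mass x = eps (fst x) * wt x"

fun to_base :: "spider_state \<Rightarrow> real" where
  "to_base (j, i, k) = (if k = j then eps j * ratio j ^ j else 0)"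

definition leg_weight :: "spider_state \<Rightarrow> spider_state \<Rightarrow> real" where
  "leg_weight x y = (if up x y then eps (fst x) * ratio (fst x) ^ snd (snd x)
     else if up y x then eps (fst y) * ratio (fst y) ^ snd (snd y) else 0)"

definition base_mass :: real where "base_mass = 1 - infsum mass blocks"

definition Q :: "spider_state \<Rightarrow> real" where "Q x = (if x = base then base_mass else mass x)"

text \<open>The loop at the base takes the mass that the edges to the spiders leave over. It
  completes the row sum of the base and makes the chain aperiodic.\<close>

definition W :: "spider_state \<Rightarrow> spider_state \<Rightarrow> real" where
  "W x y = (if x = base then if y = base then base_mass - infsum to_base blocks else to_base y
     else if y = base then to_base x else leg_weight x y)"

section \<open>Masses and weights of the spiders\<close>

lemma ratio_ge: "ratio j \<ge> 2 * (real j ^ 2 + 1)\<^sup>2"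
proof -
  have "r\<^sup>2 \<le> 1" using r by (simp add: power_le_one)
  then have a: "2 / r\<^sup>2 \<ge> 2" using r by (simp add: field_simps)
  have "2 * (real j ^ 2 + 1)\<^sup>2 * 1 \<le> 2 / r\<^sup>2 * (real j ^ 2 + 1)\<^sup>2 * 2 ^ j"
    using a by (intro mult_mono) auto
  then show ?thesis by (simp add: ratio_def)
qed

lemma ratio_ge_j: "ratio j \<ge> real j" "ratio j \<ge> 1"
proof -
  have "1 \<le> (real j ^ 2 + 1)\<^sup>2" by (simp add: power2_eq_square algebra_simps)
  then show "ratio j \<ge> 1" using ratio_ge[of j] by linarith
  have "real j \<le> real j ^ 2 + 1"
  proof (cases "j = 0")
    case False then show ?thesis by (simp add: power2_eq_square) (metis add_increasing2 le_square of_nat_le_iff of_nat_mult zero_le_one)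
  qed simp
  also have "\<dots> \<le> (real j ^ 2 + 1)\<^sup>2" by (simp add: self_le_power)
  also have "\<dots> \<le> 2 * (real j ^ 2 + 1)\<^sup>2" by simp
  finally show "ratio j \<ge> real j" using ratio_ge[of j] by linarith
qed

lemma wt_ge_1: "x \<in> blocks \<Longrightarrow> wt x \<ge> 1"
proof (cases x)
  case (fields j i k)
  assume "x \<in> blocks"
  then have j: "j \<ge> 1" using fields by (simp add: in_blocks)
  have "1 * 1 \<le> ratio j ^ (k - 1) * (1 + ratio j)"
    using ratio_ge_j(2)[of j] by (intro mult_mono) (auto simp: one_le_power)
  then show ?thesis using j fields by simp
qed

lemma block_sub: "j \<ge> 1 \<Longrightarrow> block j \<subseteq> blocks" by (auto simp: blocks_def)

lemma vol_ge_1: "j \<ge> 1 \<Longrightarrow> vol j \<ge> 1"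
proof -
  assume j: "j \<ge> 1"
  have "1 \<le> wt (j, 0, 0)" using j by simp
  also have "\<dots> \<le> vol j" unfolding vol_def
  proof (rule member_le_sum)
    show "0 \<le> wt x" if "x \<in> block j - {(j, 0, 0)}" for x
      using wt_ge_1[of x] block_sub[OF j] that by force
  qed (simp_all add: in_block finite_block)
  finally show ?thesis .
qed

lemma eps_pos: "j \<ge> 1 \<Longrightarrow> eps j > 0"
  using vol_ge_1[of j] r by (simp add: eps_def)

lemma mass_pos: "x \<in> blocks \<Longrightarrow> mass x > 0"
  using wt_ge_1[of x] eps_pos[of "fst x"] by (cases x) (auto simp: mass_def in_blocks simp del: wt.simps)

lemma sum_mass_block: "sum mass (block j) = eps j * vol j"
proof -
  have "sum mass (block j) = (\<Sum>x\<in>block j. eps j * wt x)"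
    by (rule sum.cong) (auto simp: mass_def in_block_fst)
  then show ?thesis by (simp add: vol_def sum_distrib_left)
qed

text \<open>\<open>eps\<close> is chosen for this identity. It bounds the total mass of the spiders,
  and it makes the squared mass of one spider at most \<open>eps j\<close>, which is the comparison
  needed for visits to the base.\<close>

lemma eps_vol: assumes j: "j \<ge> 1" shows "eps j * (vol j)\<^sup>2 = (r / 4 * (1 / 2) ^ j)\<^sup>2"
proof -
  have "r / 4 * (1 / 2) ^ j / vol j * vol j = r / 4 * (1 / 2) ^ j" using vol_ge_1[OF j] by simp
  then show ?thesis by (simp only: eps_def power_mult_distrib[symmetric])
qed

lemma eps_vol_le: assumes j: "j \<ge> 1" shows "eps j * vol j \<le> r\<^sup>2 / 16 * (1 / 2) ^ j"
proof -
  have v: "vol j \<ge> 1" by (rule vol_ge_1[OF j])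
  have "eps j * vol j \<le> eps j * (vol j)\<^sup>2"
    using v eps_pos[OF j] by (intro mult_left_mono) (auto simp: self_le_power)
  also have "\<dots> = r\<^sup>2 / 16 * ((1 / 2) ^ j * (1 / 2) ^ j)"
    unfolding eps_vol[OF j] by (simp add: power2_eq_square)
  also have "\<dots> \<le> r\<^sup>2 / 16 * ((1 / 2) ^ j * 1)"
    by (intro mult_left_mono) (auto simp: power_le_one)
  finally show ?thesis by simp
qed

lemma sum_mass_le: "finite F \<Longrightarrow> F \<subseteq> blocks \<Longrightarrow> sum mass F \<le> r\<^sup>2 / 16"
proof (rule sum_blocks_le)
  show "sum mass (block j) \<le> r\<^sup>2 / 16 * (1 / 2) ^ j" if "1 \<le> j" for j
    unfolding sum_mass_block by (rule eps_vol_le[OF that])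
qed (simp_all add: mass_pos less_imp_le)

lemma summable_mass: "mass summable_on blocks"
  by (rule nonneg_bdd_above_summable_on) (auto simp: mass_pos less_imp_le intro!: bdd_aboveI2[where M="r\<^sup>2 / 16"] sum_mass_le)

lemma infsum_mass: "0 \<le> infsum mass blocks" "infsum mass blocks \<le> r\<^sup>2 / 16"
proof -
  show "0 \<le> infsum mass blocks" by (rule infsum_nonneg) (simp add: mass_pos less_imp_le)
  show "infsum mass blocks \<le> r\<^sup>2 / 16" by (rule infsum_le_finite_sums[OF summable_mass sum_mass_le])
qed

lemma r2_le: "r\<^sup>2 \<le> 1" "r\<^sup>2 \<le> r" "0 < r\<^sup>2"
proof -
  show "r\<^sup>2 \<le> 1" using r by (simp add: power_le_one)
  show "r\<^sup>2 \<le> r" using r mult_left_le[of r r] by (simp add: power2_eq_square)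
qed (use r in simp)

lemma base_mass: "base_mass \<ge> 15 / 16" "base_mass \<le> 1"
  using infsum_mass r2_le by (auto simp: base_mass_def)

lemma to_base_nonneg: "x \<in> blocks \<Longrightarrow> 0 \<le> to_base x"
proof -
  assume x: "x \<in> blocks"
  obtain j i k where "x = (j, i, k)" by (cases x)
  moreover have "0 \<le> ratio j" using ratio_ge_j(2)[of j] by simp
  ultimately show ?thesis using x eps_pos[of j] by (simp add: in_blocks)
qed

lemma to_base_le: "x \<in> blocks \<Longrightarrow> to_base x \<le> mass x"
proof (cases x)
  case (fields j i k)
  assume x: "x \<in> blocks"
  show ?thesis
  proof (cases "k = j")
    case True
    then have j: "j \<ge> 1" "k \<noteq> 0" using x fields by (auto simp: in_blocks)
    have "ratio j ^ j = ratio j ^ (j - 1) * ratio j" using j by (cases j) auto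
    also have "\<dots> \<le> ratio j ^ (j - 1) * (1 + ratio j)"
      using ratio_ge_j(2)[of j] by (intro mult_left_mono) auto
    finally show ?thesis using True j eps_pos[OF j(1)] fields by (simp add: mass_def)
  next
    case False then show ?thesis using mass_pos[OF x] fields by (simp add: less_imp_le)
  qed
qed

lemma summable_to_base: "to_base summable_on blocks"
  by (rule summable_on_comparison_test[OF summable_mass]) (auto simp: to_base_le to_base_nonneg)

lemma infsum_to_base: "0 \<le> infsum to_base blocks" "infsum to_base blocks \<le> r\<^sup>2 / 16"
proof -
  show "0 \<le> infsum to_base blocks" by (rule infsum_nonneg) (rule to_base_nonneg)
  have "infsum to_base blocks \<le> infsum mass blocks"
    by (rule infsum_mono[OF summable_to_base summable_mass]) (rule to_base_le)
  then show "infsum to_base blocks \<le> r\<^sup>2 / 16" using infsum_mass by simp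
qed

lemma W_base_base: "W base base > 0" "W base base \<le> base_mass"
  using infsum_to_base r2_le base_mass by (auto simp: W_def)

text \<open>The end of an edge farther from the centre is heavier than the edge by the factor
  \<open>ratio\<close>; this one-sided gain is the source of \<open>1 / ratio\<close> in
  \<open>leg_weight_sq\<close>.\<close>

lemma up_leg_weight:
  assumes "up x y" "x \<in> blocks" "y \<in> blocks"
  shows "leg_weight x y = eps (fst x) * ratio (fst x) ^ snd (snd x)" "leg_weight x y \<le> mass x" "ratio (fst x) * leg_weight x y \<le> mass y"
proof -
  obtain j i k i' where xy: "x = (j, i, k)" "y = (j, i', Suc k)" using assms(1) by (cases x; cases y) auto
  have j: "j \<ge> 1" using assms(2) xy by (simp add: in_blocks)
  have e: "eps j > 0" by (rule eps_pos[OF j])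
  have R: "ratio j \<ge> 1" by (rule ratio_ge_j)
  show 1: "leg_weight x y = eps (fst x) * ratio (fst x) ^ snd (snd x)" using assms(1) by (simp add: leg_weight_def)
  have "ratio j ^ k \<le> wt x"
  proof (cases "k = 0")
    case True then show ?thesis using j xy by simp
  next
    case False
    then have "ratio j ^ k = ratio j ^ (k - 1) * ratio j" by (cases k) auto
    also have "\<dots> \<le> ratio j ^ (k - 1) * (1 + ratio j)" using R by (intro mult_left_mono) auto
    finally show ?thesis using False xy by simp
  qed
  then show "leg_weight x y \<le> mass x" unfolding 1 mass_def using e xy by simp
  have "ratio j * ratio j ^ k \<le> wt y" using R xy by (simp add: algebra_simps)
  then have "eps j * (ratio j * ratio j ^ k) \<le> eps j * wt y" using e by (intro mult_left_mono) auto
  then show "ratio (fst x) * leg_weight x y \<le> mass y" unfolding 1 mass_def using xy by (simp add: algebra_simps)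
qed

lemma up_asym: "up x y \<Longrightarrow> \<not> up y x"
  by (cases x; cases y) auto

lemma leg_weight_sym: "leg_weight x y = leg_weight y x"
  using up_asym[of x y] by (auto simp: leg_weight_def)

lemma leg_weight_nonneg: "x \<in> blocks \<Longrightarrow> y \<in> blocks \<Longrightarrow> 0 \<le> leg_weight x y"
proof -
  assume "x \<in> blocks" "y \<in> blocks"
  then have "0 \<le> eps (fst x)" "0 \<le> eps (fst y)"
    using eps_pos[of "fst x"] eps_pos[of "fst y"] by (cases x; cases y; simp add: in_blocks less_imp_le)+
  moreover have "0 \<le> ratio j" for j using ratio_ge_j(2)[of j] by simp
  ultimately show ?thesis by (simp add: leg_weight_def)
qed

text \<open>A crude bound for all pairs in the same spider, adjacent or not, so that afterwards only
  the number of vertices has to be known.\<close>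

lemma leg_weight_sq:
  assumes "x \<in> blocks" "y \<in> blocks"
  shows "(leg_weight x y)\<^sup>2 / (mass x * mass y) \<le> (if fst x = fst y then 1 / ratio (fst x) else 0)"
proof -
  have *: "(leg_weight x y)\<^sup>2 / (mass x * mass y) \<le> 1 / ratio (fst x) \<and> fst x = fst y" if "up x y" "x \<in> blocks" "y \<in> blocks" for x y
  proof -
    have R: "ratio (fst x) \<ge> 1" by (rule ratio_ge_j)
    have "leg_weight x y * (ratio (fst x) * leg_weight x y) \<le> mass x * mass y"
      using up_leg_weight[OF that] leg_weight_nonneg[OF that(2,3)] mass_pos[OF that(2)] R by (intro mult_mono) auto
    then have "(leg_weight x y)\<^sup>2 * ratio (fst x) \<le> mass x * mass y" by (simp add: power2_eq_square mult.commute mult.left_commute)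
    moreover have "fst x = fst y" using that(1) by (cases x; cases y) auto
    ultimately show ?thesis using mass_pos[OF that(2)] mass_pos[OF that(3)] R
      by (simp add: divide_le_eq le_divide_eq mult.commute)
  qed
  show ?thesis
  proof (cases "up x y")
    case True
    then have "fst x = fst y" by (cases x; cases y) auto
    then show ?thesis using *[OF True assms] by (subst if_P) auto
  next
    case n: False
    show ?thesis
    proof (cases "up y x")
      case True
      then have e: "fst x = fst y" by (cases x; cases y) auto
      show ?thesis using *[OF True assms(2,1)] by (subst if_P[OF e]) (simp add: leg_weight_sym[of x y] e mult.commute)
    next
      case False then show ?thesis using n ratio_ge_j(2)[of "fst y"] by (simp add: leg_weight_def)
    qed
  qed
qed

definition states :: "spider_state set" where "states = insert base blocks"

lemma base_in_states: "base \<in> states" by (simp add: states_def)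

lemma base_not_fst: "x \<in> blocks \<Longrightarrow> x \<noteq> base"
  using base_notin by auto

lemma W_simps:
  "x \<in> blocks \<Longrightarrow> W x base = to_base x" "x \<in> blocks \<Longrightarrow> W base x = to_base x"
  "x \<in> blocks \<Longrightarrow> y \<in> blocks \<Longrightarrow> W x y = leg_weight x y"
  using base_not_fst by (auto simp: W_def)

lemma Q_simps: "Q base = base_mass" "x \<in> blocks \<Longrightarrow> Q x = mass x"
  using base_not_fst by (auto simp: Q_def)

lemma W_sym: "W x y = W y x"
  by (simp add: W_def leg_weight_sym)

lemma W_nonneg: "x \<in> states \<Longrightarrow> y \<in> states \<Longrightarrow> 0 \<le> W x y"
  using W_base_base(1) by (auto simp: states_def W_simps to_base_nonneg leg_weight_nonneg)

lemma Q_pos: "x \<in> states \<Longrightarrow> 0 < Q x"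
  using base_mass by (auto simp: states_def Q_simps mass_pos)

lemma has_sum_Q: "(Q has_sum 1) states"
proof -
  have "(mass has_sum infsum mass blocks) blocks" using summable_mass by (rule has_sum_infsum)
  then have "(Q has_sum infsum mass blocks) blocks"
    by (subst has_sum_cong[where g=mass]) (auto simp: Q_simps)
  then have "(Q has_sum (Q base + infsum mass blocks)) states"
    unfolding states_def by (rule has_sum_insert[OF base_notin])
  then show ?thesis by (simp add: Q_simps base_mass_def)
qed

lemma has_sum_W_base: "(W base has_sum Q base) states"
proof -
  have "(to_base has_sum infsum to_base blocks) blocks" using summable_to_base by (rule has_sum_infsum)
  then have "(W base has_sum infsum to_base blocks) blocks"
    by (subst has_sum_cong[where g=to_base]) (auto simp: W_simps)
  then have "(W base has_sum (W base base + infsum to_base blocks)) states"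
    unfolding states_def by (rule has_sum_insert[OF base_notin])
  then show ?thesis by (simp add: Q_simps W_def)
qed

lemma has_sum_W:
  assumes x: "x \<in> blocks" shows "(W x has_sum Q x) states"
proof -
  obtain j i k where f: "x = (j, i, k)" by (cases x)
  have j: "j \<ge> 1" using x f by (simp add: in_blocks)
  show ?thesis
  proof (cases "k = 0")
    case True
    then have i: "i = 0" using x f by (simp add: in_blocks)
    let ?B = "(\<lambda>i. (j, i, 1 :: nat)) ` {..<j}"
    have B: "?B \<subseteq> blocks" using j by (auto simp: in_blocks)
    have "leg_weight x y = eps j" if "y \<in> ?B" for y
      using that True f by (auto simp: leg_weight_def)
    then have We: "W x y = eps j" if "y \<in> ?B" for y
      using that B x by (auto simp: W_simps)
    have "sum (W x) ?B = (\<Sum>y\<in>?B. eps j)"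
    proof (rule sum.cong[OF refl])
      fix y assume "y \<in> ?B"
      then show "W x y = eps j" by (rule We)
    qed
    also have "\<dots> = eps j * real j" by (simp add: card_image inj_on_def)
    finally have s: "Q x = sum (W x) ?B" using x True f by (simp add: Q_simps mass_def)
    show ?thesis
    proof (rule has_sum_finite_neutralI[OF _ _ _ s])
      show "W x y = 0" if y: "y \<in> states - ?B" for y
      proof (cases "y = base")
        case True then show ?thesis using x f \<open>k = 0\<close> j by (simp add: W_simps)
      next
        case False
        then have yb: "y \<in> blocks" using y by (auto simp: states_def)
        obtain j' i' k' where g: "y = (j', i', k')" by (cases y)
        have "\<not> up x y" "\<not> up y x" using y yb g f \<open>k = 0\<close> by (auto simp: in_blocks)
        then show ?thesis using x yb by (simp add: W_simps leg_weight_def)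
      qed
    qed (use B in \<open>auto simp: states_def\<close>)
  next
    case False
    then have ik: "i < j" "1 \<le> k" "k \<le> j" using x f by (auto simp: in_blocks)
    \<comment> \<open>The only two neighbours of a leg vertex. From level 1 the inner one is the
      centre, whose leg index is 0; from level \<open>j\<close> the outer one is the base.\<close>
    define pv where "pv = (j, (if k = 1 then 0 else i), k - 1)"
    define nx where "nx = (if k = j then base else (j, i, Suc k))"
    have pv: "pv \<in> blocks" using ik by (auto simp: pv_def in_blocks)
    have nx: "nx \<in> states" using ik by (auto simp: nx_def states_def in_blocks)
    have ne: "pv \<noteq> nx" using pv base_notin by (auto simp: nx_def pv_def)
    have upv: "up pv x" using ik f by (auto simp: pv_def)
    have 1: "W x pv = eps j * ratio j ^ (k - 1)"
      using upv up_asym[OF upv] x pv f by (simp add: W_simps leg_weight_def) (simp add: pv_def)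
    have 2: "W x nx = eps j * ratio j ^ k"
    proof (cases "k = j")
      case True then show ?thesis using x f by (simp add: nx_def W_simps)
    next
      case F: False
      then have "up x nx" "nx \<in> blocks" using ik f by (auto simp: nx_def in_blocks)
      then show ?thesis using x f by (simp add: W_simps leg_weight_def)
    qed
    have "ratio j ^ k = ratio j ^ (k - 1) * ratio j" using ik by (cases k) auto
    then have s: "Q x = sum (W x) {pv, nx}" using ne 1 2 x f False by (simp add: Q_simps mass_def algebra_simps)
    show ?thesis
    proof (rule has_sum_finite_neutralI[OF _ _ _ s])
      show "W x y = 0" if y: "y \<in> states - {pv, nx}" for y
      proof (cases "y = base")
        case True
        then have "k \<noteq> j" using y by (auto simp: nx_def)
        then show ?thesis using x f True by (simp add: W_simps)
      next
        case False
        then have yb: "y \<in> blocks" using y by (auto simp: states_def)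
        obtain j' i' k' where g: "y = (j', i', k')" by (cases y)
        have "\<not> up x y" using y yb g f ik by (auto simp: in_blocks nx_def split: if_splits)
        moreover have "\<not> up y x" using y yb g f ik by (auto simp: in_blocks pv_def split: if_splits)
        ultimately show ?thesis using x yb by (simp add: W_simps leg_weight_def)
      qed
    qed (use pv nx in \<open>auto simp: states_def\<close>)
  qed
qed

section \<open>Enumeration of the vertices\<close>

lemma countable_states: "countable states" by simp

lemma infinite_states: "infinite states"
proof -
  have "inj_on (\<lambda>j. (j, 0, 0) :: spider_state) {1..}" by (auto simp: inj_on_def)
  then have "infinite ((\<lambda>j. (j, 0, 0) :: spider_state) ` {1..})"
    by (simp add: finite_image_iff infinite_Ici)
  moreover have "(\<lambda>j. (j, 0, 0) :: spider_state) ` {1..} \<subseteq> states" by (auto simp: states_def in_blocks)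
  ultimately show ?thesis using finite_subset by blast
qed

text \<open>The path measure is built on natural numbers. As there are infinitely many vertices, the
  enumeration is a bijection with all of them, and every natural number is a state of positive
  mass.\<close>

definition lab :: "nat \<Rightarrow> spider_state" where "lab = from_nat_into states"

definition code :: "spider_state \<Rightarrow> nat" where "code = to_nat_on states"

lemma bij_lab: "bij_betw lab UNIV states"
  unfolding lab_def by (rule bij_betw_from_nat_into[OF countable_states infinite_states])

lemma lab_in [simp]: "lab n \<in> states"
  using bij_lab by (auto simp: bij_betw_def)

lemma lab_code [simp]: "x \<in> states \<Longrightarrow> lab (code x) = x"
  by (simp add: lab_def code_def countable_states)

lemma code_lab [simp]: "code (lab n) = n"
  using to_nat_on_from_nat_into_infinite[OF countable_states infinite_states] by (simp add: lab_def code_def)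

sublocale E: edge_weights "\<lambda>x y. W (lab x) (lab y)" "\<lambda>x. Q (lab x)"
proof
  show "((\<lambda>y. W (lab x) (lab y)) has_sum Q (lab x)) UNIV" for x
  proof -
    have "(W (lab x) has_sum Q (lab x)) states"
      using lab_in[of x] has_sum_W[of "lab x"] has_sum_W_base unfolding states_def by auto
    then show ?thesis using has_sum_reindex_bij_betw[OF bij_lab, of "W (lab x)"] by simp
  qed
  show "((\<lambda>x. Q (lab x)) has_sum 1) UNIV"
    using has_sum_Q has_sum_reindex_bij_betw[OF bij_lab, of Q] by simp
  show "W (lab x) (lab y) = W (lab y) (lab x)" for x y by (rule W_sym)
qed (simp_all add: W_nonneg Q_pos)

lemma finite_lab_sum:
  assumes "finite F" shows "(\<Sum>n\<in>F. f (lab n)) = sum f (lab ` F)"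
proof -
  have "inj_on lab F" using bij_lab by (auto simp: bij_betw_def intro: inj_on_subset)
  then show ?thesis by (simp add: sum.reindex)
qed

section \<open>Hilbert-Schmidt norm and entropy of the spider chain\<close>

lemma ratio_pos: "0 < ratio j" using ratio_ge_j(2)[of j] by simp

text \<open>Explains the shape of \<open>ratio\<close>: the squared factor pays for all pairs of
  vertices of a spider, the power of 2 makes the spiders summable, and the constant leaves half of
  the budget, \<open>r\<^sup>2 / 2\<close>.\<close>

lemma card_ratio: "j \<ge> 1 \<Longrightarrow> (real j ^ 2 + 1)\<^sup>2 / ratio j = r\<^sup>2 / 2 * (1 / 2) ^ j"
proof -
  have "(real j ^ 2 + 1)\<^sup>2 > 0" by (rule zero_less_power) (simp add: add_nonneg_pos)
  then have "a / (2 / r\<^sup>2 * a * b) = r\<^sup>2 / 2 * (1 / b)" if "a = (real j ^ 2 + 1)\<^sup>2" for a b :: real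
    using that r by (simp add: field_simps)
  then show ?thesis by (simp add: ratio_def power_one_over)
qed

lemma row_term_nonneg: "x \<in> states \<Longrightarrow> y \<in> states \<Longrightarrow> 0 \<le> (W x y)\<^sup>2 / (Q x * Q y)"
  using Q_pos[of x] Q_pos[of y] by simp

text \<open>The loop accounts for the 1. An edge to a spider vertex is at most as heavy as that
  vertex, and the base has at least half of the total mass, whence the factor 2.\<close>

lemma row_bound_base:
  assumes F: "finite F" "F \<subseteq> states"
  shows "(\<Sum>y\<in>F. (W base y)\<^sup>2 / (Q base * Q y)) \<le> 1 + r\<^sup>2 / 8"
proof -
  have "(\<Sum>y\<in>F. (W base y)\<^sup>2 / (Q base * Q y)) \<le> (\<Sum>y\<in>insert base (F - {base}). (W base y)\<^sup>2 / (Q base * Q y))"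
    using F base_in_states by (intro sum_mono2 row_term_nonneg) auto
  also have "\<dots> = (W base base)\<^sup>2 / (Q base * Q base) + (\<Sum>y\<in>F - {base}. (W base y)\<^sup>2 / (Q base * Q y))"
    using F by (subst sum.insert) auto
  also have "(W base base)\<^sup>2 / (Q base * Q base) \<le> 1"
  proof -
    have "(W base base)\<^sup>2 \<le> (Q base)\<^sup>2" using W_base_base by (intro power_mono) (auto simp: Q_simps)
    then show ?thesis using base_mass by (simp add: Q_simps power2_eq_square)
  qed
  also have "(\<Sum>y\<in>F - {base}. (W base y)\<^sup>2 / (Q base * Q y)) \<le> (\<Sum>y\<in>F - {base}. 2 * mass y)"
  proof (rule sum_mono)
    fix y assume "y \<in> F - {base}"
    then have y: "y \<in> blocks" using F by (auto simp: states_def)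
    have "(to_base y)\<^sup>2 \<le> (mass y)\<^sup>2" using to_base_le[OF y] to_base_nonneg[OF y] by (rule power_mono)
    also have "\<dots> \<le> 2 * mass y * (base_mass * mass y)"
      using base_mass mass_pos[OF y] by (simp add: power2_eq_square)
    finally show "(W base y)\<^sup>2 / (Q base * Q y) \<le> 2 * mass y"
      using base_mass mass_pos[OF y] y by (simp add: Q_simps W_simps divide_le_eq)
  qed
  also have "\<dots> \<le> r\<^sup>2 / 8"
  proof -
    have "sum mass (F - {base}) \<le> r\<^sup>2 / 16" by (rule sum_mass_le) (use F in \<open>auto simp: states_def\<close>)
    then show ?thesis by (simp add: sum_distrib_left[symmetric])
  qed
  finally show ?thesis by simp
qed

text \<open>The first summand is the possible edge to the base; the second charges
  \<open>1 / ratio\<close> to each vertex of the same spider.\<close>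

lemma row_bound_block:
  assumes F: "finite F" "F \<subseteq> states" and x: "x \<in> blocks"
  shows "(\<Sum>y\<in>F. (W x y)\<^sup>2 / (Q x * Q y)) \<le> 2 * mass x + (real (fst x) ^ 2 + 1) / ratio (fst x)"
proof -
  have x': "x \<in> states" using x by (simp add: states_def)
  have "(\<Sum>y\<in>F. (W x y)\<^sup>2 / (Q x * Q y)) \<le> (\<Sum>y\<in>insert base (F - {base}). (W x y)\<^sup>2 / (Q x * Q y))"
    using F base_in_states x' by (intro sum_mono2 row_term_nonneg) auto
  also have "\<dots> = (W x base)\<^sup>2 / (Q x * Q base) + (\<Sum>y\<in>F - {base}. (W x y)\<^sup>2 / (Q x * Q y))"
    using F by (subst sum.insert) auto
  also have "(W x base)\<^sup>2 / (Q x * Q base) \<le> 2 * mass x"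
  proof -
    have "(to_base x)\<^sup>2 \<le> (mass x)\<^sup>2" using to_base_le[OF x] to_base_nonneg[OF x] by (rule power_mono)
    also have "\<dots> \<le> 2 * mass x * (mass x * base_mass)"
      using base_mass mass_pos[OF x] by (simp add: power2_eq_square)
    finally show ?thesis using base_mass mass_pos[OF x] x by (simp add: Q_simps W_simps divide_le_eq)
  qed
  also have "(\<Sum>y\<in>F - {base}. (W x y)\<^sup>2 / (Q x * Q y)) \<le> (\<Sum>y\<in>F - {base}. if y \<in> block (fst x) then 1 / ratio (fst x) else 0)"
  proof (rule sum_mono)
    fix y assume "y \<in> F - {base}"
    then have y: "y \<in> blocks" using F by (auto simp: states_def)
    have "fst x = fst y \<longleftrightarrow> y \<in> block (fst x)" using y by (cases y) (auto simp: in_block in_blocks)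
    then show "(W x y)\<^sup>2 / (Q x * Q y) \<le> (if y \<in> block (fst x) then 1 / ratio (fst x) else 0)"
      using leg_weight_sq[OF x y] x y by (simp add: Q_simps W_simps split: if_splits)
  qed
  also have "\<dots> = (\<Sum>y\<in>(F - {base}) \<inter> block (fst x). 1 / ratio (fst x))"
    by (rule sum.inter_restrict[symmetric]) (use F in simp)
  also have "\<dots> = real (card ((F - {base}) \<inter> block (fst x))) / ratio (fst x)" by simp
  also have "\<dots> \<le> (real (fst x) ^ 2 + 1) / ratio (fst x)"
  proof (intro divide_right_mono)
    have "card ((F - {base}) \<inter> block (fst x)) \<le> card (block (fst x))" by (intro card_mono finite_block) auto
    also have "\<dots> \<le> (fst x)\<^sup>2 + 1" by (rule card_block)
    finally have "real (card ((F - {base}) \<inter> block (fst x))) \<le> real ((fst x)\<^sup>2 + 1)" by (simp only: of_nat_le_iff)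
    then show "real (card ((F - {base}) \<inter> block (fst x))) \<le> real (fst x) ^ 2 + 1" by simp
  qed (use ratio_pos in \<open>simp add: less_imp_le\<close>)
  finally show ?thesis by simp
qed

lemma step_chi2_le: "E.step_chi2 1 \<le> ennreal (r\<^sup>2)"
proof (rule E.step_chi2_from_rows)
  define g where "g x = (if x = base then 1 + r\<^sup>2 / 8 else 2 * mass x + (real (fst x) ^ 2 + 1) / ratio (fst x))" for x
  show "(\<Sum>y\<in>F. (W (lab x) (lab y))\<^sup>2 / (Q (lab x) * Q (lab y))) \<le> g (lab x)" if F: "finite F" for x F
  proof -
    have *: "finite (lab ` F)" "lab ` F \<subseteq> states" using F by auto
    have "(\<Sum>y\<in>F. (W (lab x) (lab y))\<^sup>2 / (Q (lab x) * Q (lab y))) = (\<Sum>y\<in>lab ` F. (W (lab x) y)\<^sup>2 / (Q (lab x) * Q y))"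
      using finite_lab_sum[OF F, of "\<lambda>y. (W (lab x) y)\<^sup>2 / (Q (lab x) * Q y)"] by simp
    also have "\<dots> \<le> g (lab x)"
      using row_bound_base[OF *] row_bound_block[OF *, of "lab x"] lab_in[of x] by (auto simp: g_def states_def)
    finally show ?thesis .
  qed
  show "(\<Sum>x\<in>F. g (lab x)) \<le> 1 + r\<^sup>2" if F: "finite F" for F
  proof -
    let ?h = "\<lambda>x. (real (fst x) ^ 2 + 1) / ratio (fst x)"
    have G: "finite (lab ` F - {base})" "lab ` F - {base} \<subseteq> blocks"
    proof -
      have "lab ` F \<subseteq> insert base blocks" by (simp add: states_def[symmetric] image_subset_iff)
      then show "lab ` F - {base} \<subseteq> blocks" by blast
    qed (use F in simp)
    have h0: "0 \<le> ?h x" for x :: spider_state using ratio_pos[of "fst x"] by simp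
    have h: "sum ?h (lab ` F - {base}) \<le> r\<^sup>2 / 2"
    proof (rule sum_blocks_le[OF G])
      fix j :: nat assume j: "1 \<le> j"
      have "sum ?h (block j) = (\<Sum>x\<in>block j. (real j ^ 2 + 1) / ratio j)"
        by (rule sum.cong) (auto simp: in_block_fst)
      also have "\<dots> = real (card (block j)) * ((real j ^ 2 + 1) / ratio j)" by simp
      also have "\<dots> \<le> (real j ^ 2 + 1) * ((real j ^ 2 + 1) / ratio j)"
      proof (rule mult_right_mono)
        have "real (card (block j)) \<le> real (j\<^sup>2 + 1)" using card_block[of j] by (simp only: of_nat_le_iff)
        then show "real (card (block j)) \<le> real j ^ 2 + 1" by simp
      qed (use ratio_pos[of j] in simp)
      also have "\<dots> = r\<^sup>2 / 2 * (1 / 2) ^ j" using card_ratio[OF j] by (simp add: power2_eq_square)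
      finally show "sum ?h (block j) \<le> r\<^sup>2 / 2 * (1 / 2) ^ j" .
    qed (use h0 in auto)
    have g0: "0 \<le> g x" if "x \<in> states" for x
      using that h0[of x] mass_pos[of x] by (auto simp: g_def states_def less_imp_le)
    have "(\<Sum>x\<in>F. g (lab x)) = sum g (lab ` F)" by (rule finite_lab_sum[OF F])
    also have "\<dots> \<le> sum g (insert base (lab ` F - {base}))"
    proof (rule sum_mono2)
      fix x assume "x \<in> insert base (lab ` F - {base}) - lab ` F"
      then have "x \<in> states" using base_in_states by auto
      then show "0 \<le> g x" by (rule g0)
    qed (use F in auto)
    also have "\<dots> = g base + sum g (lab ` F - {base})" using F by (subst sum.insert) auto
    also have "sum g (lab ` F - {base}) = 2 * sum mass (lab ` F - {base}) + sum ?h (lab ` F - {base})"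
      unfolding sum_distrib_left sum.distrib[symmetric] by (rule sum.cong) (auto simp: g_def)
    \<comment> \<open>The budget: the row of the base, the edges from the spiders to the base, and
      the edges inside the spiders. Beyond the 1 they add up to three quarters of
      \<open>r\<^sup>2\<close>.\<close>
    finally have "(\<Sum>x\<in>F. g (lab x)) \<le> 1 + r\<^sup>2 / 8 + (2 * (r\<^sup>2 / 16) + r\<^sup>2 / 2)"
      using sum_mass_le[OF G] h by (simp add: g_def)
    also have "\<dots> \<le> 1 + r\<^sup>2" by simp
    finally show ?thesis .
  qed
qed simp


text \<open>The base contributes at most \<open>1 - base_mass\<close>, since
  \<open>- (t * ln t) \<le> 1 - t\<close>. The spiders contribute square roots of masses, which the
  definition of \<open>eps\<close> as a square makes summable with total at most
  \<open>r / 2\<close>.\<close>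

lemma entropy_bound:
  assumes F: "finite F" shows "(\<Sum>n\<in>F. - (pmf E.p n * ln (pmf E.p n))) \<le> r"
proof -
  let ?f = "\<lambda>x. - (Q x * ln (Q x))"
  have G: "finite (lab ` F - {base})" "lab ` F - {base} \<subseteq> blocks"
  proof -
    have "lab ` F \<subseteq> insert base blocks" by (simp add: states_def[symmetric] image_subset_iff)
    then show "lab ` F - {base} \<subseteq> blocks" by blast
  qed (use F in simp)
  have fb: "0 \<le> ?f base" "?f base \<le> r\<^sup>2 / 16"
  proof -
    have b: "0 < base_mass" "base_mass \<le> 1" using base_mass by auto
    then show "0 \<le> ?f base" by (simp add: Q_simps mult_le_0_iff ln_le_zero_iff less_imp_le)
    have "- ln base_mass = ln (1 / base_mass)" using b by (simp add: ln_div)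
    also have "\<dots> \<le> 1 / base_mass - 1" using b by (intro ln_le_minus_one) simp
    finally have "base_mass * (- ln base_mass) \<le> base_mass * (1 / base_mass - 1)"
      using b by (intro mult_left_mono) auto
    also have "\<dots> = 1 - base_mass" using b by (simp add: right_diff_distrib)
    also have "\<dots> \<le> r\<^sup>2 / 16" using infsum_mass by (simp add: base_mass_def)
    finally show "?f base \<le> r\<^sup>2 / 16" by (simp add: Q_simps)
  qed
  have "(\<Sum>n\<in>F. - (pmf E.p n * ln (pmf E.p n))) = sum ?f (lab ` F)"
    using finite_lab_sum[OF F, of ?f] by (simp add: E.pmf_p)
  also have "\<dots> \<le> ?f base + sum ?f (lab ` F - {base})"
    using fb(1) F by (cases "base \<in> lab ` F") (simp_all add: sum.remove)
  also have "sum ?f (lab ` F - {base}) \<le> (\<Sum>x\<in>lab ` F - {base}. 2 * sqrt (mass x))"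
  proof (rule sum_mono)
    fix x assume "x \<in> lab ` F - {base}"
    then have x: "x \<in> blocks" using G(2) by blast
    show "?f x \<le> 2 * sqrt (mass x)" unfolding Q_simps(2)[OF x] by (rule entropy_term_le[OF mass_pos[OF x]])
  qed
  also have "\<dots> \<le> r / 2"
  proof (rule sum_blocks_le[OF G])
    fix j :: nat assume j: "1 \<le> j"
    let ?a = "r / 4 * (1 / 2) ^ j / vol j"
    have a: "0 \<le> ?a" using r vol_ge_1[OF j] by simp
    \<comment> \<open>As \<open>wt x \<ge> 1\<close>, the root of \<open>wt x\<close> is at most
      \<open>wt x\<close>; the sum over the spider is then a multiple of \<open>vol j\<close>, which
      cancels the denominator of \<open>?a\<close>.\<close>
    have "(\<Sum>x\<in>block j. 2 * sqrt (mass x)) \<le> (\<Sum>x\<in>block j. 2 * ?a * wt x)"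
    proof (rule sum_mono)
      fix x assume x: "x \<in> block j"
      then have w: "wt x \<ge> 1" using wt_ge_1 block_sub[OF j] by blast
      have "sqrt (a\<^sup>2 * w) = a * sqrt w" if "0 \<le> a" for a w :: real using that by (simp add: real_sqrt_mult)
      from this[OF a] have "sqrt (mass x) = ?a * sqrt (wt x)"
        by (simp only: mass_def eps_def in_block_fst[OF x])
      moreover have "sqrt (wt x) \<le> wt x" using w by (intro real_le_lsqrt) (auto simp: self_le_power)
      then have "?a * sqrt (wt x) \<le> ?a * wt x" using a by (rule mult_left_mono)
      ultimately show "2 * sqrt (mass x) \<le> 2 * ?a * wt x" by linarith
    qed
    also have "\<dots> = 2 * ?a * vol j" by (simp only: vol_def sum_distrib_left)
    also have "\<dots> = r / 2 * (1 / 2) ^ j" using vol_ge_1[OF j] by simp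
    finally show "(\<Sum>x\<in>block j. 2 * sqrt (mass x)) \<le> r / 2 * (1 / 2) ^ j" .
  qed (use r mass_pos in \<open>auto simp: less_imp_le\<close>)
  finally have "(\<Sum>n\<in>F. - (pmf E.p n * ln (pmf E.p n))) \<le> r\<^sup>2 / 16 + r / 2" using fb(2) by simp
  also have "\<dots> \<le> r" using r2_le r by simp
  finally show ?thesis .
qed

section \<open>Connectivity and runs along the legs\<close>

lemma edge_iff: "x \<in> states \<Longrightarrow> y \<in> states \<Longrightarrow> (code x, code y) \<in> E.edges \<longleftrightarrow> 0 < W x y"
  by (simp add: E.edges_iff)

lemma leg_weight_pos_iff:
  assumes "x \<in> blocks" "y \<in> blocks" shows "0 < leg_weight x y \<longleftrightarrow> up x y \<or> up y x"
proof -
  have "0 < eps (fst x)" "0 < eps (fst y)"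
    using assms eps_pos[of "fst x"] eps_pos[of "fst y"] by (cases x; cases y; simp add: in_blocks)+
  then show ?thesis using ratio_pos by (auto simp: leg_weight_def)
qed

lemma leg_connected:
  assumes "x \<in> blocks" shows "(code x, code base) \<in> E.edges\<^sup>*"
proof -
  have leg: "(code (j, i, k), code base) \<in> E.edges\<^sup>*" if "j - k = d" "i < j" "1 \<le> k" "k \<le> j" for j i k d
    using that
  proof (induction d arbitrary: k)
    case 0
    then have x: "(j, i, k) \<in> blocks" "k = j" by (auto simp: in_blocks)
    then have "0 < to_base (j, i, k)" using eps_pos[of j] ratio_pos[of j] 0 by simp
    then have "(code (j, i, k), code base) \<in> E.edges"
      using x by (subst edge_iff) (auto simp: states_def W_simps)
    then show ?case by blast
  next
    case (Suc d)
    then have x: "(j, i, k) \<in> blocks" "(j, i, Suc k) \<in> blocks" by (auto simp: in_blocks)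
    then have "(code (j, i, k), code (j, i, Suc k)) \<in> E.edges"
      by (subst edge_iff) (auto simp: states_def W_simps leg_weight_pos_iff)
    moreover have "(code (j, i, Suc k), code base) \<in> E.edges\<^sup>*" using Suc by auto
    ultimately show ?case by (rule converse_rtrancl_into_rtrancl)
  qed
  obtain j i k where f: "x = (j, i, k)" by (cases x)
  show ?thesis
  proof (cases "k = 0")
    case False
    then show ?thesis using assms f leg[OF refl, of i j k] by (auto simp: in_blocks)
  next
    case True
    then have j: "j \<ge> 1" "i = 0" using assms f by (auto simp: in_blocks)
    then have "(j, 0, 1) \<in> blocks" by (simp add: in_blocks)
    then have "(code x, code (j, 0, 1)) \<in> E.edges"
      using assms f True j by (subst edge_iff) (auto simp: states_def W_simps leg_weight_pos_iff)
    moreover have "(code (j, 0, 1), code base) \<in> E.edges\<^sup>*" using j by (intro leg[OF refl]) auto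
    ultimately show ?thesis by (rule converse_rtrancl_into_rtrancl)
  qed
qed

lemma connected: "(x, code base) \<in> E.edges\<^sup>*"
proof -
  have "lab x = base \<or> lab x \<in> blocks" using lab_in[of x] by (auto simp: states_def)
  then show ?thesis using leg_connected[of "lab x"] code_lab[of x] by (metis rtrancl.rtrancl_refl)
qed

lemma base_loop: "pmf (E.K (code base)) (code base) > 0"
  using W_base_base(1) Q_pos[OF base_in_states] by (simp add: E.pmf_K base_in_states)

lemma leg_step:
  assumes "i < j" "1 \<le> k" "k < j"
  shows "pmf (E.K (code (j, i, k))) (code (j, i, Suc k)) = ratio j / (1 + ratio j)"
proof -
  have x: "(j, i, k) \<in> blocks" "(j, i, Suc k) \<in> blocks" using assms by (auto simp: in_blocks)
  have e: "eps j > 0" using eps_pos assms by simp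
  have R: "ratio j > 0" by (rule ratio_pos)
  have "ratio j ^ k = ratio j ^ (k - 1) * ratio j" using assms by (cases k) auto
  then have "pmf (E.K (code (j, i, k))) (code (j, i, Suc k)) = eps j * (ratio j ^ (k - 1) * ratio j) / (eps j * (ratio j ^ (k - 1) * (1 + ratio j)))"
    using x assms by (simp add: E.pmf_K states_def W_simps Q_simps mass_def leg_weight_def)
  then show ?thesis using e R by simp
qed

lemma centre_step:
  assumes "i < j"
  shows "pmf (E.K (code (j, 0, 0))) (code (j, i, 1)) = 1 / real j"
proof -
  have x: "(j, 0, 0) \<in> blocks" "(j, i, 1) \<in> blocks" using assms by (auto simp: in_blocks)
  have e: "eps j > 0" using eps_pos assms by simp
  have "pmf (E.K (code (j, 0, 0))) (code (j, i, 1)) = eps j / (eps j * real j)"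
    using x assms by (simp add: E.pmf_K states_def W_simps Q_simps mass_def leg_weight_def)
  then show ?thesis using e by simp
qed

text \<open>Only the run straight down the leg is counted.\<close>

lemma leg_kstep:
  "i < j \<Longrightarrow> 1 \<le> k \<Longrightarrow> k + m \<le> j \<Longrightarrow>
    pmf (E.kstep m (code (j, i, k))) (code (j, i, k + m)) \<ge> (ratio j / (1 + ratio j)) ^ m"
proof (induction m arbitrary: k)
  case (Suc m)
  have "(ratio j / (1 + ratio j)) ^ Suc m \<le> ratio j / (1 + ratio j) * pmf (E.kstep m (code (j, i, Suc k))) (code (j, i, Suc k + m))"
    unfolding power_Suc using Suc.prems ratio_pos[of j] by (intro mult_left_mono Suc.IH) auto
  also have "\<dots> = pmf (E.K (code (j, i, k))) (code (j, i, Suc k)) * pmf (E.kstep m (code (j, i, Suc k))) (code (j, i, Suc k + m))"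
    using Suc.prems by (subst leg_step) auto
  also have "\<dots> \<le> pmf (E.kstep (Suc m) (code (j, i, k))) (code (j, i, Suc k + m))" by (rule E.kstep_Suc_ge)
  finally show ?case by simp
qed simp

text \<open>The leg is chosen uniformly. Each later step turns back with probability
  \<open>1 / (1 + ratio j)\<close>, hence at most \<open>1 / j\<close>, and Bernoulli's inequality
  adds these failures up over \<open>n - 1\<close> steps.\<close>

lemma centre_kstep:
  assumes "i < j" "1 \<le> n" "n \<le> j"
  shows "pmf (E.kstep n (code (j, 0, 0))) (code (j, i, n)) \<ge> (1 / real j) * (1 - real n / real j)"
proof -
  obtain m where m: "n = Suc m" using assms by (cases n) auto
  have R: "ratio j > 0" "ratio j \<ge> real j" by (rule ratio_pos, rule ratio_ge_j)
  have jp: "real j > 0" using assms by simp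
  have "1 - real n / real j \<le> 1 - real m * (1 / (1 + ratio j))"
  proof -
    have "real m * (1 / (1 + ratio j)) \<le> real n * (1 / real j)"
      using m R jp by (intro mult_mono divide_left_mono) auto
    then show ?thesis by simp
  qed
  also have "\<dots> = 1 + real m * (- (1 / (1 + ratio j)))" by simp
  also have "\<dots> \<le> (1 + (- (1 / (1 + ratio j)))) ^ m"
    using R by (intro Bernoulli_inequality) (simp add: divide_le_eq)
  also have "1 + (- (1 / (1 + ratio j))) = ratio j / (1 + ratio j)" using R by (simp add: field_simps)
  also have "(ratio j / (1 + ratio j)) ^ m \<le> pmf (E.kstep m (code (j, i, 1))) (code (j, i, 1 + m))"
    using assms m by (intro leg_kstep) auto
  finally have "(1 / real j) * (1 - real n / real j) \<le> pmf (E.K (code (j, 0, 0))) (code (j, i, 1)) * pmf (E.kstep m (code (j, i, 1))) (code (j, i, 1 + m))"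
    using jp by (subst centre_step[OF assms(1)]) (intro mult_left_mono; simp)
  also have "\<dots> \<le> pmf (E.kstep (Suc m) (code (j, 0, 0))) (code (j, i, 1 + m))" by (rule E.kstep_Suc_ge)
  finally show ?thesis using m by simp
qed

text \<open>Within \<open>s\<close> steps a path that avoids the base moves at most \<open>s\<close> levels towards the centre,
  so it stays on its leg until it may have reached the centre.\<close>

definition on_leg :: "nat \<Rightarrow> nat \<Rightarrow> nat \<Rightarrow> nat set" where
  "on_leg j i l = {n. \<exists>i' k. lab n = (j, i', k) \<and> (k = 0 \<or> i' = i) \<and> l \<le> k}"

lemma on_leg_step:
  assumes j: "j \<ge> 1" and x: "x \<in> on_leg j i (Suc l)" and e: "(x, y) \<in> E.edges" and y: "y \<noteq> code base"
  shows "y \<in> on_leg j i l"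
proof -
  \<comment> \<open>The level is at least 1, so the vertex is not the centre and its leg is
    known.\<close>
  obtain k where k: "lab x = (j, i, k)" "Suc l \<le> k" using x by (auto simp: on_leg_def)
  have "lab x \<noteq> base" using j k by (auto simp: base_def)
  then have xb: "lab x \<in> blocks" using lab_in[of x] by (auto simp: states_def)
  have "lab y \<noteq> base" using y code_lab[of y] by metis
  then have yb: "lab y \<in> blocks" using lab_in[of y] by (auto simp: states_def)
  have "0 < leg_weight (lab x) (lab y)" using e xb yb by (simp add: E.edges_iff W_simps)
  then have ud: "up (lab x) (lab y) \<or> up (lab y) (lab x)" using leg_weight_pos_iff[OF xb yb] by simp
  obtain j' i' k' where g: "lab y = (j', i', k')" by (cases "lab y")
  have "j' = j \<and> (k' = 0 \<or> i' = i) \<and> l \<le> k'" using ud k g by auto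
  then show ?thesis using g by (auto simp: on_leg_def)
qed

text \<open>Follow the path forwards from \<open>- int n\<close> and backwards from
  \<open>int n\<close> until time 0. The vertex there lies on leg \<open>i\<close> or is the centre,
  and lies on leg \<open>i'\<close> or is the centre; the legs differ.\<close>

lemma forced_centre:
  assumes j: "j \<ge> 1" and path: "\<And>t. (\<omega> t, \<omega> (t + 1)) \<in> E.edges"
    and l: "lab (\<omega> (- int n)) = (j, i, n)" and r: "lab (\<omega> (int n)) = (j, i', n)" and ne: "i \<noteq> i'"
    and avoid: "\<And>t. t \<in> {- int n<..<int n} \<Longrightarrow> \<omega> t \<noteq> code base" and n: "n \<ge> 1"
  shows "\<omega> 0 = code (j, 0, 0)"
proof -
  have L: "\<omega> (- int n + int s) \<in> on_leg j i (n - s)" if "s \<le> n" for s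
    using that
  proof (induction s)
    case 0 then show ?case using l by (simp add: on_leg_def)
  next
    case (Suc s)
    have "\<omega> (- int n + int s) \<in> on_leg j i (Suc (n - Suc s))" using Suc by (simp add: Suc_diff_Suc)
    moreover have "(\<omega> (- int n + int s), \<omega> (- int n + int (Suc s))) \<in> E.edges"
      using path[of "- int n + int s"] by (simp add: add.commute add.left_commute)
    moreover have "\<omega> (- int n + int (Suc s)) \<noteq> code base" using Suc n by (intro avoid) auto
    ultimately show ?case by (rule on_leg_step[OF j])
  qed
  have R: "\<omega> (int n - int s) \<in> on_leg j i' (n - s)" if "s \<le> n" for s
    using that
  proof (induction s)
    case 0 then show ?case using r by (simp add: on_leg_def)
  next
    case (Suc s)
    have "\<omega> (int n - int s) \<in> on_leg j i' (Suc (n - Suc s))" using Suc by (simp add: Suc_diff_Suc)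
    moreover have "(\<omega> (int n - int s), \<omega> (int n - int (Suc s))) \<in> E.edges"
      using path[of "int n - int (Suc s)"] E.sym_edges by (auto dest: symD)
    moreover have "\<omega> (int n - int (Suc s)) \<noteq> code base" using Suc n by (intro avoid) auto
    ultimately show ?case by (rule on_leg_step[OF j])
  qed
  obtain a k b k' where "lab (\<omega> 0) = (j, a, k)" "k = 0 \<or> a = i" "lab (\<omega> 0) = (j, b, k')" "k' = 0 \<or> b = i'"
    using L[of n] R[of n] by (auto simp: on_leg_def)
  then have z: "lab (\<omega> 0) = (j, a, 0)" using ne by auto
  moreover have "(j, a, 0) \<in> states" using lab_in[of "\<omega> 0"] z by simp
  \<comment> \<open>A triple of level 0 is a vertex only if its leg index is 0.\<close>
  then have "a = 0" using j by (auto simp: states_def in_blocks base_def)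
  ultimately show ?thesis using code_lab[of "\<omega> 0"] by simp
qed

text \<open>The state is the centre of a large spider, and \<open>D\<close> consists of the pairs of
  level-\<open>n\<close> vertices on different legs. Both errors have to be small relative to the
  mass of the centre, which itself tends to 0 along the spiders.\<close>

lemma excursion_witness:
  assumes n: "n \<ge> 1" and e: "0 < e" "e < 1 / 4"
  shows "\<exists>x D. 0 < pmf E.p x \<and> pmf E.p x \<le> e
      \<and> measure E.path_measure {\<omega>. \<omega> 0 = x \<and> (\<omega> (- int n), \<omega> (int n)) \<in> D} \<ge> (1 - e) * pmf E.p x
      \<and> measure E.path_measure {\<omega>. \<omega> 0 \<noteq> x \<and> (\<omega> (- int n), \<omega> (int n)) \<in> D} \<le> e * pmf E.p x"
proof -
  \<comment> \<open>What is needed is \<open>n \<le> j\<close> and that \<open>1 / j\<close>,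
    \<open>3 * n / j\<close> and \<open>4 * n / j\<close> are at most \<open>e\<close>: for the mass
    of the centre, for the runs from it, and for the visits to the base. The constant 8 covers all
    of them.\<close>
  obtain j :: nat where je: "real j > 8 * real n / e" using reals_Archimedean2 by blast
  have n1: "1 \<le> real n" using n by simp
  have j0: "real j > 0" using je e n1 by (meson divide_nonneg_pos le_less_trans mult_nonneg_nonneg of_nat_0_le_iff zero_le_numeral)
  then have j: "j \<ge> 1" by simp
  have nj: "8 * real n / real j \<le> e" using je e j0 by (simp add: field_simps)
  have "real n \<le> real j"
  proof -
    have "8 * real n / real j \<le> 1" using nj e by simp
    then show ?thesis using j0 by (simp add: divide_le_eq)
  qed
  then have njn: "n \<le> j" by simp
  define c where "c = code (j, 0, 0)"
  define D where "D = (\<lambda>(i, i'). (code (j, i, n), code (j, i', n))) ` {(i, i'). i < j \<and> i' < j \<and> i \<noteq> i'}"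
  have cb: "(j, 0, 0) \<in> blocks" using j by (simp add: in_blocks)
  have lb: "(j, i, n) \<in> blocks" if "i < j" for i using that n njn by (simp add: in_blocks)
  have pc: "pmf E.p c = eps j * real j" using cb by (simp add: c_def E.pmf_p states_def Q_simps mass_def)
  have e0: "eps j > 0" by (rule eps_pos[OF j])
  have v: "vol j \<ge> 1" by (rule vol_ge_1[OF j])
  have jv: "real j \<le> vol j"
  proof -
    have "wt (j, 0, 0) \<le> vol j" unfolding vol_def
    proof (rule member_le_sum)
      show "0 \<le> wt x" if "x \<in> block j - {(j, 0, 0)}" for x
        using wt_ge_1[of x] block_sub[OF j] that by force
    qed (simp_all add: in_block finite_block)
    then show ?thesis by simp
  qed
  have ev: "eps j * (vol j)\<^sup>2 \<le> 1"
  proof -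
    have "r / 4 * (1 / 2) ^ j \<le> 1 * 1" using r by (intro mult_mono power_le_one) auto
    then show ?thesis unfolding eps_vol[OF j] using r by (intro power_le_one) auto
  qed
  have pos: "0 < pmf E.p c" using pc e0 j0 by simp
  have small: "pmf E.p c \<le> e"
  proof -
    \<comment> \<open>The volume is at least \<open>j\<close>, so the mass of the centre is at most
      \<open>1 / j\<close>.\<close>
    have "(eps j * real j) * real j \<le> eps j * (vol j)\<^sup>2"
      using e0 jv j0 by (simp add: power2_eq_square mult.assoc mult_mono)
    then have "pmf E.p c * real j \<le> 1" using ev pc by simp
    then have "pmf E.p c \<le> 1 / real j" using j0 by (simp add: le_divide_eq)
    also have "\<dots> \<le> 8 * real n / real j" using n1 j0 by (intro divide_right_mono) auto
    finally show ?thesis using nj by simp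
  qed
  have inj: "inj_on (\<lambda>(i, i'). (code (j, i, n), code (j, i', n))) {(i, i'). i < j \<and> i' < j \<and> i \<noteq> i'}"
  proof (rule inj_onI, clarify)
    fix a b a' b' assume *: "a < j" "b < j" "a' < j" "b' < j" and eq: "code (j, a, n) = code (j, a', n)" "code (j, b, n) = code (j, b', n)"
    have "lab (code (j, a, n)) = lab (code (j, a', n))" "lab (code (j, b, n)) = lab (code (j, b', n))" using eq by simp_all
    then show "a = a' \<and> b = b'" using lb * by (simp add: states_def)
  qed
  have finI: "finite {(i, i'). i < j \<and> i' < j \<and> i \<noteq> i'}"
    by (rule finite_subset[of _ "{..<j} \<times> {..<j}"]) auto
  have cardI: "real (card {(i, i'). i < j \<and> i' < j \<and> i \<noteq> i'}) = real j * real j - real j"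
  proof -
    have "{(i, i'). i < j \<and> i' < j \<and> i \<noteq> i'} = {..<j} \<times> {..<j} - (\<lambda>i. (i, i)) ` {..<j}" by auto
    then have "card {(i, i'). i < j \<and> i' < j \<and> i \<noteq> i'} = card ({..<j} \<times> {..<j}) - card ((\<lambda>i. (i, i)) ` {..<j})"
      by (simp only:) (rule card_Diff_subset; auto)
    also have "card ((\<lambda>i. (i, i)) ` {..<j}) = j" by (simp add: card_image inj_on_def)
    finally show ?thesis using j by (simp add: of_nat_diff)
  qed
  have mass_ge: "(1 - e) * pmf E.p c \<le> measure E.path_measure {\<omega>. \<omega> 0 = c \<and> (\<omega> (- int n), \<omega> (int n)) \<in> D}"
  proof -
    let ?t = "(1 / real j) * (1 - real n / real j)"
    have t0: "0 \<le> ?t" using njn j0 by (simp add: divide_le_eq)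
    have "measure E.path_measure {\<omega>. \<omega> 0 = c \<and> (\<omega> (- int n), \<omega> (int n)) \<in> D}
      = pmf E.p c * (\<Sum>(x, y)\<in>D. pmf (E.kstep n c) x * pmf (E.kstep n c) y)"
      by (rule E.centre_mass) (simp add: D_def finI)
    also have "\<dots> \<ge> pmf E.p c * (\<Sum>(x, y)\<in>D. ?t * ?t)"
    proof (intro mult_left_mono sum_mono)
      fix d assume "d \<in> D"
      then obtain i i' where "d = (code (j, i, n), code (j, i', n))" "i < j" "i' < j" by (auto simp: D_def)
      then show "(case d of (x, y) \<Rightarrow> ?t * ?t) \<le> (case d of (x, y) \<Rightarrow> pmf (E.kstep n c) x * pmf (E.kstep n c) y)"
        unfolding c_def using centre_kstep[OF _ n njn] t0 by (simp only: prod.case) (intro mult_mono; simp)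
    qed simp
    also have "(\<Sum>(x, y)\<in>D. ?t * ?t) = real (card D) * (?t * ?t)" by simp
    also have "real (card D) = real j * real j - real j" unfolding D_def card_image[OF inj] by (rule cardI)
    \<comment> \<open>The factor \<open>1 - 1 / real j\<close> is the probability that two uniformly
      chosen legs differ; the other two belong to the two runs. Each of the three is at least
      \<open>1 - real n / real j\<close>.\<close>
    also have "(real j * real j - real j) * (?t * ?t) = (1 - 1 / real j) * (1 - real n / real j) * (1 - real n / real j)"
      using j0 by (simp add: field_simps)
    finally have ge: "pmf E.p c * ((1 - 1 / real j) * (1 - real n / real j) * (1 - real n / real j))
      \<le> measure E.path_measure {\<omega>. \<omega> 0 = c \<and> (\<omega> (- int n), \<omega> (int n)) \<in> D}" .
    let ?u = "real n / real j"
    have u: "0 \<le> ?u" "8 * ?u \<le> e" "1 / real j \<le> ?u" using nj n1 j0 by (auto simp: divide_right_mono)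
    have u1: "?u \<le> 1" using u e by simp
    have cube: "1 - 3 * v \<le> (1 - v) * (1 - v) * (1 - v)" if "0 \<le> v" "v \<le> 1" for v :: real
    proof -
      have "(1 - v) * (1 - v) * (1 - v) - (1 - 3 * v) = v * v * (3 - v)" by (simp add: algebra_simps)
      moreover have "0 \<le> v * v * (3 - v)" using that by simp
      ultimately show ?thesis by linarith
    qed
    have "1 - 3 * ?u \<le> (1 - ?u) * (1 - ?u) * (1 - ?u)" by (rule cube[OF u(1) u1])
    also have "\<dots> \<le> (1 - 1 / real j) * (1 - ?u) * (1 - ?u)"
      using u u1 by (intro mult_right_mono) auto
    finally have "1 - e \<le> (1 - 1 / real j) * (1 - ?u) * (1 - ?u)" using u by linarith
    then have "(1 - e) * pmf E.p c \<le> (1 - 1 / real j) * (1 - ?u) * (1 - ?u) * pmf E.p c"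
      using pos by (intro mult_right_mono) auto
    then show ?thesis using ge by (simp only: mult.commute)
  qed
  let ?V = "code ` block j"
  have massV: "measure E.p ?V = eps j * vol j"
  proof -
    have "block j \<subseteq> states" using block_sub[OF j] by (auto simp: states_def)
    then have "inj_on code (block j)" by (metis inj_on_def lab_code subsetD)
    then have "measure E.p ?V = (\<Sum>x\<in>block j. pmf E.p (code x))"
      by (simp add: measure_measure_pmf_finite finite_block sum.reindex)
    also have "\<dots> = (\<Sum>x\<in>block j. mass x)"
    proof (rule sum.cong[OF refl])
      fix x assume "x \<in> block j"
      then have "x \<in> blocks" "x \<in> states" using block_sub[OF j] by (auto simp: states_def)
      then show "pmf E.p (code x) = mass x" by (simp add: E.pmf_p Q_simps)
    qed
    finally show ?thesis by (simp add: sum_mass_block)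
  qed
  have exc: "measure E.path_measure {\<omega>. \<omega> 0 \<noteq> c \<and> (\<omega> (- int n), \<omega> (int n)) \<in> D} \<le> e * pmf E.p c"
  proof -
    have "measure E.path_measure {\<omega>. \<omega> 0 \<noteq> c \<and> (\<omega> (- int n), \<omega> (int n)) \<in> D}
      \<le> real (2 * n) * ((measure E.p ?V)\<^sup>2 / pmf E.p (code base))"
    proof (rule E.excursion_bound)
      show "D \<subseteq> ?V \<times> ?V"
      proof
        fix d assume "d \<in> D"
        then obtain i i' where d: "d = (code (j, i, n), code (j, i', n))" "i < j" "i' < j" by (auto simp: D_def)
        then have "(j, i, n) \<in> block j" "(j, i', n) \<in> block j" using n njn by (auto simp: in_block)
        then show "d \<in> ?V \<times> ?V" using d by auto
      qed
      fix \<omega> :: "int \<Rightarrow> nat"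
      assume path: "\<And>t. (\<omega> t, \<omega> (t + 1)) \<in> E.edges" and w: "(\<omega> (- int n), \<omega> (int n)) \<in> D"
        and avoid: "\<And>t. t \<in> {- int n<..<int n} \<Longrightarrow> \<omega> t \<noteq> code base"
      obtain i i' where ii: "\<omega> (- int n) = code (j, i, n)" "\<omega> (int n) = code (j, i', n)" "i < j" "i' < j" "i \<noteq> i'"
        using w by (auto simp: D_def)
      show "\<omega> 0 = c" unfolding c_def
        using lb[OF ii(3)] lb[OF ii(4)] ii by (intro forced_centre[where \<omega>=\<omega> and j=j and n=n and i=i and i'=i', OF j path _ _ ii(5) avoid n]) (auto simp: states_def)
    qed
    also have "\<dots> \<le> real (2 * n) * ((measure E.p ?V)\<^sup>2 * 2)"
    proof (intro mult_left_mono)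
      have "pmf E.p (code base) \<ge> 1 / 2" using base_mass by (simp add: E.pmf_p base_in_states Q_simps)
      then show "(measure E.p ?V)\<^sup>2 / pmf E.p (code base) \<le> (measure E.p ?V)\<^sup>2 * 2"
        using mult_left_mono[of "1 / pmf E.p (code base)" 2 "(measure E.p ?V)\<^sup>2"] by (simp add: divide_le_eq)
    qed simp
    \<comment> \<open>Of the two factors \<open>eps j\<close> one is absorbed together with the
      squared volume, which leaves at most 1; the other equals \<open>pmf E.p c / real j\<close> and
      supplies the smallness relative to the centre.\<close>
    also have "(measure E.p ?V)\<^sup>2 = eps j * (eps j * (vol j)\<^sup>2)" by (simp add: massV power2_eq_square)
    also have "real (2 * n) * (eps j * (eps j * (vol j)\<^sup>2) * 2) \<le> real (2 * n) * (eps j * 1 * 2)"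
      using e0 ev by (intro mult_left_mono mult_right_mono) auto
    also have "\<dots> = (4 * real n / real j) * pmf E.p c" using j0 by (simp add: pc)
    also have "\<dots> \<le> e * pmf E.p c"
    proof (rule mult_right_mono)
      have "4 * real n / real j \<le> 8 * real n / real j" using j0 by (intro divide_right_mono) auto
      then show "4 * real n / real j \<le> e" using nj by simp
    qed simp
    finally show ?thesis .
  qed
  show ?thesis using pos small mass_ge exc by blast
qed

end

theorem theorem1p1:
  fixes r :: real
  assumes "0 < r" and "r < 1"
  shows "\<exists>(M :: (int \<Rightarrow> nat) measure) (S :: nat set) (X :: int \<Rightarrow> (int \<Rightarrow> nat) \<Rightarrow> nat).
    prob_space M \<and>
    strictly_stationary M (count_space S) X \<and>
    countable_state_markov_chain M S X \<and>
    irreducible_chain M S X \<and>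
    aperiodic_chain M S X \<and>
    reversible M (count_space S) X \<and>
    field_entropy M (generated_field M (count_space S) X {0}) \<le> ennreal r \<and>
    (\<forall>n::nat. n \<ge> 1 \<longrightarrow>
       max (rho_mix M (count_space S) X n)
         (max (beta_mix M (count_space S) X n) (info_mix M (count_space S) X n)) \<le> ereal (r ^ n)) \<and>
    (\<forall>n::nat. n \<ge> 1 \<longrightarrow>
       rho_star M (count_space S) X n =
         rho_coeff M (generated_field M (count_space S) X {0})
           (generated_field M (count_space S) X {- int n, int n}) \<and>
       rho_coeff M (generated_field M (count_space S) X {0})
           (generated_field M (count_space S) X {- int n, int n}) = 1)"
proof -
  interpret spider r by unfold_locales fact+
  show ?thesis
  proof (intro exI conjI allI impI)
    show "prob_space E.path_measure" by (rule E.prob_space_path_measure)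
    show "strictly_stationary E.path_measure (count_space UNIV) coord" by (rule E.stationary)
    show "countable_state_markov_chain E.path_measure UNIV coord" by (rule E.markov_chain)
    show "irreducible_chain E.path_measure UNIV coord" "aperiodic_chain E.path_measure UNIV coord"
      by (rule E.irreducible_aperiodic[OF base_loop connected])+
    show "reversible E.path_measure (count_space UNIV) coord" by (rule E.reversible_path_measure)
    show "field_entropy E.path_measure (generated_field E.path_measure (count_space UNIV) coord {0}) \<le> ennreal r"
      by (rule E.field_entropy_le[OF entropy_bound])
  next
    fix n :: nat assume n: "1 \<le> n"
    show "max (rho_mix E.path_measure (count_space UNIV) coord n)
        (max (beta_mix E.path_measure (count_space UNIV) coord n) (info_mix E.path_measure (count_space UNIV) coord n)) \<le> ereal (r ^ n)"
      using E.mixing_bounds[OF step_chi2_le _ _ n] r by simp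
    show "rho_star E.path_measure (count_space UNIV) coord n =
         rho_coeff E.path_measure (generated_field E.path_measure (count_space UNIV) coord {0})
           (generated_field E.path_measure (count_space UNIV) coord {- int n, int n})"
      "rho_coeff E.path_measure (generated_field E.path_measure (count_space UNIV) coord {0})
           (generated_field E.path_measure (count_space UNIV) coord {- int n, int n}) = 1"
      by (rule E.rho_star_eq_1[OF n excursion_witness[OF n]]; assumption)+
  qed
qed

end
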